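(* Let $M$ be a matroid of rank $d$ on $[n]$, and consider the map $\Phi$ sending $p=(p_B)_{B}\in\mathrm{R}_M(\mathbb{C})$ to the polynomial $\sum_{B}|p_B|^2x^B$. The image of $\Phi$ is contained in $\mathrm{L}_M$; in fact every polynomial in the image is stable. Moreover: (1) If $M$ has a $U_{2,4}$ minor, then $\Phi(\mathrm{R}_M(\mathbb{R}))\subseteq\partial\mathrm{L}_M$. (2) If $M$ has a $U_{2,5}$ minor, then $\Phi(\mathrm{R}_M(\mathbb{C}))\subseteq\partial\mathrm{L}_M$. (3) If $M=U_{2,4}$, then the induced map $\underline{\mathrm{Gr}}_M(\mathbb{R})\to\partial\underline{\mathrm{L}}_M$ is a homeomorphism. (4) The map $\mathrm{Gr}(2,4)(\mathbb{R})\to\partial\,\mathbb{P}\mathrm{L}(2,4)_{\boxtimes}$, $[p]\mapsto[\sum_S p_S^2x^S]$, is the quotient map by the action of the multiplicative group $\{-1,1\}^4$ on $\mathrm{Gr}(2,4)(\mathbb{R})$ by rescaling, $(t\cdot p)_S=\prod_{i\in S}t_i\,p_S$.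
   Context: Bases of $M$ are $d$-subsets $B\subseteq[n]$, $x^B=\prod_{i\in B}x_i$. For a field $K\in\{\mathbb{R},\mathbb{C}\}$, $\mathrm{R}_M(K)$ is the set of vectors $(p_S)_{S\in\binom{[n]}{d}}$ of maximal minors of $d\times n$ matrices over $K$ for which $p_S\ne0$ exactly when $S$ is a basis of $M$ (Euclidean topology); $\underline{\mathrm{Gr}}_M(K)=\mathrm{R}_M(K)/(K^\times)^n$ where $(K^\times)^n$ rescales columns. $\mathrm{Gr}(2,4)(\mathbb{R})$ is the real Grassmannian of 2-planes in $\mathbb{R}^4$ in Plücker coordinates. A polynomial is stable if it is zero or nonvanishing on $\{z\in\mathbb{C}:\mathrm{Im} z>0\}^n$. A nonzero homogeneous polynomial $f$ of degree $d$ with nonnegative coefficients is Lorentzian if its support is M-convex and $\partial^\alpha f$ has Hessian with at most one positive eigenvalue for all $\alpha$ of degree $d-2$. $\mathrm{L}_M$ is the set of Lorentzian polynomials whose support is the set of (indicator vectors of) bases of $M$. For a multiaffine $f=\sum_S c_Sx^S$ write $\rho_f(S)=c_S$. $\partial\mathrm{L}_M$ denotes the boundary of $\mathrm{L}_M$ relative to the set of polynomials $f$ with support $M$ such that $\rho_f$ is a strong $\mathbb{T}_\infty$-representation of $M$, i.e. for all relevant Plücker relations $\sum_k\pm p_{S_1\cup\{x_k\}}p_{S_2\setminus\{x_k\}}$ of $M$ the corresponding list of products $\rho_f(S_1\cup\{x_k\})\rho_f(S_2\setminus\{x_k\})$ is all zero, or has its maximum attained twice, or has at least three nonzero entries. $\underline{\mathrm{L}}_M$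 is $\mathrm{L}_M$ modulo $\mathbb{R}^n_{>0}$ acting by $f(x)\mapsto f(c_1x_1,\dots,c_nx_n)$ and $\partial\underline{\mathrm{L}}_M$ is the image of $\partial\mathrm{L}_M$. $\mathbb{P}\mathrm{L}(2,4)_\boxtimes$ is the set of multiaffine Lorentzian quadrics in $x_1,\dots,x_4$ modulo positive scalars, a subset of the 5-dimensional real projective space of multiaffine quadrics, and $\partial\,\mathbb{P}\mathrm{L}(2,4)_\boxtimes$ its boundary in that projective space.
   Formalization: In (3), the space Gr_M(R) is taken as R_M(R) modulo column rescaling and also modulo a common nonzero scalar; with column rescaling alone p and -p would be distinct classes with the same image, so the map would not be injective. *)

theory Defs
  imports
    "HOL-Analysis.Function_Topology"
    "HOL-Analysis.Finite_Function_Topology"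
    "Jordan_Normal_Form.Char_Poly"
    "Jordan_Normal_Form.DL_Submatrix"
begin

text \<open>
  The ground set \<open>[n]\<close> is \<open>{..<n}\<close>, so that it matches the indices of matrices.
\<close>

subsection \<open>Quotient spaces\<close>

definition quotient_topology :: "'a topology \<Rightarrow> ('a \<Rightarrow> 'b) \<Rightarrow> 'b topology" where
  "quotient_topology X q =
     topology (\<lambda>U. U \<subseteq> q ` topspace X \<and> openin X {x \<in> topspace X. q x \<in> U})"

lemma openin_quotient_topology:
  "openin (quotient_topology X q) U \<longleftrightarrow>
     U \<subseteq> q ` topspace X \<and> openin X {x \<in> topspace X. q x \<in> U}"
proof -
  have "istopology (\<lambda>U. U \<subseteq> q ` topspace X \<and> openin X {x \<in> topspace X. q x \<in> U})"
    unfolding istopology_def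
  proof (intro conjI allI impI)
    fix S T
    assume "S \<subseteq> q ` topspace X \<and> openin X {x \<in> topspace X. q x \<in> S}"
      and "T \<subseteq> q ` topspace X \<and> openin X {x \<in> topspace X. q x \<in> T}"
    moreover have "{x \<in> topspace X. q x \<in> S \<inter> T} =
        {x \<in> topspace X. q x \<in> S} \<inter> {x \<in> topspace X. q x \<in> T}" by auto
    ultimately show "S \<inter> T \<subseteq> q ` topspace X"
      and "openin X {x \<in> topspace X. q x \<in> S \<inter> T}" by auto
  next
    fix \<K>
    assume K: "\<forall>S\<in>\<K>. S \<subseteq> q ` topspace X \<and> openin X {x \<in> topspace X. q x \<in> S}"
    then show "\<Union>\<K> \<subseteq> q ` topspace X" by blast
    have "{x \<in> topspace X. q x \<in> \<Union>\<K>} = (\<Union>S\<in>\<K>. {x \<in> topspace X. q x \<in> S})" by auto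
    with K show "openin X {x \<in> topspace X. q x \<in> \<Union>\<K>}" by auto
  qed
  then show ?thesis
    unfolding quotient_topology_def by (simp add: topology_inverse')
qed

lemma topspace_quotient_topology: "topspace (quotient_topology X q) = q ` topspace X"
proof (rule antisym)
  show "topspace (quotient_topology X q) \<subseteq> q ` topspace X"
    using openin_topspace[of "quotient_topology X q"] unfolding openin_quotient_topology by blast
  have "{x \<in> topspace X. q x \<in> q ` topspace X} = topspace X" by auto
  then have "openin (quotient_topology X q) (q ` topspace X)"
    unfolding openin_quotient_topology by simp
  then show "q ` topspace X \<subseteq> topspace (quotient_topology X q)" by (rule openin_subset)
qed

lemma quotient_map_quotient_topology: "quotient_map X (quotient_topology X q) q"
  unfolding quotient_map_def topspace_quotient_topology by (simp add: openin_quotient_topology)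

definition orbit_of :: "'g set \<Rightarrow> ('g \<Rightarrow> 'a \<Rightarrow> 'a) \<Rightarrow> 'a \<Rightarrow> 'a set" where
  "orbit_of G act x = {act g x | g. g \<in> G}"

definition orbit_space :: "'a::topological_space set \<Rightarrow> 'g set \<Rightarrow> ('g \<Rightarrow> 'a \<Rightarrow> 'a) \<Rightarrow> 'a set topology"
  where "orbit_space S G act = quotient_topology (top_of_set S) (orbit_of G act)"


subsection \<open>Matroids, given by their bases\<close>

definition ksubsets :: "nat \<Rightarrow> nat \<Rightarrow> nat set set" where
  "ksubsets n d = {S. S \<subseteq> {..<n} \<and> card S = d}"

definition matroid_bases :: "nat \<Rightarrow> nat \<Rightarrow> nat set set \<Rightarrow> bool" where
  "matroid_bases n d \<B> \<longleftrightarrow>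
     \<B> \<noteq> {} \<and> \<B> \<subseteq> ksubsets n d \<and>
     (\<forall>A\<in>\<B>. \<forall>B\<in>\<B>. \<forall>x\<in>A - B. \<exists>y\<in>B - A. insert y (A - {x}) \<in> \<B>)"

definition dual_bases :: "nat set \<Rightarrow> nat set set \<Rightarrow> nat set set" where
  "dual_bases E \<B> = (\<lambda>B. E - B) ` \<B>"

text \<open>The bases of \<open>M \<setminus> J\<close> are the maximal independent sets of \<open>M\<close> disjoint from \<open>J\<close>.\<close>

definition delete_bases :: "nat set set \<Rightarrow> nat set \<Rightarrow> nat set set" where
  "delete_bases \<B> J =
     {X. (\<exists>B\<in>\<B>. X = B - J) \<and> (\<forall>B\<in>\<B>. X \<subseteq> B - J \<longrightarrow> X = B - J)}"

text \<open>\<open>M / I\<close> is the dual of the deletion of \<open>I\<close> from the dual matroid.\<close>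

definition contract_bases :: "nat set \<Rightarrow> nat set set \<Rightarrow> nat set \<Rightarrow> nat set set" where
  "contract_bases E \<B> I = dual_bases (E - I) (delete_bases (dual_bases E \<B>) I)"

definition has_uniform_minor :: "nat \<Rightarrow> nat set set \<Rightarrow> nat \<Rightarrow> nat \<Rightarrow> bool" where
  "has_uniform_minor n \<B> r m \<longleftrightarrow>
     (\<exists>I J. I \<subseteq> {..<n} \<and> J \<subseteq> {..<n} \<and> I \<inter> J = {} \<and> card ({..<n} - I - J) = m \<and>
        delete_bases (contract_bases {..<n} \<B> I) J =
          {S. S \<subseteq> {..<n} - I - J \<and> card S = r})"


subsection \<open>Realizations and Grassmannians\<close>

text \<open>
  Vectors indexed by the \<open>d\<close>-subsets of \<open>[n]\<close> are functions on sets of natural numbers that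
  vanish elsewhere. Function types carry the product topology, which restricts to the Euclidean
  topology on these vectors.
\<close>

definition maximal_minors :: "nat \<Rightarrow> nat \<Rightarrow> 'a::comm_ring_1 mat \<Rightarrow> nat set \<Rightarrow> 'a" where
  "maximal_minors d n A =
     (\<lambda>S. if S \<in> ksubsets n d then Determinant.det (submatrix A {..<d} S) else 0)"

definition minor_vectors :: "nat \<Rightarrow> nat \<Rightarrow> (nat set \<Rightarrow> 'a::comm_ring_1) set" where
  "minor_vectors d n = maximal_minors d n ` carrier_mat d n"

definition realizations :: "nat \<Rightarrow> nat \<Rightarrow> nat set set \<Rightarrow> (nat set \<Rightarrow> 'a::comm_ring_1) set" where
  "realizations d n \<B> =
     {p \<in> minor_vectors d n. \<forall>S\<in>ksubsets n d. p S \<noteq> 0 \<longleftrightarrow> S \<in> \<B>}"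

definition scale_columns :: "(nat \<Rightarrow> 'a::comm_ring_1) \<Rightarrow> (nat set \<Rightarrow> 'a) \<Rightarrow> (nat set \<Rightarrow> 'a)" where
  "scale_columns t p = (\<lambda>S. (\<Prod>i\<in>S. t i) * p S)"

definition scale_vector :: "'a::comm_ring_1 \<Rightarrow> (nat set \<Rightarrow> 'a) \<Rightarrow> (nat set \<Rightarrow> 'a)" where
  "scale_vector c p = (\<lambda>S. c * p S)"

text \<open>
  Points of the realization space are realizations up to change of basis of the row space, which
  multiplies all minors by a common nonzero scalar, and up to rescaling of the columns. Over the
  reals and for even rank the scalars have to be taken along: \<open>p\<close> and \<open>- p\<close> come from the same
  row space, but column scalings need not connect them.
\<close>

definition realization_group :: "nat \<Rightarrow> ('a::comm_ring_1 \<times> (nat \<Rightarrow> 'a)) set" where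
  "realization_group n = {(c, t). c \<noteq> 0 \<and> (\<forall>i<n. t i \<noteq> 0)}"

definition realization_action ::
  "'a::comm_ring_1 \<times> (nat \<Rightarrow> 'a) \<Rightarrow> (nat set \<Rightarrow> 'a) \<Rightarrow> (nat set \<Rightarrow> 'a)" where
  "realization_action = (\<lambda>(c, t) p. scale_vector c (scale_columns t p))"

definition realization_class :: "nat \<Rightarrow> (nat set \<Rightarrow> 'a::comm_ring_1) \<Rightarrow> (nat set \<Rightarrow> 'a) set" where
  "realization_class n = orbit_of (realization_group n) realization_action"

definition realization_space ::
  "nat \<Rightarrow> nat \<Rightarrow> nat set set \<Rightarrow> (nat set \<Rightarrow> 'a::real_normed_field) set topology" where
  "realization_space d n \<B> =
     orbit_space (realizations d n \<B>) (realization_group n) realization_action"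

definition vector_class :: "(nat set \<Rightarrow> 'a::comm_ring_1) \<Rightarrow> (nat set \<Rightarrow> 'a) set" where
  "vector_class = orbit_of {c. c \<noteq> 0} scale_vector"

definition plucker_projective_space ::
  "nat \<Rightarrow> nat \<Rightarrow> (nat set \<Rightarrow> 'a::real_normed_field) set topology" where
  "plucker_projective_space d n =
     orbit_space {p. (\<forall>S. S \<notin> ksubsets n d \<longrightarrow> p S = 0) \<and> p \<noteq> (\<lambda>_. 0)} {c. c \<noteq> 0} scale_vector"

definition grassmannian ::
  "nat \<Rightarrow> nat \<Rightarrow> (nat set \<Rightarrow> 'a::real_normed_field) set topology" where
  "grassmannian d n =
     subtopology (plucker_projective_space d n) (vector_class ` (minor_vectors d n - {\<lambda>_. 0}))"


subsection \<open>Polynomials\<close>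

text \<open>
  A polynomial maps exponent vectors to coefficients. The topology of the type, induced by the
  sum of the absolute values of the coefficients, restricts to the Euclidean topology on
  polynomials with support in a fixed finite set.
\<close>

type_synonym real_mpoly = "(nat \<Rightarrow>\<^sub>0 nat) \<Rightarrow>\<^sub>0 real"

definition exponent_of :: "nat set \<Rightarrow> nat \<Rightarrow>\<^sub>0 nat" where
  "exponent_of S = (\<Sum>i\<in>S. Poly_Mapping.single i 1)"

definition coeff_at :: "real_mpoly \<Rightarrow> nat set \<Rightarrow> real" where
  "coeff_at f S = Poly_Mapping.lookup f (exponent_of S)"

definition multiaffine_poly :: "nat set set \<Rightarrow> (nat set \<Rightarrow> real) \<Rightarrow> real_mpoly" where
  "multiaffine_poly \<S> c = (\<Sum>S\<in>\<S>. Poly_Mapping.single (exponent_of S) (c S))"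

definition eval_mpoly :: "real_mpoly \<Rightarrow> (nat \<Rightarrow> complex) \<Rightarrow> complex" where
  "eval_mpoly f z =
     (\<Sum>m\<in>Poly_Mapping.keys f. of_real (Poly_Mapping.lookup f m) *
        (\<Prod>i\<in>Poly_Mapping.keys m. z i ^ Poly_Mapping.lookup m i))"

definition stable_mpoly :: "nat \<Rightarrow> real_mpoly \<Rightarrow> bool" where
  "stable_mpoly n f \<longleftrightarrow> f = 0 \<or> (\<forall>z. (\<forall>i<n. Im (z i) > 0) \<longrightarrow> eval_mpoly f z \<noteq> 0)"

text \<open>The truncated subtraction is harmless, because its result has coefficient zero.\<close>

definition partial :: "nat \<Rightarrow> real_mpoly \<Rightarrow> real_mpoly" where
  "partial i f =
     (\<Sum>m\<in>Poly_Mapping.keys f. Poly_Mapping.single (m - Poly_Mapping.single i 1)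
        (of_nat (Poly_Mapping.lookup m i) * Poly_Mapping.lookup f m))"

definition partials :: "nat \<Rightarrow> (nat \<Rightarrow>\<^sub>0 nat) \<Rightarrow> real_mpoly \<Rightarrow> real_mpoly" where
  "partials n \<alpha> = fold (\<lambda>i. partial i ^^ Poly_Mapping.lookup \<alpha> i) [0..<n]"

text \<open>The Hessian of a quadratic form, whose second derivatives are constant polynomials.\<close>

definition hessian :: "nat \<Rightarrow> real_mpoly \<Rightarrow> real mat" where
  "hessian n q = mat n n (\<lambda>(i, j). Poly_Mapping.lookup (partial i (partial j q)) 0)"

text \<open>The roots of the characteristic polynomial are counted with multiplicity.\<close>

definition at_most_one_positive_eigenvalue :: "real mat \<Rightarrow> bool" where
  "at_most_one_positive_eigenvalue A \<longleftrightarrow>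
     size (filter_mset (\<lambda>x. x > 0) (proots (char_poly A))) \<le> 1"

definition exponents :: "nat \<Rightarrow> nat \<Rightarrow> (nat \<Rightarrow>\<^sub>0 nat) set" where
  "exponents n d =
     {m. Poly_Mapping.keys m \<subseteq> {..<n} \<and> (\<Sum>i\<in>Poly_Mapping.keys m. Poly_Mapping.lookup m i) = d}"

definition M_convex :: "(nat \<Rightarrow>\<^sub>0 nat) set \<Rightarrow> bool" where
  "M_convex J \<longleftrightarrow>
     (\<forall>\<alpha>\<in>J. \<forall>\<beta>\<in>J. \<forall>i. Poly_Mapping.lookup \<alpha> i > Poly_Mapping.lookup \<beta> i \<longrightarrow>
        (\<exists>j. Poly_Mapping.lookup \<alpha> j < Poly_Mapping.lookup \<beta> j \<and>
             \<alpha> - Poly_Mapping.single i 1 + Poly_Mapping.single j 1 \<in> J))"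

definition lorentzian :: "nat \<Rightarrow> nat \<Rightarrow> real_mpoly \<Rightarrow> bool" where
  "lorentzian n d f \<longleftrightarrow>
     f \<noteq> 0 \<and> Poly_Mapping.keys f \<subseteq> exponents n d \<and>
     (\<forall>m. Poly_Mapping.lookup f m \<ge> 0) \<and>
     M_convex (Poly_Mapping.keys f) \<and>
     (\<forall>k \<alpha>. k + 2 = d \<and> \<alpha> \<in> exponents n k \<longrightarrow>
        at_most_one_positive_eigenvalue (hessian n (partials n \<alpha> f)))"


subsection \<open>Lorentzian polynomials supported on a matroid\<close>

definition L_mat :: "nat \<Rightarrow> nat \<Rightarrow> nat set set \<Rightarrow> real_mpoly set" where
  "L_mat n d \<B> = {f. lorentzian n d f \<and> Poly_Mapping.keys f = exponent_of ` \<B>}"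

text \<open>\<open>g\<close> on the finite index set \<open>A\<close> is the list of the terms of a sum of elements of the
  hyperfield; the condition says that the sum contains zero.\<close>

definition tinf_null :: "'i set \<Rightarrow> ('i \<Rightarrow> real) \<Rightarrow> bool" where
  "tinf_null A g \<longleftrightarrow>
     (\<forall>x\<in>A. g x = 0) \<or>
     (\<exists>x\<in>A. \<exists>y\<in>A. x \<noteq> y \<and> g x = g y \<and> (\<forall>z\<in>A. g z \<le> g x)) \<or>
     card {x\<in>A. g x \<noteq> 0} \<ge> 3"

text \<open>For \<open>x \<in> S2 \<inter> S1\<close> the set \<open>S1 \<union> {x}\<close> has only \<open>d - 1\<close> elements, so that there is no
  corresponding term.\<close>

definition strong_tinf_representation ::
  "nat \<Rightarrow> nat \<Rightarrow> nat set set \<Rightarrow> (nat set \<Rightarrow> real) \<Rightarrow> bool" where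
  "strong_tinf_representation n d \<B> \<rho> \<longleftrightarrow>
     (\<forall>S\<in>ksubsets n d. \<rho> S \<ge> 0 \<and> (\<rho> S \<noteq> 0 \<longleftrightarrow> S \<in> \<B>)) \<and>
     (\<forall>S1 S2. S1 \<subseteq> {..<n} \<and> S2 \<subseteq> {..<n} \<and> card S1 + 1 = d \<and> card S2 = d + 1 \<longrightarrow>
        tinf_null (S2 - S1) (\<lambda>x. \<rho> (insert x S1) * \<rho> (S2 - {x})))"

definition tinf_polys :: "nat \<Rightarrow> nat \<Rightarrow> nat set set \<Rightarrow> real_mpoly set" where
  "tinf_polys n d \<B> =
     {f. Poly_Mapping.keys f = exponent_of ` \<B> \<and> strong_tinf_representation n d \<B> (coeff_at f)}"

definition boundary_L_mat :: "nat \<Rightarrow> nat \<Rightarrow> nat set set \<Rightarrow> real_mpoly set" where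
  "boundary_L_mat n d \<B> = top_of_set (tinf_polys n d \<B>) frontier_of L_mat n d \<B>"

definition rescale_vars :: "(nat \<Rightarrow> real) \<Rightarrow> real_mpoly \<Rightarrow> real_mpoly" where
  "rescale_vars c f =
     (\<Sum>m\<in>Poly_Mapping.keys f. Poly_Mapping.single m
        (Poly_Mapping.lookup f m * (\<Prod>i\<in>Poly_Mapping.keys m. c i ^ Poly_Mapping.lookup m i)))"

definition pos_torus :: "nat \<Rightarrow> (nat \<Rightarrow> real) set" where
  "pos_torus n = {c. \<forall>i<n. c i > 0}"

definition L_class :: "nat \<Rightarrow> real_mpoly \<Rightarrow> real_mpoly set" where
  "L_class n = orbit_of (pos_torus n) rescale_vars"

definition reduced_L_mat :: "nat \<Rightarrow> nat \<Rightarrow> nat set set \<Rightarrow> real_mpoly set topology" where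
  "reduced_L_mat n d \<B> = orbit_space (L_mat n d \<B>) (pos_torus n) rescale_vars"

definition boundary_reduced_L_mat :: "nat \<Rightarrow> nat \<Rightarrow> nat set set \<Rightarrow> real_mpoly set set" where
  "boundary_reduced_L_mat n d \<B> = L_class n ` boundary_L_mat n d \<B>"

text \<open>The map \<open>p \<mapsto> \<Sum>\<^sub>B |p\<^sub>B|\<^sup>2 x\<^sup>B\<close>, over the reals or the complex numbers.\<close>

definition sq_abs_poly :: "nat set set \<Rightarrow> (nat set \<Rightarrow> 'a::real_normed_field) \<Rightarrow> real_mpoly" where
  "sq_abs_poly \<B> p = multiaffine_poly \<B> (\<lambda>B. (norm (p B))\<^sup>2)"


subsection \<open>Projective space of multiaffine forms\<close>

definition multiaffine_forms :: "nat \<Rightarrow> nat \<Rightarrow> real_mpoly set" where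
  "multiaffine_forms d n = {f. Poly_Mapping.keys f \<subseteq> exponent_of ` ksubsets n d}"

definition poly_class :: "real_mpoly \<Rightarrow> real_mpoly set" where
  "poly_class = orbit_of {c::real. c \<noteq> 0} scaleR"

definition multiaffine_projective_space :: "nat \<Rightarrow> nat \<Rightarrow> real_mpoly set topology" where
  "multiaffine_projective_space d n =
     orbit_space (multiaffine_forms d n - {0}) {c::real. c \<noteq> 0} scaleR"

text \<open>
  Lorentzian polynomials have nonnegative coefficients, so that two of them with the same class
  differ by a positive scalar.
\<close>

definition PL_box :: "nat \<Rightarrow> nat \<Rightarrow> real_mpoly set set" where
  "PL_box d n = poly_class ` {f \<in> multiaffine_forms d n. lorentzian n d f}"

definition boundary_PL_box :: "nat \<Rightarrow> nat \<Rightarrow> real_mpoly set set" where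
  "boundary_PL_box d n = multiaffine_projective_space d n frontier_of PL_box d n"

end

theory Submission
  imports Defs "HOL-Analysis.Generalised_Binomial_Theorem"
begin

unbundle no vec_syntax and no inner_syntax

text \<open>
  Write \<open>p = minors of A\<close> and \<open>f = \<Sum> |p\<^sub>B|\<^sup>2 x\<^sup>B\<close>. By Cauchy-Binet \<open>f(z) = det (A diag(z) A\<^sup>*)\<close>, which gives stability.
  The Hessian of the derivative of \<open>f\<close> along a \<open>(d - 2)\<close>-set \<open>T\<close> has the entries \<open>|a\<^sub>i b\<^sub>j - a\<^sub>j b\<^sub>i|\<^sup>2\<close>, where \<open>a\<close>, \<open>b\<close>
  represent the contraction of \<open>T\<close>; this is the Gram matrix of a Lorentz form on a space of dimension 3 (real) or
  4 (complex), so it has at most one positive eigenvalue and is singular on 4, respectively 5, elements of a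
  uniform minor. The coefficientwise powers \<open>f\<^sup>t\<close>, \<open>t > 1\<close>, remain \<open>T\<^sub>\<infinity>\<close>-representations and converge to \<open>f\<close>. They are not
  Lorentzian, because by an argument of Schoenberg the powers with exponent \<open>1/t < 1\<close> of a Lorentzian rank two
  form without zero coefficients are nonsingular. Hence \<open>f\<close> is a boundary point.

  For the uniform matroid \<open>U\<^sub>2\<^sub>,\<^sub>4\<close> let \<open>a\<close>, \<open>b\<close>, \<open>c\<close> be the products of the coefficients at complementary pairs. A form with
  nonnegative coefficients is Lorentzian iff \<open>a\<^sup>2 + b\<^sup>2 + c\<^sup>2 \<le> 2ab + 2ac + 2bc\<close>, and equality means that
  suitably signed square roots of the coefficients satisfy the Pluecker relation. The boundary is covered by three closed
  sets on which the signs can be chosen constant, so that the square root map is continuous there; this makes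
  \<open>p \<mapsto> \<Sum> p\<^sub>S\<^sup>2 x\<^sup>S\<close> a quotient map. Its fibres are found by comparing two Pluecker vectors with equal squares.
\<close>

section \<open>Real symmetric matrices\<close>

text \<open>Being a boundary point is tested inside the space of
  \<open>T\<^sub>\<infinity>\<close>-representations, and this dictates the perturbation. A Pluecker
  relation with only two nonzero terms forces their products to agree, so over a general matroid no
  single coefficient of \<open>f\<close> can be moved freely. A coefficientwise power keeps zeros,
  equalities and order of all products and so respects all relations simultaneously. The exponent
  has to exceed 1, since exponents below 1 are the ones that Schoenberg's argument controls. A
  uniform minor enters through a single set \<open>T\<close> that completes every pair in the ground
  set \<open>E\<close> of the minor to a basis; on \<open>E\<close> everything then happens in rank
  two, with positive entries off the diagonal. In four variables the delicate forms have zero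
  coefficients. There the discriminant is a square, hence nonnegative, so the inequality becomes an
  equality; the form then comes from a Pluecker vector, and its support is M-convex because supports
  of Pluecker vectors are matroids. Conversely, M-convexity excludes forms such as
  \<open>x\<^sub>0 x\<^sub>1 + x\<^sub>2 x\<^sub>3\<close>, whose positive eigenvalue is double and
  escapes an intermediate value argument.\<close>

lemma real_symmetric_eigenvalue:
  fixes A :: "real mat"
  assumes A: "A \<in> carrier_mat n n" and sym: "A\<^sup>T = A" and n: "n > 0"
  shows "\<exists>l v. eigenvector A v l"
proof -
  let ?C = "map_mat complex_of_real A"
  have C: "?C \<in> carrier_mat n n" using A by auto
  have "degree (char_poly ?C) = n" using degree_monic_char_poly[OF C] by simp
  with n have "\<not> constant (poly (char_poly ?C))" by (simp add: constant_degree)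
  then obtain z where "poly (char_poly ?C) z = 0"
    using fundamental_theorem_of_algebra by blast
  then have "eigenvalue ?C z" using eigenvalue_root_char_poly[OF C] by simp
  then obtain v where v: "v \<in> carrier_vec n" "v \<noteq> 0\<^sub>v n" "?C *\<^sub>v v = z \<cdot>\<^sub>v v"
    using A unfolding eigenvalue_def eigenvector_def by auto
  have Av: "(\<Sum>j<n. of_real (A $$ (i,j)) * v $ j) = z * v $ i" if "i < n" for i
  proof -
    have "(?C *\<^sub>v v) $ i = (\<Sum>j<n. of_real (A $$ (i,j)) * v $ j)"
      using that A v(1) by (auto simp: scalar_prod_def lessThan_atLeast0 intro!: sum.cong)
    then show ?thesis using v that by auto
  qed
  define s where "s = (\<Sum>i<n. (cmod (v $ i))\<^sup>2)"
  have s: "s > 0"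
  proof -
    obtain i where "i < n" "v $ i \<noteq> 0"
      using v(1,2) by (metis carrier_vecD eq_vecI index_zero_vec(1) index_zero_vec(2))
    then show ?thesis unfolding s_def
      by (intro sum_pos2[where i = i]) auto
  qed
  \<comment> \<open>The value of the Hermitian form at \<open>v\<close>: it is real because
    \<open>A\<close> is real symmetric, and it equals \<open>z\<close> times the squared length of
    \<open>v\<close>, so \<open>z\<close> is real.\<close>
  define q where "q = (\<Sum>i<n. \<Sum>j<n. cnj (v $ i) * of_real (A $$ (i,j)) * v $ j)"
  have q: "q = z * of_real s"
  proof -
    have "q = (\<Sum>i<n. cnj (v $ i) * (\<Sum>j<n. of_real (A $$ (i,j)) * v $ j))"
      unfolding q_def by (simp add: sum_distrib_left mult.assoc)
    also have "\<dots> = (\<Sum>i<n. z * of_real ((cmod (v $ i))\<^sup>2))"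
    proof (intro sum.cong refl)
      fix i assume "i \<in> {..<n}"
      then have "cnj (v $ i) * (\<Sum>j<n. of_real (A $$ (i,j)) * v $ j) = z * (v $ i * cnj (v $ i))"
        by (subst Av) auto
      then show "cnj (v $ i) * (\<Sum>j<n. of_real (A $$ (i,j)) * v $ j) = z * of_real ((cmod (v $ i))\<^sup>2)"
        by (simp only: complex_norm_square)
    qed
    finally show ?thesis by (simp add: s_def sum_distrib_left)
  qed
  have Asym: "A $$ (i,j) = A $$ (j,i)" if "i < n" "j < n" for i j
    using arg_cong[OF sym, of "\<lambda>M. M $$ (i,j)"] that A by auto
  have "cnj q = (\<Sum>i<n. \<Sum>j<n. v $ i * of_real (A $$ (i,j)) * cnj (v $ j))"
    unfolding q_def by simp
  also have "\<dots> = (\<Sum>j<n. \<Sum>i<n. v $ i * of_real (A $$ (i,j)) * cnj (v $ j))"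
    by (rule sum.swap)
  also have "\<dots> = q" unfolding q_def by (intro sum.cong refl) (simp add: Asym ac_simps)
  finally have "cnj z = z" using s unfolding q by (simp)
  then obtain l where l: "z = complex_of_real l" by (metis Reals_cases Reals_cnj_iff)
  \<comment> \<open>Going back through the characteristic polynomial over the reals produces a real
    eigenvector; \<open>v\<close> itself may be complex.\<close>
  have "poly (char_poly A) l = 0"
  proof -
    have "char_poly ?C = map_poly complex_of_real (char_poly A)"
      by (rule of_real_hom.char_poly_hom[OF A])
    with \<open>poly (char_poly ?C) z = 0\<close> have "complex_of_real (poly (char_poly A) l) = 0"
      by (simp add: l)
    then show ?thesis by simp
  qed
  then have "eigenvalue A l" using eigenvalue_root_char_poly[OF A] by simp
  then show ?thesis unfolding eigenvalue_def by blast
qed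

text \<open>The witness is the Householder reflection exchanging \<open>v\<close> and the first unit vector.\<close>

lemma symmetric_orthogonal_mat_first_column:
  fixes v :: "real Matrix.vec"
  assumes v: "v \<in> carrier_vec (Suc n)" and norm: "v \<bullet> v = 1"
  shows "\<exists>W \<in> carrier_mat (Suc n) (Suc n). W\<^sup>T = W \<and> W * W = 1\<^sub>m (Suc n) \<and> W *\<^sub>v unit_vec (Suc n) 0 = v"
proof -
  let ?N = "Suc n"
  define u where "u i = v $ i - (if i = 0 then 1 else 0)" for i
  define s where "s = (\<Sum>i<?N. u i * u i)"
  have vv: "(\<Sum>i<?N. v $ i * v $ i) = 1"
    using norm v by (simp add: scalar_prod_def lessThan_atLeast0)
  have s2: "s = 2 - 2 * v $ 0"
  proof -
    have "s = (\<Sum>i<?N. v $ i * v $ i - (if i = 0 then 2 * v $ 0 - 1 else 0))"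
      unfolding s_def u_def by (intro sum.cong refl) (auto simp: algebra_simps)
    then show ?thesis unfolding sum_subtractf vv
      by (subst (asm) sum.delta) auto
  qed
  \<comment> \<open>If \<open>v\<close> is already the unit vector then \<open>s = 0\<close>, and
    the convention \<open>2 / 0 = 0\<close> turns \<open>W\<close> into the identity, which is the
    right witness in that case.\<close>
  define W where "W = Matrix.mat ?N ?N (\<lambda>(i,j). (if i = j then 1 else 0) - 2 / s * (u i * u j))"
  have W: "W \<in> carrier_mat ?N ?N" unfolding W_def by simp
  have sym: "W\<^sup>T = W" by (rule eq_matI) (auto simp: W_def)
  have "W * W = 1\<^sub>m ?N"
  proof (rule eq_matI)
    fix i j assume ij: "i < dim_row (1\<^sub>m ?N)" "j < dim_col (1\<^sub>m ?N)"
    let ?d = "\<lambda>i j. (if i = j then 1 else 0::real)"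
    have "(W * W) $$ (i,j) = (\<Sum>k<?N. (?d i k - 2 / s * (u i * u k)) * (?d k j - 2 / s * (u k * u j)))"
      using ij by (simp add: W_def scalar_prod_def lessThan_atLeast0)
    also have "\<dots> = (\<Sum>k<?N. ?d i k * ?d k j - ?d i k * (2 / s * (u k * u j)) - ?d k j * (2 / s * (u i * u k))
        + 4 / s / s * u i * u j * (u k * u k))"
      by (intro sum.cong refl) (simp add: algebra_simps)
    also have "\<dots> = ?d i j - 2 / s * (u i * u j) - 2 / s * (u i * u j) + 4 / s / s * u i * u j * s"
    proof -
      have "(\<Sum>k<?N. ?d i k * f k) = f i" for f :: "nat \<Rightarrow> real"
        using ij sum.delta'[of "{..<?N}" i f] by (simp add: if_distrib[of "\<lambda>x. x * _"] cong: if_cong)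
      moreover have "(\<Sum>k<?N. ?d k j * f k) = f j" for f :: "nat \<Rightarrow> real"
        using ij sum.delta[of "{..<?N}" j f] by (simp add: if_distrib[of "\<lambda>x. x * _"] cong: if_cong)
      ultimately show ?thesis
        unfolding sum.distrib sum_subtractf by (simp only: s_def sum_distrib_left[symmetric])
    qed
    also have "\<dots> = ?d i j" by (cases "s = 0") (auto simp: field_simps)
    finally show "(W * W) $$ (i,j) = 1\<^sub>m ?N $$ (i,j)" using ij by simp
  qed (auto simp: W_def)
  moreover have "W *\<^sub>v unit_vec ?N 0 = v"
  proof (rule eq_vecI)
    fix i assume i: "i < dim_vec v"
    then have iN: "i < ?N" using v by simp
    have "(W *\<^sub>v unit_vec ?N 0) $ i = W $$ (i,0)"
      using iN W by (simp add: scalar_prod_right_unit)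
    also have "\<dots> = v $ i"
    proof (cases "s = 0")
      case True
      then have "\<forall>k\<in>{..<?N}. u k * u k = 0"
        unfolding s_def by (subst (asm) sum_nonneg_eq_0_iff) auto
      then have "u i = 0" using iN by simp
      then show ?thesis using iN True by (simp add: W_def u_def)
    next
      case False
      have "u 0 = - s / 2" using s2 by (simp add: u_def)
      then have "2 / s * (u i * u 0) = - u i" using False by simp
      then show ?thesis using iN by (simp add: W_def) (simp add: u_def)
    qed
    finally show "(W *\<^sub>v unit_vec ?N 0) $ i = v $ i" .
  qed (use W v in auto)
  ultimately show ?thesis using W sym by blast
qed

text \<open>Deflation: conjugating by a reflection that moves the first unit vector to a unit
  eigenvector splits off a 1 by 1 block, and symmetry clears the first row together with the first
  column. The reflection is its own inverse and transpose, so orthogonality is preserved.\<close>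

lemma real_symmetric_diagonalization:
  fixes A :: "real mat"
  assumes "A \<in> carrier_mat n n" and "A\<^sup>T = A"
  shows "\<exists>P l. P \<in> carrier_mat n n \<and> P * P\<^sup>T = 1\<^sub>m n \<and> A = P * mat_diag n l * P\<^sup>T"
  using assms
proof (induction n arbitrary: A)
  case 0
  then have "A = 1\<^sub>m 0 * mat_diag 0 (\<lambda>_. 0) * (1\<^sub>m 0)\<^sup>T" by (intro eq_matI) auto
  then show ?case by (intro exI[of _ "1\<^sub>m 0"] exI[of _ "\<lambda>_. 0"]) auto
next
  case (Suc n)
  let ?N = "Suc n"
  note A = Suc.prems(1)
  obtain l x where "eigenvector A x l" using real_symmetric_eigenvalue[OF Suc.prems] by auto
  then have x: "x \<in> carrier_vec ?N" "x \<noteq> 0\<^sub>v ?N" "A *\<^sub>v x = l \<cdot>\<^sub>v x"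
    using A unfolding eigenvector_def by auto
  have xx: "x \<bullet> x > 0"
    using conjugate_square_greater_0_vec[OF x(1)] x(2) by (simp add: conjugate_vec_def vec_eq_iff)
  define v where "v = (1 / sqrt (x \<bullet> x)) \<cdot>\<^sub>v x"
  have v: "v \<in> carrier_vec ?N" using x by (simp add: v_def)
  have vv: "v \<bullet> v = 1" using x xx by (simp add: v_def)
  have Av: "A *\<^sub>v v = l \<cdot>\<^sub>v v" using A x by (simp add: v_def mult_mat_vec smult_smult_assoc mult.commute)
  obtain W where W: "W \<in> carrier_mat ?N ?N" "W\<^sup>T = W" "W * W = 1\<^sub>m ?N" "W *\<^sub>v unit_vec ?N 0 = v"
    using symmetric_orthogonal_mat_first_column[OF v vv] by blast
  define B where "B = W * A * W"
  have B: "B \<in> carrier_mat ?N ?N" using W A by (simp add: B_def)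
  have BT: "B\<^sup>T = B"
    unfolding B_def using W A Suc.prems(2)
    by (simp add: transpose_mult[of _ ?N ?N _ ?N] assoc_mult_mat[of _ ?N ?N _ ?N _ ?N])
  have Wv: "W *\<^sub>v v = unit_vec ?N 0"
  proof -
    have "W *\<^sub>v (W *\<^sub>v unit_vec ?N 0) = (W * W) *\<^sub>v unit_vec ?N 0"
      using W(1) by (subst assoc_mult_mat_vec[of _ ?N ?N _ ?N]) auto
    then show ?thesis using W by simp
  qed
  have Be: "B *\<^sub>v unit_vec ?N 0 = l \<cdot>\<^sub>v unit_vec ?N 0"
  proof -
    have "B *\<^sub>v unit_vec ?N 0 = W *\<^sub>v (A *\<^sub>v (W *\<^sub>v unit_vec ?N 0))"
      unfolding B_def using W(1) A
      by (simp add: assoc_mult_mat_vec[of _ ?N ?N _ ?N])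
    also have "\<dots> = l \<cdot>\<^sub>v unit_vec ?N 0"
      using W(1) v by (simp add: W(4) Av mult_mat_vec[of _ ?N ?N] Wv)
    finally show ?thesis .
  qed
  have B0: "B $$ (i,0) = (if i = 0 then l else 0)" if "i < ?N" for i
    using arg_cong[OF Be, of "\<lambda>w. w $ i"] that B by (auto simp: scalar_prod_right_unit)
  have B0': "B $$ (0,i) = (if i = 0 then l else 0)" if "i < ?N" for i
    using arg_cong[OF BT, of "\<lambda>M. M $$ (i,0)"] B0[OF that] that B by auto
  define A' where "A' = Matrix.mat n n (\<lambda>(i,j). B $$ (Suc i, Suc j))"
  have A': "A' \<in> carrier_mat n n" by (simp add: A'_def)
  have "A'\<^sup>T = A'"
  proof (rule eq_matI)
    fix i j assume "i < dim_row A'" "j < dim_col A'"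
    then have ij: "i < n" "j < n" by (auto simp: A'_def)
    have "B\<^sup>T $$ (Suc i, Suc j) = B $$ (Suc i, Suc j)" by (simp add: BT)
    then show "A'\<^sup>T $$ (i,j) = A' $$ (i,j)" using ij B by (simp add: A'_def)
  qed (auto simp: A'_def)
  from Suc.IH[OF A' this] obtain P' l' where P': "P' \<in> carrier_mat n n" "P' * P'\<^sup>T = 1\<^sub>m n"
    "A' = P' * mat_diag n l' * P'\<^sup>T" by blast
  let ?L = "Matrix.mat 1 1 (\<lambda>_. l)"
  have Bblock: "B = four_block_mat ?L (0\<^sub>m 1 n) (0\<^sub>m n 1) A'"
    using B B0 B0' by (intro eq_matI) (auto simp: A'_def)
  define Q where "Q = four_block_mat (1\<^sub>m 1) (0\<^sub>m 1 n) (0\<^sub>m n 1) P'"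
  have Q: "Q \<in> carrier_mat ?N ?N" using four_block_carrier_mat[of "1\<^sub>m 1" 1 1 P' n n] P'(1) unfolding Q_def by simp
  have QT: "Q\<^sup>T = four_block_mat (1\<^sub>m 1) (0\<^sub>m 1 n) (0\<^sub>m n 1) (P'\<^sup>T)"
    unfolding Q_def by (subst transpose_four_block_mat[of _ 1 1 _ n _ n]) (use P' in auto)
  have QQ: "Q * Q\<^sup>T = 1\<^sub>m ?N"
    unfolding QT unfolding Q_def
    by (subst mult_four_block_mat[of _ 1 1 _ n _ n _ _ 1 _ n]) (use P' in auto)
  define D' where "D' = mat_diag n l'"
  define D where "D = mat_diag ?N (case_nat l l')"
  have D'c: "D' \<in> carrier_mat n n" and Dc: "D \<in> carrier_mat ?N ?N" by (auto simp: D'_def D_def)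
  have PD: "P' * D' \<in> carrier_mat n n" "P' * D' * P'\<^sup>T \<in> carrier_mat n n" using P' D'c by auto
  have Deq: "D = four_block_mat ?L (0\<^sub>m 1 n) (0\<^sub>m n 1) D'"
    unfolding D_def D'_def by (rule eq_matI) (auto simp: mat_diag_def split: nat.split)
  have BQ: "Q * D * Q\<^sup>T = B"
  proof -
    have "Q * D = four_block_mat ?L (0\<^sub>m 1 n) (0\<^sub>m n 1) (P' * D')"
      unfolding Deq Q_def
      by (subst mult_four_block_mat[of _ 1 1 _ n _ n _ _ 1 _ n])
        (use P' D'c in auto)
    then show ?thesis
      unfolding QT Bblock P'(3)[folded D'_def]
      by (simp only:) (subst mult_four_block_mat[of _ 1 1 _ n _ n _ _ 1 _ n], use P'(1) PD in auto)
  qed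
  define P where "P = W * Q"
  have P: "P \<in> carrier_mat ?N ?N" using W Q by (simp add: P_def)
  have PT: "P\<^sup>T = Q\<^sup>T * W" unfolding P_def using transpose_mult[OF W(1) Q] W(2) by simp
  have "P * P\<^sup>T = W * (Q * Q\<^sup>T) * W"
    unfolding PT unfolding P_def using W(1) Q by (simp add: assoc_mult_mat[of _ ?N ?N _ ?N _ ?N])
  then have "P * P\<^sup>T = 1\<^sub>m ?N" unfolding QQ using W by simp
  moreover have "A = P * D * P\<^sup>T"
  proof -
    have "P * D * P\<^sup>T = W * (Q * D * Q\<^sup>T) * W"
      unfolding PT unfolding P_def using W(1) Q Dc by (simp add: assoc_mult_mat[of _ ?N ?N _ ?N _ ?N])
    also have "\<dots> = (W * W) * A * (W * W)"
      unfolding BQ B_def using W(1) A by (simp add: assoc_mult_mat[of _ ?N ?N _ ?N _ ?N])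
    finally show ?thesis using W A by simp
  qed
  ultimately show ?case using P unfolding D_def by blast
qed

text \<open>Diagonalization in coordinates, so that later arguments manipulate sums instead of
  matrix products. Roots of the characteristic polynomial counted with multiplicity become indices
  \<open>k\<close> with \<open>l k > 0\<close>.\<close>

lemma spectral_expansion:
  fixes A :: "real mat"
  assumes A: "A \<in> carrier_mat n n" and sym: "A\<^sup>T = A"
  shows "\<exists>l p. (\<forall>k<n. \<forall>k'<n. (\<Sum>i<n. p k i * p k' i) = (if k = k' then 1 else 0)) \<and>
      (\<forall>i<n. \<forall>j<n. A $$ (i,j) = (\<Sum>k<n. l k * p k i * p k j)) \<and>
      (at_most_one_positive_eigenvalue A \<longleftrightarrow> card {k. k < n \<and> l k > 0} \<le> 1)"
proof -
  obtain P l where P: "P \<in> carrier_mat n n" "P * P\<^sup>T = 1\<^sub>m n" "A = P * mat_diag n l * P\<^sup>T"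
    using real_symmetric_diagonalization[OF A sym] by blast
  have PT: "P\<^sup>T * P = 1\<^sub>m n"
    by (rule mat_mult_left_right_inverse[OF P(1) _ P(2)]) (use P in auto)
  define p where "p k i = P $$ (i,k)" for k i
  have "(\<Sum>i<n. p k i * p k' i) = (if k = k' then 1 else 0)" if "k < n" "k' < n" for k k'
    using arg_cong[OF PT, of "\<lambda>M. M $$ (k,k')"] that P(1)
    by (simp add: p_def scalar_prod_def lessThan_atLeast0)
  moreover have "A $$ (i,j) = (\<Sum>k<n. l k * p k i * p k j)" if "i < n" "j < n" for i j
    using that P(1) arg_cong[OF P(3), of "\<lambda>M. M $$ (i,j)"]
    by (subst (asm) mat_diag_mult_right[OF P(1)])
      (simp add: p_def scalar_prod_def lessThan_atLeast0 ac_simps)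
  moreover have "size (filter_mset (\<lambda>x. x > 0) (proots (char_poly A))) = card {k. k < n \<and> l k > 0}"
  proof -
    have "similar_mat_wit A (mat_diag n l) P (P\<^sup>T)"
      unfolding similar_mat_wit_def using A P PT by (auto simp: Let_def)
    then have "char_poly A = char_poly (mat_diag n l)"
      by (intro char_poly_similar) (auto simp: similar_mat_def)
    also have "\<dots> = (\<Prod>a\<leftarrow>diag_mat (mat_diag n l). [:- a, 1:])"
      by (rule char_poly_upper_triangular[of _ n]) (auto simp: mat_diag_def)
    also have "diag_mat (mat_diag n l) = map l [0..<n]"
      by (auto simp: diag_mat_def mat_diag_def)
    also have "(\<Prod>a\<leftarrow>map l [0..<n]. [:- a, 1:]) = (\<Prod>k<n. [:- l k, 1:])"
      by (simp add: prod.list_conv_set_nth lessThan_atLeast0 o_def)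
    finally have "proots (char_poly A) = (\<Sum>k<n. {#l k#})"
      by (simp add: proots_prod)
    moreover have "filter_mset (\<lambda>x. x > 0) (\<Sum>k<n. {#l k#}) = (\<Sum>k<n. if l k > 0 then {#l k#} else {#})"
      by (induction n) (auto simp: lessThan_Suc)
    ultimately show ?thesis
      by (simp add: size_multiset_overloaded_def[symmetric] if_distrib[of size] sum.If_cases Int_def cong: if_cong)
  qed
  ultimately show ?thesis unfolding at_most_one_positive_eigenvalue_def
    by (intro exI[of _ l] exI[of _ p]) auto
qed

lemma quadratic_form_expansion:
  fixes a :: "nat \<Rightarrow> nat \<Rightarrow> real"
  assumes "\<And>i j. i \<in> I \<Longrightarrow> j \<in> I \<Longrightarrow> a i j = (\<Sum>k\<in>K. l k * p k i * p k j)"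
  shows "(\<Sum>i\<in>I. \<Sum>j\<in>I. x i * x j * a i j) = (\<Sum>k\<in>K. l k * (\<Sum>i\<in>I. p k i * x i)\<^sup>2)"
proof -
  have "(\<Sum>k\<in>K. l k * (\<Sum>i\<in>I. p k i * x i)\<^sup>2) = (\<Sum>k\<in>K. \<Sum>i\<in>I. \<Sum>j\<in>I. x i * x j * (l k * p k i * p k j))"
    by (simp add: power2_eq_square sum_product sum_distrib_left ac_simps)
  also have "\<dots> = (\<Sum>i\<in>I. \<Sum>k\<in>K. \<Sum>j\<in>I. x i * x j * (l k * p k i * p k j))"
    by (rule sum.swap)
  also have "\<dots> = (\<Sum>i\<in>I. \<Sum>j\<in>I. \<Sum>k\<in>K. x i * x j * (l k * p k i * p k j))"
    by (intro sum.cong refl sum.swap)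
  also have "\<dots> = (\<Sum>i\<in>I. \<Sum>j\<in>I. x i * x j * a i j)"
    using assms by (simp add: sum_distrib_left)
  finally show ?thesis by simp
qed

text \<open>Two positive eigenvalues would make the form positive definite on a plane. The linear
  functional given by \<open>h\<close> vanishes at some nonzero vector of that plane, where the
  assumed bound fails.\<close>

lemma at_most_one_positive_eigenvalueI:
  fixes A :: "real mat"
  assumes A: "A \<in> carrier_mat n n" and sym: "A\<^sup>T = A"
    and le: "\<And>x. (\<Sum>i<n. \<Sum>j<n. x i * x j * A $$ (i,j)) \<le> (\<Sum>i<n. h i * x i)\<^sup>2"
  shows "at_most_one_positive_eigenvalue A"
proof -
  obtain l p where
    p: "\<And>k k'. k < n \<Longrightarrow> k' < n \<Longrightarrow> (\<Sum>i<n. p k i * p k' i) = (if k = k' then 1 else 0)" and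
    a: "\<And>i j. i < n \<Longrightarrow> j < n \<Longrightarrow> A $$ (i,j) = (\<Sum>k<n. l k * p k i * p k j)" and
    iff: "at_most_one_positive_eigenvalue A \<longleftrightarrow> card {k. k < n \<and> l k > 0} \<le> 1"
    using spectral_expansion[OF A sym] by blast
  have "k1 = k2" if k: "k1 < n" "l k1 > 0" "k2 < n" "l k2 > 0" for k1 k2
  proof (rule ccontr)
    assume ne: "k1 \<noteq> k2"
    define g where "g k = (\<Sum>i<n. h i * p k i)" for k
    obtain \<alpha> \<beta> where ab: "\<alpha> * g k1 + \<beta> * g k2 = 0" "\<alpha> \<noteq> 0 \<or> \<beta> \<noteq> 0"
    proof (cases "g k1 = 0 \<and> g k2 = 0")
      case True then show ?thesis using that[of 1 1] by simp
    next
      case False then show ?thesis using that[of "g k2" "- g k1"] by auto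
    qed
    define x where "x i = \<alpha> * p k1 i + \<beta> * p k2 i" for i
    have "(\<Sum>i<n. h i * x i) = \<alpha> * g k1 + \<beta> * g k2"
      unfolding x_def g_def by (simp add: sum_distrib_left sum.distrib algebra_simps)
    with le[of x] ab have le0: "(\<Sum>i<n. \<Sum>j<n. x i * x j * A $$ (i,j)) \<le> 0" by simp
    have px: "(\<Sum>i<n. p k i * x i) = (if k = k1 then \<alpha> else if k = k2 then \<beta> else 0)" if "k < n" for k
    proof -
      have "(\<Sum>i<n. p k i * x i) = \<alpha> * (\<Sum>i<n. p k i * p k1 i) + \<beta> * (\<Sum>i<n. p k i * p k2 i)"
        unfolding x_def by (simp add: sum_distrib_left sum.distrib algebra_simps)
      then show ?thesis using p[OF that k(1)] p[OF that k(3)] ne by auto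
    qed
    have "(\<Sum>i<n. \<Sum>j<n. x i * x j * A $$ (i,j)) = (\<Sum>k<n. l k * (\<Sum>i<n. p k i * x i)\<^sup>2)"
      by (rule quadratic_form_expansion) (use a in auto)
    also have "\<dots> = (\<Sum>k<n. (if k = k1 then l k1 * \<alpha>\<^sup>2 else 0) + (if k = k2 then l k2 * \<beta>\<^sup>2 else 0))"
      using ne by (intro sum.cong refl) (auto simp: px)
    also have "\<dots> = l k1 * \<alpha>\<^sup>2 + l k2 * \<beta>\<^sup>2"
      using k by (simp add: sum.distrib)
    also have "\<dots> > 0"
      using ab(2) k by (auto intro: add_pos_nonneg add_nonneg_pos)
    finally show False using le0 by simp
  qed
  then show ?thesis unfolding iff by (auto simp: card_le_Suc0_iff_eq)
qed

text \<open>The positive part of the spectral sum has at most one term, hence is a single square;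
  the rest is minus a sum of squares. The matrix thus becomes a Gram matrix in Lorentz
  signature.\<close>

lemma at_most_one_positive_eigenvalueD:
  fixes A :: "real mat"
  assumes A: "A \<in> carrier_mat n n" and sym: "A\<^sup>T = A" and "at_most_one_positive_eigenvalue A"
  shows "\<exists>h v. \<forall>i<n. \<forall>j<n. A $$ (i,j) = h i * h j - (\<Sum>k<n. v k i * v k j)"
proof -
  obtain l p where
    a: "\<And>i j. i < n \<Longrightarrow> j < n \<Longrightarrow> A $$ (i,j) = (\<Sum>k<n. l k * p k i * p k j)" and
    "at_most_one_positive_eigenvalue A \<longleftrightarrow> card {k. k < n \<and> l k > 0} \<le> 1"
    using spectral_expansion[OF A sym] by blast
  with assms(3) have eq: "\<And>k1 k2. k1 < n \<Longrightarrow> l k1 > 0 \<Longrightarrow> k2 < n \<Longrightarrow> l k2 > 0 \<Longrightarrow> k1 = k2"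
    by (auto simp: card_le_Suc0_iff_eq)
  obtain h where h: "\<And>i j. (\<Sum>k<n. max (l k) 0 * p k i * p k j) = h i * h j"
  proof (cases "\<exists>k<n. l k > 0")
    case False
    then have "max (l k) 0 = 0" if "k < n" for k
      using that by (metis max_absorb2 not_le)
    then have "(\<Sum>k<n. max (l k) 0 * p k i * p k j) = 0" for i j
      by (intro sum.neutral ballI) simp
    then show ?thesis using that[of "\<lambda>_. 0"] by simp
  next
    case True
    then obtain k0 where k0: "k0 < n" "l k0 > 0" by blast
    have "(\<Sum>k<n. max (l k) 0 * p k i * p k j) = (\<Sum>k\<in>{k0}. max (l k) 0 * p k i * p k j)" for i j
      by (rule sum.mono_neutral_right) (use k0 eq in \<open>auto simp: max_def not_less not_le\<close>)
    then show ?thesis using k0 by (intro that[of "\<lambda>i. sqrt (l k0) * p k0 i"]) simp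
  qed
  define v where "v k i = sqrt (max (- l k) 0) * p k i" for k i
  have "A $$ (i,j) = h i * h j - (\<Sum>k<n. v k i * v k j)" if "i < n" "j < n" for i j
  proof -
    have "v k i * v k j = max (- l k) 0 * p k i * p k j" for k by (simp add: v_def)
    then have "h i * h j - (\<Sum>k<n. v k i * v k j) = (\<Sum>k<n. (max (l k) 0 - max (- l k) 0) * (p k i * p k j))"
      unfolding h[symmetric] by (simp add: sum_subtractf[symmetric] algebra_simps)
    also have "\<dots> = A $$ (i,j)"
      unfolding a[OF that] by (intro sum.cong refl) (auto simp: max_def)
    finally show ?thesis by simp
  qed
  then show ?thesis by blast
qed

section \<open>Maximal minors and Pluecker relations\<close>

text \<open>Indexed by a list of columns rather than a set: repetitions and arbitrary orders occur
  in Laplace expansions and in the Cauchy-Binet sum, whereas \<open>maximal_minors\<close> reads its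
  columns in increasing order.\<close>

definition cols_det :: "nat \<Rightarrow> 'a::comm_ring_1 mat \<Rightarrow> (nat \<Rightarrow> nat) \<Rightarrow> 'a" where
  "cols_det d A j = Determinant.det (Matrix.mat d d (\<lambda>(r,k). A $$ (r, j k)))"

lemma cols_det_cong: "(\<And>k. k < d \<Longrightarrow> j k = j' k) \<Longrightarrow> cols_det d A j = cols_det d A j'"
  unfolding cols_det_def by (intro arg_cong[of _ _ Determinant.det] eq_matI) auto

lemma cols_det_repeated:
  assumes "k < d" "k' < d" "k \<noteq> k'" "j k = j k'"
  shows "cols_det d A j = 0"
  unfolding cols_det_def
  by (rule det_identical_columns[of _ d k k']) (use assms in \<open>auto intro!: eq_vecI\<close>)

lemma cols_det_permute:
  assumes "\<pi> permutes {..<d}"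
  shows "cols_det d A (j \<circ> \<pi>) = signof \<pi> * cols_det d A j"
proof -
  let ?M = "Matrix.mat d d (\<lambda>(r,k). A $$ (k, j r))"
  have T: "Determinant.det (Matrix.mat d d (\<lambda>(r,k). A $$ (r, i k))) =
      Determinant.det (Matrix.mat d d (\<lambda>(r,k). A $$ (k, i r)))" for i
    by (subst det_transpose[symmetric, of _ d])
      (auto intro!: arg_cong[of _ _ Determinant.det] eq_matI)
  have "Matrix.mat d d (\<lambda>(r,k). A $$ (k, (j \<circ> \<pi>) r)) = Matrix.mat d d (\<lambda>(r,k). ?M $$ (\<pi> r, k))"
    using permutes_in_image[OF assms] by (intro eq_matI) auto
  then show ?thesis
    unfolding cols_det_def T using det_permute_rows[of ?M d \<pi>] assms
    by (simp add: lessThan_atLeast0)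
qed

lemma pick_lessThan: "i < d \<Longrightarrow> pick {..<d} i = i"
proof -
  assume "i < d"
  moreover have "{a \<in> {..<d}. a < i} = {..<i}" using \<open>i < d\<close> by auto
  ultimately show ?thesis using pick_card_in_set[of i "{..<d}"] by simp
qed

lemma bij_betw_pick:
  assumes "finite S" shows "bij_betw (pick S) {..<card S} S"
proof -
  have inj: "inj_on (pick S) {..<card S}"
    by (rule inj_onI) (use pick_mono_le[of _ S] in \<open>metis lessThan_iff less_irrefl nat_neq_iff\<close>)
  have "pick S ` {..<card S} \<subseteq> S" using pick_in_set_le by blast
  then show ?thesis
    using card_image[OF inj] card_subset_eq[OF assms] inj by (auto simp: bij_betw_def)
qed

lemma ksubsets_finite: "S \<in> ksubsets n d \<Longrightarrow> finite S"
  unfolding ksubsets_def using finite_subset by auto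

lemma finite_ksubsets: "finite (ksubsets n d)"
  unfolding ksubsets_def by simp

lemma maximal_minors_eq_cols_det:
  assumes "A \<in> carrier_mat d n" "S \<in> ksubsets n d"
  shows "maximal_minors d n A S = cols_det d A (pick S)"
proof -
  have 1: "card {i. i < d \<and> i < d} = d" by simp
  have "{j. j < n \<and> j \<in> S} = S" "card S = d" using assms(2) by (auto simp: ksubsets_def)
  then have "submatrix A {..<d} S = Matrix.mat d d (\<lambda>(r,k). A $$ (r, pick S k))"
    using assms(1) unfolding submatrix_def by (intro eq_matI) (auto simp: pick_lessThan)
  then show ?thesis using assms(2) unfolding maximal_minors_def cols_det_def by simp
qed

text \<open>Reordering columns costs only a sign, so absolute values depend on the set of columns
  alone. This keeps sign bookkeeping out of the statements about minors that follow.\<close>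

lemma norm_cols_det:
  fixes A :: "'a::real_normed_field mat"
  assumes A: "A \<in> carrier_mat d n" and inj: "inj_on j {..<d}" and sub: "j ` {..<d} \<subseteq> {..<n}"
  shows "norm (cols_det d A j) = norm (maximal_minors d n A (j ` {..<d}))"
proof -
  let ?S = "j ` {..<d}"
  have card: "card ?S = d" using inj by (simp add: card_image)
  have S: "?S \<in> ksubsets n d" using sub card by (simp add: ksubsets_def)
  have bp: "bij_betw (pick ?S) {..<d} ?S" using bij_betw_pick[of ?S] card by simp
  define \<pi> where "\<pi> k = (if k < d then inv_into {..<d} (pick ?S) (j k) else k)" for k
  have "bij_betw (inv_into {..<d} (pick ?S) \<circ> j) {..<d} {..<d}"
    using inj bij_betw_inv_into[OF bp] by (intro bij_betw_trans[of j _ ?S]) (auto simp: bij_betw_def)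
  then have "bij_betw \<pi> {..<d} {..<d}"
    by (rule bij_betw_cong[THEN iffD1, rotated]) (auto simp: \<pi>_def)
  then have perm: "\<pi> permutes {..<d}" by (rule bij_imp_permutes) (auto simp: \<pi>_def)
  have "cols_det d A j = cols_det d A (pick ?S \<circ> \<pi>)"
    by (rule cols_det_cong) (use bij_betw_inv_into_right[OF bp] in \<open>auto simp: \<pi>_def\<close>)
  also have "\<dots> = signof \<pi> * cols_det d A (pick ?S)" by (rule cols_det_permute[OF perm])
  also have "cols_det d A (pick ?S) = maximal_minors d n A ?S"
    using maximal_minors_eq_cols_det[OF A S] by simp
  finally show ?thesis by (simp add: norm_mult sign_def)
qed

text \<open>Laplace expansion along column \<open>m\<close>: its cofactors do not involve the
  entries of that column, so the coefficients \<open>c\<close> are independent of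
  \<open>x\<close>.\<close>

lemma cols_det_last_column:
  "\<exists>c. \<forall>x. cols_det (Suc m) A (j(m := x)) = (\<Sum>r<Suc m. A $$ (r, x) * c r)"
proof -
  define M where "M x = Matrix.mat (Suc m) (Suc m) (\<lambda>(r,k). A $$ (r, (j(m := x)) k))" for x
  have "cols_det (Suc m) A (j(m := x)) = (\<Sum>r<Suc m. A $$ (r, x) * cofactor (M 0) r m)" for x
  proof -
    have "cofactor (M x) r m = cofactor (M 0) r m" for r
    proof -
      have "mat_delete (M x) r m = mat_delete (M 0) r m"
        by (rule eq_matI) (auto simp: mat_delete_def M_def)
      then show ?thesis unfolding cofactor_def by simp
    qed
    moreover have "cols_det (Suc m) A (j(m := x)) = (\<Sum>r<Suc m. M x $$ (r, m) * cofactor (M x) r m)"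
      unfolding cols_det_def M_def[symmetric] by (rule laplace_expansion_column) (auto simp: M_def)
    moreover have "M x $$ (r, m) = A $$ (r, x)" if "r < Suc m" for r
      using that by (simp add: M_def)
    ultimately show ?thesis by simp
  qed
  then show ?thesis by (intro exI[of _ "\<lambda>r. cofactor (M 0) r m"] allI)
qed

text \<open>Linearity of the first factor in its last column reduces the claim to one row
  \<open>r\<close> of \<open>A\<close>. For that row the alternating sum is the top row expansion of
  the square matrix with columns \<open>w\<close> and an extra copy of row \<open>r\<close> on top,
  which is singular.\<close>

lemma plucker_relation:
  "(\<Sum>k<Suc (Suc m). (- 1) ^ k * cols_det (Suc m) A (j(m := w k)) *
      cols_det (Suc m) A (w \<circ> insert_index k)) = 0"
proof -
  let ?d = "Suc m"
  let ?W = "\<lambda>k. cols_det ?d A (w \<circ> insert_index k)"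
  obtain c where c: "\<And>x. cols_det ?d A (j(m := x)) = (\<Sum>r<?d. A $$ (r, x) * c r)"
    using cols_det_last_column by blast
  have row: "(\<Sum>k<Suc ?d. (- 1) ^ k * A $$ (r, w k) * ?W k) = 0" if r: "r < ?d" for r
  proof -
    define M where "M = Matrix.mat (Suc ?d) (Suc ?d) (\<lambda>(i,k). if i = 0 then A $$ (r, w k) else A $$ (i - 1, w k))"
    have M: "M \<in> carrier_mat (Suc ?d) (Suc ?d)" by (simp add: M_def)
    have "Determinant.det M = 0"
      by (rule det_identical_rows[OF M, of 0 "Suc r"]) (use r in \<open>auto simp: M_def intro!: eq_vecI\<close>)
    moreover have "Determinant.det M = (\<Sum>k<Suc ?d. M $$ (0,k) * cofactor M 0 k)"
      by (rule laplace_expansion_row[OF M]) simp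
    moreover have "M $$ (0,k) * cofactor M 0 k = (- 1) ^ k * A $$ (r, w k) * ?W k" if "k < Suc ?d" for k
    proof -
      have "mat_delete M 0 k = Matrix.mat ?d ?d (\<lambda>(i,l). A $$ (i, (w \<circ> insert_index k) l))"
        by (rule eq_matI) (auto simp: mat_delete_def M_def insert_index_def)
      then show ?thesis using that by (simp add: cofactor_def cols_det_def M_def)
    qed
    ultimately show ?thesis by simp
  qed
  have "(\<Sum>k<Suc ?d. (- 1) ^ k * cols_det ?d A (j(m := w k)) * ?W k) =
      (\<Sum>k<Suc ?d. \<Sum>r<?d. c r * ((- 1) ^ k * A $$ (r, w k) * ?W k))"
    unfolding c sum_distrib_left sum_distrib_right by (intro sum.cong refl) (simp only: ac_simps)
  also have "\<dots> = (\<Sum>r<?d. c r * (\<Sum>k<Suc ?d. (- 1) ^ k * A $$ (r, w k) * ?W k))"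
    unfolding sum_distrib_left by (rule sum.swap)
  also have "\<dots> = 0" by (rule sum.neutral) (use row in auto)
  finally show ?thesis .
qed

text \<open>Signs are hidden in \<open>z\<close>: both the hyperfield condition and basis exchange
  only use that numbers of the given absolute values add up to zero. Elements common to
  \<open>S1\<close> and \<open>S2\<close> drop out because their determinants repeat a
  column.\<close>

lemma minors_plucker:
  fixes A :: "'a::real_normed_field mat"
  assumes A: "A \<in> carrier_mat d n" and S1: "S1 \<subseteq> {..<n}" "card S1 + 1 = d"
    and S2: "S2 \<subseteq> {..<n}" "card S2 = d + 1"
  shows "\<exists>z::nat \<Rightarrow> 'a. (\<Sum>x\<in>S2 - S1. z x) = 0 \<and> (\<forall>x\<in>S2 - S1. norm (z x) =
      norm (maximal_minors d n A (insert x S1)) * norm (maximal_minors d n A (S2 - {x})))"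
proof -
  define m where "m = card S1"
  have d: "d = Suc m" using S1 by (simp add: m_def)
  have fin: "finite S1" "finite S2" using S1 S2 finite_subset by auto
  have b1: "bij_betw (pick S1) {..<m} S1" using bij_betw_pick[OF fin(1)] by (simp add: m_def)
  have b2: "bij_betw (pick S2) {..<Suc d} S2" using bij_betw_pick[OF fin(2)] S2 by simp
  define t where "t k = (- 1) ^ k * cols_det d A ((pick S1)(m := pick S2 k)) *
      cols_det d A (pick S2 \<circ> insert_index k)" for k
  define z where "z = t \<circ> inv_into {..<Suc d} (pick S2)"
  have zt: "z (pick S2 k) = t k" if "k < Suc d" for k
    using that bij_betw_inv_into_left[OF b2] by (simp add: z_def)
  have S2im: "S2 = pick S2 ` {..<Suc d}" using b2 by (simp add: bij_betw_def)
  have "(\<Sum>x\<in>S2. z x) = (\<Sum>k<Suc d. t k)"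
    using sum.reindex_bij_betw[OF b2, of z] zt by simp
  also have "\<dots> = 0" using plucker_relation[of m A "pick S1" "pick S2"] unfolding t_def d .
  finally have sum0: "(\<Sum>x\<in>S2. z x) = 0" .
  have z0: "z x = 0" if x: "x \<in> S2" "x \<in> S1" for x
  proof -
    obtain k where k: "k < Suc d" "x = pick S2 k" using x S2im by auto
    obtain i where i: "i < m" "x = pick S1 i" using x b1 by (auto simp: bij_betw_def)
    have "cols_det d A ((pick S1)(m := pick S2 k)) = 0"
      by (rule cols_det_repeated[of i _ m]) (use i k in \<open>auto simp: d\<close>)
    then show ?thesis using zt[OF k(1)] by (simp add: k t_def)
  qed
  have "(\<Sum>x\<in>S2 - S1. z x) = (\<Sum>x\<in>S2. z x)"
    by (rule sum.mono_neutral_left) (use z0 fin in auto)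
  moreover have "norm (z x) = norm (maximal_minors d n A (insert x S1)) * norm (maximal_minors d n A (S2 - {x}))"
    if x: "x \<in> S2 - S1" for x
  proof -
    obtain k where k: "k < Suc d" "x = pick S2 k" using x S2im by auto
    have xn: "x < n" using x S2 by auto
    have im1: "(pick S1)(m := x) ` {..<d} = insert x S1"
      using b1 by (auto simp: d bij_betw_def lessThan_Suc image_iff)
    have "inj_on ((pick S1)(m := x)) {..<d}"
      using b1 x by (auto simp: d bij_betw_def lessThan_Suc inj_on_def)
    then have 1: "norm (cols_det d A ((pick S1)(m := x))) = norm (maximal_minors d n A (insert x S1))"
      using norm_cols_det[OF A, of "(pick S1)(m := x)"] S1 xn unfolding im1 by auto
    have ii: "insert_index k ` {..<d} = {..<Suc d} - {k}"
      using insert_index_image[of k d] k by (simp add: lessThan_atLeast0)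
    have im2: "(pick S2 \<circ> insert_index k) ` {..<d} = S2 - {x}"
    proof -
      have "(pick S2 \<circ> insert_index k) ` {..<d} = pick S2 ` ({..<Suc d} - {k})"
        unfolding image_comp[symmetric] ii ..
      also have "\<dots> = pick S2 ` {..<Suc d} - pick S2 ` {k}"
        by (rule inj_on_image_set_diff[of _ "{..<Suc d}"]) (use b2 k in \<open>auto simp: bij_betw_def\<close>)
      finally show ?thesis using S2im k by simp
    qed
    have "inj_on (pick S2 \<circ> insert_index k) {..<d}"
      by (rule comp_inj_on) (use b2 ii in \<open>auto simp: bij_betw_def insert_index_inj_on intro: inj_on_subset\<close>)
    then have 2: "norm (cols_det d A (pick S2 \<circ> insert_index k)) = norm (maximal_minors d n A (S2 - {x}))"
      using norm_cols_det[OF A, of "pick S2 \<circ> insert_index k"] S2 unfolding im2 by auto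
    show ?thesis using zt[OF k(1)] k(2) 1 2 by (simp add: t_def norm_mult norm_power)
  qed
  ultimately show ?thesis using sum0 by (intro exI[of _ z] conjI ballI) simp_all
qed

text \<open>The rows \<open>a\<close>, \<open>b\<close> represent the contraction of \<open>T\<close>.\<close>

lemma minors_rank_two:
  fixes A :: "'a::real_normed_field mat"
  assumes A: "A \<in> carrier_mat d n" and T: "T \<subseteq> {..<n}" "card T + 2 = d"
  shows "\<exists>a b::nat \<Rightarrow> 'a. \<forall>x<n. \<forall>y<n. norm (a x * b y - a y * b x) =
      (if x \<noteq> y \<and> x \<notin> T \<and> y \<notin> T then norm (maximal_minors d n A (insert x (insert y T))) else 0)"
proof -
  define m where "m = card T"
  have d: "d = Suc (Suc m)" using T by (simp add: m_def)
  have fin: "finite T" using T finite_subset by auto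
  have b: "bij_betw (pick T) {..<m} T" using bij_betw_pick[OF fin] by (simp add: m_def)
  define D where "D x y = cols_det d A ((pick T)(m := x, Suc m := y))" for x y
  have D0: "D x y = 0" if xy: "x = y \<or> x \<in> T \<or> y \<in> T" for x y
  proof -
    have "\<exists>i<m. z = pick T i" if "z \<in> T" for z using that b by (auto simp: bij_betw_def)
    with xy consider "x = y" | i where "i < m" "x = pick T i" | i where "i < m" "y = pick T i" by blast
    then show ?thesis
    proof cases
      case 1 then show ?thesis unfolding D_def by (intro cols_det_repeated[of m _ "Suc m"]) (auto simp: d)
    next
      case 2 then show ?thesis unfolding D_def by (intro cols_det_repeated[of i _ m]) (auto simp: d)
    next
      case 3 then show ?thesis unfolding D_def by (intro cols_det_repeated[of i _ "Suc m"]) (auto simp: d)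
    qed
  qed
  have normD: "norm (D x y) = (if x \<noteq> y \<and> x \<notin> T \<and> y \<notin> T then norm (maximal_minors d n A (insert x (insert y T))) else 0)"
    if xy: "x < n" "y < n" for x y
  proof (cases "x \<noteq> y \<and> x \<notin> T \<and> y \<notin> T")
    case True
    let ?j = "(pick T)(m := x, Suc m := y)"
    have im: "?j ` {..<d} = insert x (insert y T)"
    proof -
      have "?j ` {..<m} = pick T ` {..<m}" by (intro image_cong) auto
      also have "\<dots> = T" using b by (simp add: bij_betw_def)
      finally have "?j ` {..<m} = T" .
      moreover have "{..<d} = insert (Suc m) (insert m {..<m})" by (auto simp: d)
      ultimately have "?j ` {..<d} = insert (?j (Suc m)) (insert (?j m) T)"
        by (simp only: image_insert)
      then show ?thesis by auto
    qed
    have "inj_on ?j {..<d}"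
      using b True by (auto simp: d bij_betw_def lessThan_Suc inj_on_def)
    then show ?thesis
      using norm_cols_det[OF A, of ?j] T xy True unfolding im D_def by auto
  qed (use D0 in auto)
  \<comment> \<open>The three-term relation. For \<open>k < m\<close> the column \<open>?w k\<close>
    already occurs among the first \<open>m\<close> columns, so only the last three of the
    \<open>d + 1\<close> summands survive.\<close>
  have three: "D x y * D u v - D x u * D y v + D x v * D y u = 0" for x y u v
  proof -
    let ?w = "(pick T)(m := y, Suc m := u, Suc (Suc m) := v)"
    let ?t = "\<lambda>k. (- 1) ^ k * cols_det d A ((pick T)(m := x, Suc m := ?w k)) * cols_det d A (?w \<circ> insert_index k)"
    have "0 = (\<Sum>k<Suc d. ?t k)"
      using plucker_relation[of "Suc m" A "(pick T)(m := x)" ?w] unfolding d by simp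
    also have "\<dots> = ?t m + ?t (Suc m) + ?t (Suc (Suc m))"
    proof -
      have "?t k = 0" if "k < m" for k
        using cols_det_repeated[of k d "Suc m" "(pick T)(m := x, Suc m := ?w k)" A] that by (simp add: d)
      then have "(\<Sum>k<m. ?t k) = 0" by (intro sum.neutral) auto
      then show ?thesis unfolding d by (simp only: sum.lessThan_Suc) simp
    qed
    also have "?t m = (- 1) ^ m * (D x y * D u v)"
    proof -
      have "cols_det d A (?w \<circ> insert_index m) = D u v" unfolding D_def
        by (rule cols_det_cong) (auto simp: d insert_index_def less_Suc_eq)
      then show ?thesis by (simp add: D_def)
    qed
    also have "?t (Suc m) = - ((- 1) ^ m * (D x u * D y v))"
    proof -
      have "cols_det d A (?w \<circ> insert_index (Suc m)) = D y v" unfolding D_def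
        by (rule cols_det_cong) (auto simp: d insert_index_def less_Suc_eq)
      then show ?thesis by (simp add: D_def)
    qed
    also have "?t (Suc (Suc m)) = (- 1) ^ m * (D x v * D y u)"
    proof -
      have "cols_det d A (?w \<circ> insert_index (Suc (Suc m))) = D y u" unfolding D_def
        by (rule cols_det_cong) (auto simp: d insert_index_def less_Suc_eq)
      then show ?thesis by (simp add: D_def)
    qed
    finally have "(- 1) ^ m * (D x y * D u v - D x u * D y v + D x v * D y u) = 0"
      by (simp add: algebra_simps)
    then show ?thesis by simp
  qed
  \<comment> \<open>With a pivot \<open>D u v \<noteq> 0\<close> the three-term relation expresses
    \<open>D x y\<close> as a 2 by 2 determinant of the values of \<open>D\<close> against
    \<open>u\<close> and \<open>v\<close>.\<close>
  obtain a b where ab: "\<And>x y. D x y = a x * b y - a y * b x"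
  proof (cases "\<forall>x y. D x y = 0")
    case True then show ?thesis using that[of "\<lambda>_. 0" "\<lambda>_. 0"] by simp
  next
    case False
    then obtain u v where uv: "D u v \<noteq> 0" by blast
    show ?thesis
    proof (rule that[of "\<lambda>x. D x u" "\<lambda>y. D y v / D u v"])
      fix x y
      have "D x y * D u v = D x u * D y v - D y u * D x v"
        using three[of x y u v] by (simp add: algebra_simps eq_neg_iff_add_eq_0)
      then show "D x y = D x u * (D y v / D u v) - D y u * (D x v / D u v)"
        using uv by (simp add: field_simps)
    qed
  qed
  show ?thesis
    using normD unfolding ab by (intro exI[of _ a] exI[of _ b]) simp
qed

section \<open>Hyperfield representations and matroids from Pluecker relations\<close>

text \<open>A vanishing sum cannot have exactly one nonzero term, and if it has exactly two, these
  have equal norm and are the largest. From three nonzero terms on the hyperfield imposes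
  nothing.\<close>

lemma tinf_null_if_sum_zero:
  fixes z :: "'i \<Rightarrow> 'a::real_normed_vector"
  assumes fin: "finite A" and sum: "(\<Sum>x\<in>A. z x) = 0" and g: "\<And>x. x \<in> A \<Longrightarrow> g x = (norm (z x))\<^sup>2"
  shows "tinf_null A g"
proof (cases "card {x\<in>A. z x \<noteq> 0} \<ge> 3")
  case True
  moreover have "{x\<in>A. z x \<noteq> 0} = {x\<in>A. g x \<noteq> 0}" using g by auto
  ultimately show ?thesis unfolding tinf_null_def by simp
next
  case False
  let ?N = "{x\<in>A. z x \<noteq> 0}"
  have finN: "finite ?N" using fin by simp
  have sumN: "(\<Sum>x\<in>?N. z x) = 0"
  proof -
    have "(\<Sum>x\<in>A. z x) = (\<Sum>x\<in>?N. z x)"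
      by (rule sum.mono_neutral_right[OF fin]) auto
    then show ?thesis using sum by simp
  qed
  from False consider "card ?N = 0" | "card ?N = 1" | "card ?N = 2" by linarith
  then show ?thesis
  proof cases
    case 1
    then have "\<forall>x\<in>A. z x = 0" using finN by auto
    then show ?thesis unfolding tinf_null_def using g by simp
  next
    case 2
    then obtain x where x: "?N = {x}" by (rule card_1_singletonE)
    have "z x = 0" using sumN unfolding x by simp
    moreover have "x \<in> ?N" unfolding x by simp
    ultimately show ?thesis by simp
  next
    case 3
    then obtain x y where xy: "?N = {x, y}" "x \<noteq> y" unfolding card_2_iff by blast
    have "z x = - z y" using sumN xy(2) unfolding xy(1) by (simp add: eq_neg_iff_add_eq_0)
    then have eq: "norm (z x) = norm (z y)" by simp
    have le: "norm (z w) \<le> norm (z x)" if "w \<in> A" for w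
    proof (cases "z w = 0")
      case False
      then have "w \<in> {x, y}" using that xy(1) by blast
      then show ?thesis using eq by auto
    qed simp
    have "x \<in> A" "y \<in> A" using xy(1) by auto
    moreover have "g x = g y" using g eq \<open>x \<in> A\<close> \<open>y \<in> A\<close> by simp
    moreover have "\<forall>w\<in>A. g w \<le> g x" using g le \<open>x \<in> A\<close> by (simp add: power_mono)
    ultimately show ?thesis unfolding tinf_null_def using xy(2) by blast
  qed
qed

lemma realizations_tinf:
  fixes p :: "nat set \<Rightarrow> 'a::real_normed_field"
  assumes "p \<in> realizations d n \<B>"
  shows "strong_tinf_representation n d \<B> (\<lambda>S. (norm (p S))\<^sup>2)"
proof -
  obtain A where A: "A \<in> carrier_mat d n" "p = maximal_minors d n A"
    and supp: "\<forall>S\<in>ksubsets n d. p S \<noteq> 0 \<longleftrightarrow> S \<in> \<B>"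
    using assms unfolding realizations_def minor_vectors_def by auto
  have "tinf_null (S2 - S1) (\<lambda>x. (norm (p (insert x S1)))\<^sup>2 * (norm (p (S2 - {x})))\<^sup>2)"
    if S: "S1 \<subseteq> {..<n}" "S2 \<subseteq> {..<n}" "card S1 + 1 = d" "card S2 = d + 1" for S1 S2
  proof -
    obtain z :: "nat \<Rightarrow> 'a" where z: "(\<Sum>x\<in>S2 - S1. z x) = 0"
      "\<forall>x\<in>S2 - S1. norm (z x) = norm (p (insert x S1)) * norm (p (S2 - {x}))"
      using minors_plucker[OF A(1) S(1,3,2,4)] unfolding A(2) by blast
    have "finite (S2 - S1)" using S(2) finite_subset by blast
    then show ?thesis
      by (rule tinf_null_if_sum_zero[OF _ z(1)]) (use z(2) in \<open>simp add: power_mult_distrib\<close>)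
  qed
  then show ?thesis
    using supp unfolding strong_tinf_representation_def by auto
qed

text \<open>In the relation for \<open>B - {x}\<close> and \<open>insert x C\<close> the term of
  \<open>x\<close> is \<open>p B * p C\<close> up to sign, hence nonzero. Another term must
  compensate it, and the index of that term is the exchange element.\<close>

lemma minors_support_matroid:
  fixes p :: "nat set \<Rightarrow> 'a::real_normed_field"
  assumes "p \<in> minor_vectors d n" "p \<noteq> (\<lambda>_. 0)"
  shows "matroid_bases n d {S \<in> ksubsets n d. p S \<noteq> 0}"
proof -
  obtain A where A: "A \<in> carrier_mat d n" "p = maximal_minors d n A"
    using assms unfolding minor_vectors_def by auto
  have "p S = 0" if "S \<notin> ksubsets n d" for S using that unfolding A(2) maximal_minors_def by simp
  then have "{S \<in> ksubsets n d. p S \<noteq> 0} \<noteq> {}" using assms(2) by blast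
  moreover have "\<exists>y\<in>C - B. insert y (B - {x}) \<in> ksubsets n d \<and> p (insert y (B - {x})) \<noteq> 0"
    if B: "B \<in> ksubsets n d" "p B \<noteq> 0" and C: "C \<in> ksubsets n d" "p C \<noteq> 0" and x: "x \<in> B - C" for B C x
  proof (rule ccontr)
    assume contra: "\<not> ?thesis"
    have fin: "finite B" "finite C" using B C ksubsets_finite by auto
    let ?S1 = "B - {x}" and ?S2 = "insert x C"
    have "card B > 0" using x fin by (auto simp: card_gt_0_iff)
    have sub: "B \<subseteq> {..<n}" "C \<subseteq> {..<n}" and card: "card B = d" "card C = d"
      using B C by (auto simp: ksubsets_def)
    have cB: "card ?S1 + 1 = d" using card_Diff_singleton[of x B] x card \<open>card B > 0\<close> by simp
    have cC: "card ?S2 = d + 1" using x card fin by simp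
    have sub': "?S1 \<subseteq> {..<n}" "?S2 \<subseteq> {..<n}" using sub x by auto
    obtain z :: "nat \<Rightarrow> 'a" where z: "(\<Sum>y\<in>?S2 - ?S1. z y) = 0"
      "\<forall>y\<in>?S2 - ?S1. norm (z y) = norm (p (insert y ?S1)) * norm (p (?S2 - {y}))"
      using minors_plucker[OF A(1) sub'(1) cB sub'(2) cC] unfolding A(2) by blast
    have "z y = 0" if y: "y \<in> ?S2 - ?S1 - {x}" for y
    proof -
      have "y \<in> C - B" using y x by auto
      moreover from this have "insert y (B - {x}) \<in> ksubsets n d"
        using sub cB fin by (simp add: ksubsets_def subset_iff)
      ultimately have "p (insert y ?S1) = 0" using contra by blast
      then have "norm (p (insert y ?S1)) * norm (p (?S2 - {y})) = 0" by (simp only: norm_zero mult_zero_left)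
      moreover have "y \<in> ?S2 - ?S1" using y by blast
      ultimately have "norm (z y) = 0" using z(2) by metis
      then show ?thesis by simp
    qed
    moreover have xin: "x \<in> ?S2 - ?S1" by simp
    moreover have "finite (?S2 - ?S1)" using fin by simp
    ultimately have "(\<Sum>y\<in>?S2 - ?S1. z y) = (\<Sum>y\<in>{x}. z y)"
      by (intro sum.mono_neutral_right) blast+
    then have "z x = 0" unfolding z(1) by simp
    moreover have "insert x ?S1 = B" "?S2 - {x} = C" using x by auto
    then have "norm (z x) = norm (p B) * norm (p C)"
      using bspec[OF z(2) xin] by metis
    ultimately show False using B C by simp
  qed
  ultimately show ?thesis unfolding matroid_bases_def by (intro conjI ballI) auto
qed

section \<open>Multiaffine Lorentzian polynomials\<close>

lemma lookup_exponent_of: "finite S \<Longrightarrow> Poly_Mapping.lookup (exponent_of S) i = (if i \<in> S then 1 else 0)"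
  unfolding exponent_of_def by (simp add: lookup_sum lookup_single when_def)

lemma keys_exponent_of: "finite S \<Longrightarrow> Poly_Mapping.keys (exponent_of S) = S"
  by (auto simp: in_keys_iff lookup_exponent_of split: if_splits)

lemma exponent_of_eq_iff: "finite S \<Longrightarrow> finite T \<Longrightarrow> exponent_of S = exponent_of T \<longleftrightarrow> S = T"
  using keys_exponent_of by metis

lemma inj_on_exponent_of: "inj_on exponent_of (ksubsets n d)"
  by (rule inj_onI) (metis exponent_of_eq_iff ksubsets_finite)

lemma lookup_multiaffine_poly:
  assumes "\<S> \<subseteq> ksubsets n d"
  shows "Poly_Mapping.lookup (multiaffine_poly \<S> c) m =
     (\<Sum>S\<in>\<S>. if exponent_of S = m then c S else 0)"
  unfolding multiaffine_poly_def by (simp add: lookup_sum lookup_single when_def)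

lemma coeff_at_multiaffine_poly:
  assumes "\<S> \<subseteq> ksubsets n d" "finite S"
  shows "coeff_at (multiaffine_poly \<S> c) S = (if S \<in> \<S> then c S else 0)"
proof -
  have fin: "finite \<S>" using assms finite_ksubsets finite_subset by blast
  have "coeff_at (multiaffine_poly \<S> c) S = (\<Sum>T\<in>\<S>. if exponent_of T = exponent_of S then c T else 0)"
    unfolding coeff_at_def by (rule lookup_multiaffine_poly[OF assms(1)])
  also have "\<dots> = (\<Sum>T\<in>\<S>. if T = S then c T else 0)"
  proof (rule sum.cong[OF refl])
    fix T assume "T \<in> \<S>"
    then have "finite T" using assms(1) ksubsets_finite by blast
    then show "(if exponent_of T = exponent_of S then c T else 0) = (if T = S then c T else 0)"
      using exponent_of_eq_iff[of T S] assms(2) by simp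
  qed
  also have "\<dots> = (if S \<in> \<S> then c S else 0)" using fin by simp
  finally show ?thesis .
qed

lemma keys_multiaffine_poly:
  assumes "\<S> \<subseteq> ksubsets n d"
  shows "Poly_Mapping.keys (multiaffine_poly \<S> c) = exponent_of ` {S \<in> \<S>. c S \<noteq> 0}"
proof (intro equalityI subsetI)
  fix m assume m: "m \<in> Poly_Mapping.keys (multiaffine_poly \<S> c)"
  then have "(\<Sum>S\<in>\<S>. if exponent_of S = m then c S else 0) \<noteq> 0"
    using lookup_multiaffine_poly[OF assms] by (simp add: in_keys_iff)
  then obtain S where "S \<in> \<S>" "(if exponent_of S = m then c S else 0) \<noteq> 0"
    by (rule sum.not_neutral_contains_not_neutral)
  then show "m \<in> exponent_of ` {S \<in> \<S>. c S \<noteq> 0}" by (auto split: if_splits)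
next
  fix m assume "m \<in> exponent_of ` {S \<in> \<S>. c S \<noteq> 0}"
  then obtain S where S: "m = exponent_of S" "S \<in> \<S>" "c S \<noteq> 0" by blast
  moreover from S(2) have "finite S" using assms ksubsets_finite by blast
  ultimately have "coeff_at (multiaffine_poly \<S> c) S \<noteq> 0"
    by (simp add: coeff_at_multiaffine_poly[OF assms])
  then show "m \<in> Poly_Mapping.keys (multiaffine_poly \<S> c)"
    by (simp add: coeff_at_def S in_keys_iff)
qed

lemma multiaffine_poly_coeff_at:
  assumes "\<S> \<subseteq> ksubsets n d" "Poly_Mapping.keys f \<subseteq> exponent_of ` \<S>"
  shows "multiaffine_poly \<S> (coeff_at f) = f"
proof (rule poly_mapping_eqI)
  fix m
  show "Poly_Mapping.lookup (multiaffine_poly \<S> (coeff_at f)) m = Poly_Mapping.lookup f m"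
  proof (cases "m \<in> exponent_of ` \<S>")
    case True
    then obtain S where S: "m = exponent_of S" "S \<in> \<S>" by blast
    then have "finite S" using assms ksubsets_finite by blast
    from coeff_at_multiaffine_poly[OF assms(1) this, of "coeff_at f"] S
    show ?thesis by (simp add: coeff_at_def)
  next
    case False
    then have "m \<notin> Poly_Mapping.keys f" "m \<notin> Poly_Mapping.keys (multiaffine_poly \<S> (coeff_at f))"
      using assms keys_multiaffine_poly[OF assms(1)] by auto
    then show ?thesis by (simp add: in_keys_iff)
  qed
qed

lemma lookup_partial:
  "Poly_Mapping.lookup (partial i f) m =
     of_nat (Poly_Mapping.lookup m i + 1) * Poly_Mapping.lookup f (m + Poly_Mapping.single i 1)"
proof -
  let ?e = "Poly_Mapping.single i (1::nat)"
  have "Poly_Mapping.lookup (partial i f) m = (\<Sum>k\<in>Poly_Mapping.keys f.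
      if k - ?e = m then of_nat (Poly_Mapping.lookup k i) * Poly_Mapping.lookup f k else 0)"
    unfolding partial_def by (simp add: lookup_sum lookup_single when_def)
  also have "\<dots> = (\<Sum>k\<in>Poly_Mapping.keys f.
      if k = m + ?e then of_nat (Poly_Mapping.lookup k i) * Poly_Mapping.lookup f k else 0)"
  proof (intro sum.cong refl)
    fix k
    have eq: "k = k - ?e + ?e" if "Poly_Mapping.lookup k i > 0"
      by (rule poly_mapping_eqI) (use that in \<open>auto simp: lookup_add lookup_minus lookup_single when_def\<close>)
    have eq': "m + ?e - ?e = m"
      by (rule poly_mapping_eqI) (simp add: lookup_add lookup_minus)
    have iff: "k - ?e = m \<longleftrightarrow> k = m + ?e" if "Poly_Mapping.lookup k i > 0"
      using eq[OF that] eq' by auto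
    show "(if k - ?e = m then of_nat (Poly_Mapping.lookup k i) * Poly_Mapping.lookup f k else 0) =
        (if k = m + ?e then of_nat (Poly_Mapping.lookup k i) * Poly_Mapping.lookup f k else 0)"
    proof (cases "Poly_Mapping.lookup k i = 0")
      case False
      then show ?thesis using iff by simp
    qed simp
  qed
  also have "\<dots> = of_nat (Poly_Mapping.lookup m i + 1) * Poly_Mapping.lookup f (m + ?e)"
    by (simp add: lookup_add in_keys_iff)
  finally show ?thesis .
qed

definition squarefree_mpoly :: "real_mpoly \<Rightarrow> bool" where
  "squarefree_mpoly f \<longleftrightarrow> (\<forall>m\<in>Poly_Mapping.keys f. \<forall>i. Poly_Mapping.lookup m i \<le> 1)"

text \<open>The factor produced by differentiation differs from 1 only at exponents where a
  squarefree polynomial has coefficient zero, so a partial derivative is a pure shift of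
  exponents.\<close>

lemma squarefree_partial:
  assumes "squarefree_mpoly f"
  shows "Poly_Mapping.lookup (partial i f) m = Poly_Mapping.lookup f (m + Poly_Mapping.single i 1)"
    and "squarefree_mpoly (partial i f)"
proof -
  show *: "Poly_Mapping.lookup (partial i f) m = Poly_Mapping.lookup f (m + Poly_Mapping.single i 1)" for m
  proof (cases "Poly_Mapping.lookup m i = 0")
    case False
    then have "Poly_Mapping.lookup (m + Poly_Mapping.single i 1) i > 1" by (simp add: lookup_add)
    then have "m + Poly_Mapping.single i 1 \<notin> Poly_Mapping.keys f"
      using assms unfolding squarefree_mpoly_def by (metis not_le)
    then show ?thesis by (simp add: lookup_partial in_keys_iff)
  qed (simp add: lookup_partial)
  show "squarefree_mpoly (partial i f)" unfolding squarefree_mpoly_def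
  proof (intro ballI allI)
    fix m j assume "m \<in> Poly_Mapping.keys (partial i f)"
    then have "m + Poly_Mapping.single i 1 \<in> Poly_Mapping.keys f" by (simp add: in_keys_iff *)
    then have "Poly_Mapping.lookup (m + Poly_Mapping.single i 1) j \<le> 1"
      using assms unfolding squarefree_mpoly_def by blast
    then show "Poly_Mapping.lookup m j \<le> 1" by (simp add: lookup_add)
  qed
qed

lemma squarefree_partial_power:
  assumes "squarefree_mpoly f"
  shows "squarefree_mpoly ((partial i ^^ k) f) \<and>
    (\<forall>m. Poly_Mapping.lookup ((partial i ^^ k) f) m = Poly_Mapping.lookup f (m + Poly_Mapping.single i k))"
proof (induction k)
  case (Suc k)
  have "m + Poly_Mapping.single i 1 + Poly_Mapping.single i k = m + Poly_Mapping.single i (Suc k)" for m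
    by (simp add: add.assoc single_add[symmetric])
  then show ?case using Suc squarefree_partial[of "(partial i ^^ k) f" i] by simp
qed (use assms in simp)

lemma squarefree_partials:
  assumes "squarefree_mpoly f" "Poly_Mapping.keys \<alpha> \<subseteq> {..<n}"
  shows "squarefree_mpoly (partials n \<alpha> f)"
    and "Poly_Mapping.lookup (partials n \<alpha> f) m = Poly_Mapping.lookup f (m + \<alpha>)"
proof -
  have *: "squarefree_mpoly (fold (\<lambda>i. partial i ^^ Poly_Mapping.lookup \<alpha> i) xs f) \<and>
    (\<forall>m. Poly_Mapping.lookup (fold (\<lambda>i. partial i ^^ Poly_Mapping.lookup \<alpha> i) xs f) m =
       Poly_Mapping.lookup f (m + (\<Sum>i\<leftarrow>xs. Poly_Mapping.single i (Poly_Mapping.lookup \<alpha> i))))" for xs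
    using assms(1)
  proof (induction xs arbitrary: f)
    case (Cons i xs)
    from squarefree_partial_power[OF Cons.prems, of "Poly_Mapping.lookup \<alpha> i" i]
    show ?case using Cons.IH[of "(partial i ^^ Poly_Mapping.lookup \<alpha> i) f"] by (simp add: ac_simps)
  qed simp
  have "(\<Sum>i\<leftarrow>[0..<n]. Poly_Mapping.single i (Poly_Mapping.lookup \<alpha> i)) = \<alpha>"
  proof (rule poly_mapping_eqI)
    fix j
    have "Poly_Mapping.lookup (\<Sum>i\<leftarrow>[0..<n]. Poly_Mapping.single i (Poly_Mapping.lookup \<alpha> i)) j
      = (\<Sum>i<n. if i = j then Poly_Mapping.lookup \<alpha> i else 0)"
      by (simp add: sum_list_distinct_conv_sum_set lookup_sum lookup_single when_def lessThan_atLeast0)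
    also have "\<dots> = Poly_Mapping.lookup \<alpha> j" using assms(2) by (auto simp: in_keys_iff subset_iff)
    finally show "Poly_Mapping.lookup (\<Sum>i\<leftarrow>[0..<n]. Poly_Mapping.single i (Poly_Mapping.lookup \<alpha> i)) j
      = Poly_Mapping.lookup \<alpha> j" .
  qed
  then show "squarefree_mpoly (partials n \<alpha> f)"
    and "Poly_Mapping.lookup (partials n \<alpha> f) m = Poly_Mapping.lookup f (m + \<alpha>)"
    using *[of "[0..<n]"] by (auto simp: partials_def)
qed

text \<open>The Hessian of the derivative along \<open>T\<close>, written in coefficients. Elements
  of \<open>T\<close> are kept as zero rows and columns so that all contractions share one index
  set.\<close>

definition contraction_matrix :: "nat \<Rightarrow> (nat set \<Rightarrow> real) \<Rightarrow> nat set \<Rightarrow> real mat" where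
  "contraction_matrix n c T = Matrix.mat n n (\<lambda>(i,j).
     if i \<noteq> j \<and> i \<notin> T \<and> j \<notin> T then c (insert i (insert j T)) else 0)"

lemma contraction_matrix_carrier: "contraction_matrix n c T \<in> carrier_mat n n"
  by (simp add: contraction_matrix_def)

lemma contraction_matrix_sym: "(contraction_matrix n c T)\<^sup>T = contraction_matrix n c T"
  by (rule eq_matI) (auto simp: contraction_matrix_def insert_commute)

lemma contraction_matrix_index: "i < n \<Longrightarrow> j < n \<Longrightarrow> contraction_matrix n c T $$ (i,j) =
    (if i \<noteq> j \<and> i \<notin> T \<and> j \<notin> T then c (insert i (insert j T)) else 0)"
  by (simp add: contraction_matrix_def)

lemma squarefree_if_multiaffine:
  assumes "Poly_Mapping.keys f \<subseteq> exponent_of ` ksubsets n d"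
  shows "squarefree_mpoly f"
  unfolding squarefree_mpoly_def
proof (intro ballI allI)
  fix m i assume "m \<in> Poly_Mapping.keys f"
  then obtain S where "m = exponent_of S" "S \<in> ksubsets n d" using assms by blast
  then show "Poly_Mapping.lookup m i \<le> 1" using ksubsets_finite lookup_exponent_of by auto
qed

lemma hessian_partials_index:
  assumes f: "Poly_Mapping.keys f \<subseteq> exponent_of ` ksubsets n d" and \<alpha>: "Poly_Mapping.keys \<alpha> \<subseteq> {..<n}"
    and ij: "i < n" "j < n"
  shows "hessian n (partials n \<alpha> f) $$ (i,j) =
    Poly_Mapping.lookup f (Poly_Mapping.single i 1 + Poly_Mapping.single j 1 + \<alpha>)"
proof -
  have sf: "squarefree_mpoly f" by (rule squarefree_if_multiaffine[OF f])
  note 1 = squarefree_partials[OF sf \<alpha>]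
  note 2 = squarefree_partial[OF 1(1)]
  show ?thesis using ij by (simp add: hessian_def squarefree_partial(1)[OF 2(2)] 2(1) 1(2))
qed

lemma hessian_partials_exponent_of:
  assumes f: "Poly_Mapping.keys f \<subseteq> exponent_of ` ksubsets n d" and T: "T \<subseteq> {..<n}"
  shows "hessian n (partials n (exponent_of T) f) = contraction_matrix n (coeff_at f) T"
proof (rule eq_matI)
  have fin: "finite T" using T finite_subset by blast
  fix i j assume "i < dim_row (contraction_matrix n (coeff_at f) T)" "j < dim_col (contraction_matrix n (coeff_at f) T)"
  then have ij: "i < n" "j < n" by (auto simp: contraction_matrix_def)
  let ?m = "Poly_Mapping.single i 1 + Poly_Mapping.single j 1 + exponent_of T"
  have "Poly_Mapping.lookup f ?m = (if i \<noteq> j \<and> i \<notin> T \<and> j \<notin> T then coeff_at f (insert i (insert j T)) else 0)"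
  proof (cases "i \<noteq> j \<and> i \<notin> T \<and> j \<notin> T")
    case True
    then have "?m = exponent_of (insert i (insert j T))"
      using fin by (simp add: exponent_of_def add.assoc)
    then show ?thesis using True by (simp add: coeff_at_def)
  next
    case False
    then consider "i = j" | "i \<in> T" | "j \<in> T" by blast
    then have "\<exists>k. Poly_Mapping.lookup ?m k > 1"
    proof cases
      case 1 then show ?thesis by (intro exI[of _ i]) (simp add: lookup_add)
    next
      case 2 then show ?thesis using fin by (intro exI[of _ i]) (simp add: lookup_add lookup_exponent_of)
    next
      case 3 then show ?thesis using fin by (intro exI[of _ j]) (simp add: lookup_add lookup_exponent_of)
    qed
    then have "?m \<notin> Poly_Mapping.keys f"
      using squarefree_if_multiaffine[OF f] unfolding squarefree_mpoly_def by (metis not_le)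
    then show ?thesis using False by (auto simp: in_keys_iff)
  qed
  then show "hessian n (partials n (exponent_of T) f) $$ (i,j) = contraction_matrix n (coeff_at f) T $$ (i,j)"
    using hessian_partials_index[OF f _ ij, of "exponent_of T"] T fin ij
    by (simp add: keys_exponent_of contraction_matrix_index)
qed (auto simp: hessian_def contraction_matrix_def)

text \<open>A derivative with a repeated variable annihilates a multiaffine polynomial, and the zero
  Hessian passes the eigenvalue test; only derivatives along sets remain.\<close>

lemma hessians_iff_contraction_matrices:
  assumes f: "Poly_Mapping.keys f \<subseteq> exponent_of ` ksubsets n d"
  shows "(\<forall>k \<alpha>. k + 2 = d \<and> \<alpha> \<in> exponents n k \<longrightarrow> at_most_one_positive_eigenvalue (hessian n (partials n \<alpha> f)))
    \<longleftrightarrow> (\<forall>T. T \<subseteq> {..<n} \<and> card T + 2 = d \<longrightarrow> at_most_one_positive_eigenvalue (contraction_matrix n (coeff_at f) T))"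
    (is "?L \<longleftrightarrow> ?R")
proof
  assume L: ?L
  show ?R
  proof (intro allI impI, elim conjE)
    fix T assume T: "T \<subseteq> {..<n}" "card T + 2 = d"
    have fin: "finite T" using T finite_subset by blast
    have "exponent_of T \<in> exponents n (card T)"
      using T fin by (simp add: exponents_def keys_exponent_of lookup_exponent_of)
    then show "at_most_one_positive_eigenvalue (contraction_matrix n (coeff_at f) T)"
      using L T hessian_partials_exponent_of[OF f T(1)] by metis
  qed
next
  assume R: ?R
  show ?L
  proof (intro allI impI, elim conjE)
    fix k \<alpha> assume k: "k + 2 = d" and \<alpha>: "\<alpha> \<in> exponents n k"
    show "at_most_one_positive_eigenvalue (hessian n (partials n \<alpha> f))"
    proof (cases "\<forall>i. Poly_Mapping.lookup \<alpha> i \<le> 1")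
      case True
      define T where "T = Poly_Mapping.keys \<alpha>"
      have "\<alpha> = exponent_of T"
      proof (rule poly_mapping_eqI)
        fix i
        show "Poly_Mapping.lookup \<alpha> i = Poly_Mapping.lookup (exponent_of T) i"
          using True[rule_format, of i] by (simp add: T_def lookup_exponent_of in_keys_iff)
      qed
      moreover have "T \<subseteq> {..<n}" using \<alpha> by (simp add: T_def exponents_def)
      moreover have "card T = k"
      proof -
        have "card T = (\<Sum>i\<in>T. Poly_Mapping.lookup \<alpha> i)"
          unfolding card_eq_sum
        proof (rule sum.cong)
          fix i assume "i \<in> T"
          then show "1 = Poly_Mapping.lookup \<alpha> i"
            using True[rule_format, of i] by (simp add: T_def in_keys_iff)
        qed simp
        then show ?thesis using \<alpha> by (simp add: T_def exponents_def)
      qed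
      ultimately show ?thesis using R k hessian_partials_exponent_of[OF f] by simp
    next
      case False
      then obtain l where l: "Poly_Mapping.lookup \<alpha> l > 1" by (auto simp: not_le)
      have \<alpha>n: "Poly_Mapping.keys \<alpha> \<subseteq> {..<n}" using \<alpha> by (simp add: exponents_def)
      have zero: "hessian n (partials n \<alpha> f) = 0\<^sub>m n n"
      proof (rule eq_matI)
        fix i j assume "i < dim_row (0\<^sub>m n n :: real mat)" "j < dim_col (0\<^sub>m n n :: real mat)"
        then have ij: "i < n" "j < n" by auto
        let ?m = "Poly_Mapping.single i 1 + Poly_Mapping.single j 1 + \<alpha>"
        have "Poly_Mapping.lookup ?m l > 1" using l by (simp add: lookup_add)
        then have "?m \<notin> Poly_Mapping.keys f"
          using squarefree_if_multiaffine[OF f] unfolding squarefree_mpoly_def by (metis not_le)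
        then show "hessian n (partials n \<alpha> f) $$ (i,j) = 0\<^sub>m n n $$ (i,j)"
          using hessian_partials_index[OF f \<alpha>n ij] ij by (simp add: in_keys_iff)
      qed (auto simp: hessian_def)
      show ?thesis unfolding zero
        by (rule at_most_one_positive_eigenvalueI[of _ n "\<lambda>_. 0"]) auto
    qed
  qed
qed

lemma matroid_bases_M_convex:
  assumes M: "matroid_bases n d \<B>"
  shows "M_convex (exponent_of ` \<B>)"
  unfolding M_convex_def
proof (intro ballI allI impI)
  fix \<alpha> \<beta> i assume "\<alpha> \<in> exponent_of ` \<B>" "\<beta> \<in> exponent_of ` \<B>"
    and gt: "Poly_Mapping.lookup \<beta> i < Poly_Mapping.lookup \<alpha> i"
  then obtain A B where AB: "\<alpha> = exponent_of A" "A \<in> \<B>" "\<beta> = exponent_of B" "B \<in> \<B>" by blast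
  have "\<B> \<subseteq> ksubsets n d" using M unfolding matroid_bases_def by simp
  then have fin: "finite A" "finite B" using AB ksubsets_finite by blast+
  have i: "i \<in> A - B" using gt fin by (auto simp: AB lookup_exponent_of split: if_splits)
  then obtain j where j: "j \<in> B - A" "insert j (A - {i}) \<in> \<B>"
    using M AB unfolding matroid_bases_def by blast
  have "\<alpha> - Poly_Mapping.single i 1 + Poly_Mapping.single j 1 = exponent_of (insert j (A - {i}))"
  proof (rule poly_mapping_eqI)
    fix k
    have "finite (insert j (A - {i}))" using fin by simp
    then show "Poly_Mapping.lookup (\<alpha> - Poly_Mapping.single i 1 + Poly_Mapping.single j 1) k =
        Poly_Mapping.lookup (exponent_of (insert j (A - {i}))) k"
      using fin(1) i j(1) unfolding AB(1) lookup_add lookup_minus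
      by (cases "k = j"; cases "k = i") (simp_all add: lookup_single lookup_exponent_of when_def)
  qed
  then have "\<alpha> - Poly_Mapping.single i 1 + Poly_Mapping.single j 1 \<in> exponent_of ` \<B>"
    using imageI[OF j(2), of exponent_of] by (simp only:)
  moreover have "Poly_Mapping.lookup \<alpha> j < Poly_Mapping.lookup \<beta> j"
    using j(1) fin by (simp add: AB lookup_exponent_of)
  ultimately show "\<exists>j. Poly_Mapping.lookup \<alpha> j < Poly_Mapping.lookup \<beta> j \<and>
      \<alpha> - Poly_Mapping.single i 1 + Poly_Mapping.single j 1 \<in> exponent_of ` \<B>"
    by (intro exI[of _ j] conjI)
qed

lemma exponent_of_in_exponents: "S \<in> ksubsets n d \<Longrightarrow> exponent_of S \<in> exponents n d"
proof -
  assume S: "S \<in> ksubsets n d"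
  then have fin: "finite S" by (rule ksubsets_finite)
  have "(\<Sum>i\<in>S. Poly_Mapping.lookup (exponent_of S) i) = (\<Sum>i\<in>S. 1)"
    by (rule sum.cong) (use fin in \<open>simp_all add: lookup_exponent_of\<close>)
  then show ?thesis using S fin unfolding exponents_def ksubsets_def by (simp add: keys_exponent_of)
qed

lemma L_mat_iff:
  assumes M: "matroid_bases n d \<B>" and keys: "Poly_Mapping.keys f = exponent_of ` \<B>"
  shows "f \<in> L_mat n d \<B> \<longleftrightarrow> (\<forall>S\<in>\<B>. coeff_at f S \<ge> 0) \<and>
    (\<forall>T. T \<subseteq> {..<n} \<and> card T + 2 = d \<longrightarrow> at_most_one_positive_eigenvalue (contraction_matrix n (coeff_at f) T))"
proof -
  have sub: "\<B> \<subseteq> ksubsets n d" and ne: "\<B> \<noteq> {}" using M unfolding matroid_bases_def by auto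
  have f: "Poly_Mapping.keys f \<subseteq> exponent_of ` ksubsets n d" using keys sub by auto
  have "f \<noteq> 0" using keys ne by auto
  moreover have "Poly_Mapping.keys f \<subseteq> exponents n d" using f exponent_of_in_exponents by blast
  moreover have "(\<forall>m. Poly_Mapping.lookup f m \<ge> 0) \<longleftrightarrow> (\<forall>S\<in>\<B>. coeff_at f S \<ge> 0)"
  proof -
    have "(\<forall>m. Poly_Mapping.lookup f m \<ge> 0) \<longleftrightarrow> (\<forall>m\<in>Poly_Mapping.keys f. Poly_Mapping.lookup f m \<ge> 0)"
      by (metis in_keys_iff order_refl)
    then show ?thesis by (simp add: keys coeff_at_def)
  qed
  ultimately show ?thesis
    unfolding L_mat_def lorentzian_def mem_Collect_eq hessians_iff_contraction_matrices[OF f]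
    using keys matroid_bases_M_convex[OF M] by simp
qed

section \<open>Continuity of coefficients and of multiaffine polynomials\<close>

text \<open>The distance of two polynomials is the sum of the distances of their coefficients, so
  taking one coefficient is 1-Lipschitz.\<close>

lemma continuous_on_coeff_at: "continuous_on X (\<lambda>f. coeff_at f S)"
proof (rule continuous_on_subset)
  have "dist (coeff_at f S) (coeff_at g S) \<le> dist f g" for f g :: real_mpoly
  proof (cases "exponent_of S \<in> Poly_Mapping.keys f \<union> Poly_Mapping.keys g")
    case True
    show ?thesis unfolding dist_poly_mapping_def coeff_at_def
      by (rule member_le_sum[OF True]) auto
  next
    case False
    then show ?thesis by (simp add: coeff_at_def in_keys_iff)
  qed
  then have "dist f g < e \<longrightarrow> dist (coeff_at f S) (coeff_at g S) < e" for f g :: real_mpoly and e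
    by (blast intro: order_le_less_trans)
  then show "continuous_on UNIV (\<lambda>f. coeff_at f S)"
    unfolding continuous_on_iff by (intro ballI allI impI) blast
qed simp

lemma lookup_scaleR: "Poly_Mapping.lookup (r *\<^sub>R f) m = r *\<^sub>R Poly_Mapping.lookup f m"
proof -
  have "{i. r *\<^sub>R Poly_Mapping.lookup f i \<noteq> 0} \<subseteq> Poly_Mapping.keys f"
    by (auto simp: in_keys_iff)
  then have "finite {i. r *\<^sub>R Poly_Mapping.lookup f i \<noteq> 0}" by (rule finite_subset) simp
  then show ?thesis unfolding scaleR_poly_mapping_def by (simp add: lookup_Abs_poly_mapping)
qed

lemma continuous_on_multiaffine_poly:
  assumes "\<And>S. S \<in> \<S> \<Longrightarrow> continuous_on X (\<lambda>x. c x S)"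
  shows "continuous_on X (\<lambda>x. multiaffine_poly \<S> (c x))"
proof -
  have "Poly_Mapping.single e a = a *\<^sub>R Poly_Mapping.single e (1::real)" for e :: "nat \<Rightarrow>\<^sub>0 nat" and a
    by (rule poly_mapping_eqI) (simp add: lookup_single when_def lookup_scaleR)
  then have "multiaffine_poly \<S> (c x) = (\<Sum>S\<in>\<S>. c x S *\<^sub>R Poly_Mapping.single (exponent_of S) 1)" for x
    unfolding multiaffine_poly_def by (intro sum.cong refl)
  then have eq: "(\<lambda>x. multiaffine_poly \<S> (c x)) =
      (\<lambda>x. \<Sum>S\<in>\<S>. c x S *\<^sub>R Poly_Mapping.single (exponent_of S) 1)" by (rule ext)
  show ?thesis unfolding eq
    by (intro continuous_on_sum continuous_on_scaleR continuous_on_const assms)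
qed

section \<open>The Cauchy-Binet formula and stability\<close>

lemma cols_det_expand:
  "cols_det d A f = (\<Sum>\<pi> | \<pi> permutes {..<d}. signof \<pi> * (\<Prod>k<d. A $$ (\<pi> k, f k)))"
proof -
  let ?M = "Matrix.mat d d (\<lambda>(r,k). A $$ (r, f k))"
  have "cols_det d A f = (\<Sum>\<pi> | \<pi> permutes {0..<d}. signof \<pi> * (\<Prod>k<d. ?M $$ (\<pi> k, k)))"
    unfolding cols_det_def by (rule det_col) simp
  also have "\<dots> = (\<Sum>\<pi> | \<pi> permutes {..<d}. signof \<pi> * (\<Prod>k<d. A $$ (\<pi> k, f k)))"
    unfolding lessThan_atLeast0
  proof (rule sum.cong[OF refl])
    fix \<pi> assume "\<pi> \<in> {\<pi>. \<pi> permutes {0..<d}}"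
    then have "\<pi> k < d" if "k < d" for k using permutes_in_image[of \<pi> "{0..<d}" k] that by simp
    then have "(\<Prod>k = 0..<d. ?M $$ (\<pi> k, k)) = (\<Prod>k = 0..<d. A $$ (\<pi> k, f k))"
      by (intro prod.cong) simp_all
    then show "signof \<pi> * (\<Prod>k = 0..<d. ?M $$ (\<pi> k, k)) = signof \<pi> * (\<Prod>k = 0..<d. A $$ (\<pi> k, f k))"
      by simp
  qed
  finally show ?thesis .
qed

text \<open>Summing over all column maps, injective or not, lets the sum of products factor as a
  product of sums over single columns. After Leibniz expansion of both determinants, each
  \<open>\<pi>\<close> leaves the determinant of \<open>M\<close> with permuted rows; its sign
  cancels the sign of \<open>\<pi>\<close>, so all \<open>fact d\<close> permutations contribute
  equally.\<close>

lemma sum_maps_cols_det: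
  fixes A B :: "'a::field_char_0 mat" and z :: "nat \<Rightarrow> 'a" and d n :: nat
  defines "M \<equiv> Matrix.mat d d (\<lambda>(r,s). \<Sum>j<n. A $$ (r,j) * z j * B $$ (s,j))"
  shows "(\<Sum>f\<in>{..<d} \<rightarrow>\<^sub>E {..<n}. cols_det d A f * cols_det d B f * (\<Prod>k<d. z (f k))) = fact d * Determinant.det M"
proof -
  let ?F = "{..<d} \<rightarrow>\<^sub>E {..<n}" and ?P = "{\<pi>. \<pi> permutes {..<d}}"
  have "(\<Sum>f\<in>?F. cols_det d A f * cols_det d B f * (\<Prod>k<d. z (f k))) =
     (\<Sum>f\<in>?F. \<Sum>\<pi>\<in>?P. \<Sum>\<sigma>\<in>?P. signof \<pi> * signof \<sigma> * (\<Prod>k<d. A $$ (\<pi> k, f k) * z (f k) * B $$ (\<sigma> k, f k)))"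
    unfolding cols_det_expand
    unfolding sum_product
    unfolding sum_distrib_right prod.distrib
    by (intro sum.cong refl) (simp only: ac_simps)
  also have "\<dots> = (\<Sum>\<pi>\<in>?P. \<Sum>f\<in>?F. \<Sum>\<sigma>\<in>?P. signof \<pi> * signof \<sigma> * (\<Prod>k<d. A $$ (\<pi> k, f k) * z (f k) * B $$ (\<sigma> k, f k)))"
    by (rule sum.swap)
  also have "\<dots> = (\<Sum>\<pi>\<in>?P. \<Sum>\<sigma>\<in>?P. \<Sum>f\<in>?F. signof \<pi> * signof \<sigma> * (\<Prod>k<d. A $$ (\<pi> k, f k) * z (f k) * B $$ (\<sigma> k, f k)))"
    by (intro sum.cong refl sum.swap)
  also have "\<dots> = (\<Sum>\<pi>\<in>?P. Determinant.det M)"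
  proof (rule sum.cong[OF refl])
    fix \<pi> assume "\<pi> \<in> ?P"
    then have \<pi>: "\<pi> permutes {..<d}" by simp
    have inner: "(\<Sum>f\<in>?F. signof \<pi> * signof \<sigma> * (\<Prod>k<d. A $$ (\<pi> k, f k) * z (f k) * B $$ (\<sigma> k, f k))) =
        signof \<pi> * (signof \<sigma> * (\<Prod>k<d. M $$ (\<pi> k, \<sigma> k)))" if "\<sigma> \<in> ?P" for \<sigma>
    proof -
      have "(\<Prod>k<d. M $$ (\<pi> k, \<sigma> k)) = (\<Prod>k<d. \<Sum>j<n. A $$ (\<pi> k, j) * z j * B $$ (\<sigma> k, j))"
      proof (rule prod.cong[OF refl])
        fix k assume "k \<in> {..<d}"
        then have "\<pi> k < d" "\<sigma> k < d" using \<pi> that permutes_in_image[of _ "{..<d}" k] by auto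
        then show "M $$ (\<pi> k, \<sigma> k) = (\<Sum>j<n. A $$ (\<pi> k, j) * z j * B $$ (\<sigma> k, j))" by (simp add: M_def)
      qed
      also have "\<dots> = (\<Sum>f\<in>?F. \<Prod>k<d. A $$ (\<pi> k, f k) * z (f k) * B $$ (\<sigma> k, f k))"
        by (rule prod_sum_PiE) auto
      finally show ?thesis by (simp add: sum_distrib_left mult.assoc)
    qed
    have "(\<Sum>\<sigma>\<in>?P. \<Sum>f\<in>?F. signof \<pi> * signof \<sigma> * (\<Prod>k<d. A $$ (\<pi> k, f k) * z (f k) * B $$ (\<sigma> k, f k))) =
      signof \<pi> * (\<Sum>\<sigma>\<in>?P. signof \<sigma> * (\<Prod>k<d. M $$ (\<pi> k, \<sigma> k)))"
      unfolding sum_distrib_left by (rule sum.cong[OF refl inner])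
    also have "(\<Sum>\<sigma>\<in>?P. signof \<sigma> * (\<Prod>k<d. M $$ (\<pi> k, \<sigma> k))) =
        Determinant.det (Matrix.mat d d (\<lambda>(i,j). M $$ (\<pi> i, j)))"
      by (subst det_def'[of _ d])
        (auto simp: lessThan_atLeast0 permutes_in_image intro!: sum.cong prod.cong arg_cong2[of _ _ _ _ "(*)"])
    also have "\<dots> = signof \<pi> * Determinant.det M"
      by (rule det_permute_rows) (use \<pi> in \<open>auto simp: M_def lessThan_atLeast0\<close>)
    also have "signof \<pi> * (signof \<pi> * Determinant.det M) = Determinant.det M"
      by (simp add: sign_def)
    finally show "(\<Sum>\<sigma>\<in>?P. \<Sum>f\<in>?F. signof \<pi> * signof \<sigma> * (\<Prod>k<d. A $$ (\<pi> k, f k) * z (f k) * B $$ (\<sigma> k, f k))) =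
        Determinant.det M" .
  qed
  also have "\<dots> = fact d * Determinant.det M"
    using card_permutations[of "{..<d}" d] by simp
  finally show ?thesis .
qed

text \<open>An injective list of columns is a set together with an ordering. Grouping the column
  maps by their image gives classes of \<open>fact d\<close> members each, which accounts for the
  factorial in \<open>sum_maps_cols_det\<close>.\<close>

lemma bij_betw_injections:
  "bij_betw (\<lambda>(S, \<pi>). restrict (pick S \<circ> \<pi>) {..<d}) (ksubsets n d \<times> {\<pi>. \<pi> permutes {..<d}})
     {f \<in> {..<d} \<rightarrow>\<^sub>E {..<n}. inj_on f {..<d}}"
proof -
  let ?D = "{..<d}" and ?I = "{f \<in> {..<d} \<rightarrow>\<^sub>E {..<n}. inj_on f {..<d}}"
  define enc where "enc = (\<lambda>(S, \<pi>). restrict (pick S \<circ> \<pi>) ?D)"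
  \<comment> \<open>Two default values meet here: \<open>permutes\<close> wants the identity beyond
    \<open>d\<close>, while the maps in the extensional function space are \<open>undefined\<close>
    there.\<close>
  define pos where "pos S f = (\<lambda>k. if k < d then inv_into ?D (pick S) (f k) else k)" for S and f :: "nat \<Rightarrow> nat"
  have enc: "enc (S, \<pi>) k = (if k < d then pick S (\<pi> k) else undefined)" for S \<pi> k
    by (simp add: enc_def)
  have pick: "bij_betw (pick S) ?D S" if "S \<in> ksubsets n d" for S
    using bij_betw_pick[of S] that ksubsets_finite[OF that] by (auto simp: ksubsets_def)
  have im: "f ` ?D \<in> ksubsets n d" if "f \<in> ?I" for f
  proof -
    have "inj_on f ?D" and "f \<in> ?D \<rightarrow>\<^sub>E {..<n}" using that by simp_all
    then have "card (f ` ?D) = d" "f ` ?D \<subseteq> {..<n}"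
      by (simp add: card_image, blast dest: PiE_mem)
    then show ?thesis by (simp add: ksubsets_def)
  qed
  have enc_im: "enc (S, \<pi>) ` ?D = S" if S: "S \<in> ksubsets n d" and \<pi>: "\<pi> permutes ?D" for S \<pi>
  proof -
    have "enc (S, \<pi>) ` ?D = (pick S \<circ> \<pi>) ` ?D" by (rule image_cong) (simp_all add: enc)
    then have "enc (S, \<pi>) ` ?D = pick S ` (\<pi> ` ?D)" by (simp only: image_comp)
    then show ?thesis using pick[OF S] permutes_image[OF \<pi>] by (simp add: bij_betw_def)
  qed
  have pos_enc: "pos S (enc (S, \<pi>)) = \<pi>" if S: "S \<in> ksubsets n d" and \<pi>: "\<pi> permutes ?D" for S \<pi>
  proof
    fix k
    show "pos S (enc (S, \<pi>)) k = \<pi> k"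
    proof (cases "k < d")
      case True
      then have "\<pi> k \<in> ?D" using permutes_in_image[OF \<pi>, of k] by simp
      then show ?thesis using True bij_betw_inv_into_left[OF pick[OF S]] by (simp add: pos_def enc)
    next
      case False
      then show ?thesis using permutes_not_in[OF \<pi>, of k] by (simp add: pos_def)
    qed
  qed
  have enc_pos: "enc (f ` ?D, pos (f ` ?D) f) = f" if f: "f \<in> ?I" for f
  proof
    fix k
    show "enc (f ` ?D, pos (f ` ?D) f) k = f k"
    proof (cases "k < d")
      case True
      then have "f k \<in> f ` ?D" by simp
      then show ?thesis using True bij_betw_inv_into_right[OF pick[OF im[OF f]]]
        by (simp add: enc pos_def)
    next
      case False
      then show ?thesis using f PiE_arb[of f ?D "\<lambda>_. {..<n}" k] by (simp add: enc)
    qed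
  qed
  have pos_perm: "pos (f ` ?D) f permutes ?D" if f: "f \<in> ?I" for f
  proof -
    have "bij_betw f ?D (f ` ?D)" using f by (simp add: bij_betw_def)
    then have "bij_betw (inv_into ?D (pick (f ` ?D)) \<circ> f) ?D ?D"
      by (rule bij_betw_trans[OF _ bij_betw_inv_into[OF pick[OF im[OF f]]]])
    then have "bij_betw (pos (f ` ?D) f) ?D ?D"
      by (rule bij_betw_cong[THEN iffD1, rotated]) (simp add: pos_def)
    then show ?thesis by (rule bij_imp_permutes) (simp add: pos_def)
  qed
  have enc_in: "enc (S, \<pi>) \<in> ?I" if S: "S \<in> ksubsets n d" and \<pi>: "\<pi> permutes ?D" for S \<pi>
  proof -
    have "pick S k < n" if "k < d" for k
    proof -
      have "pick S k \<in> S" using bij_betwE[OF pick[OF S]] that by simp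
      then show ?thesis using S by (auto simp: ksubsets_def)
    qed
    moreover have "\<pi> k < d" if "k < d" for k using permutes_in_image[OF \<pi>, of k] that by simp
    ultimately have "enc (S, \<pi>) \<in> ?D \<rightarrow>\<^sub>E {..<n}" by (intro PiE_I) (simp_all add: enc)
    moreover have "inj_on (pick S \<circ> \<pi>) ?D"
      using bij_betw_trans[OF permutes_imp_bij[OF \<pi>] pick[OF S]] by (rule bij_betw_imp_inj_on)
    then have "inj_on (enc (S, \<pi>)) ?D"
      unfolding inj_on_def by (auto simp: enc)
    ultimately show ?thesis by (intro CollectI conjI)
  qed
  show ?thesis unfolding enc_def[symmetric]
  proof (rule bij_betw_byWitness[where f' = "\<lambda>f. (f ` ?D, pos (f ` ?D) f)"])
    show "\<forall>a\<in>ksubsets n d \<times> {\<pi>. \<pi> permutes ?D}. (enc a ` ?D, pos (enc a ` ?D) (enc a)) = a"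
    proof
      fix a assume "a \<in> ksubsets n d \<times> {\<pi>. \<pi> permutes ?D}"
      then obtain S \<pi> where a: "a = (S, \<pi>)" "S \<in> ksubsets n d" "\<pi> permutes ?D" by blast
      show "(enc a ` ?D, pos (enc a ` ?D) (enc a)) = a"
        unfolding a(1) enc_im[OF a(2,3)] pos_enc[OF a(2,3)] ..
    qed
    show "\<forall>f\<in>?I. enc (f ` ?D, pos (f ` ?D) f) = f" by (intro ballI enc_pos)
    show "enc ` (ksubsets n d \<times> {\<pi>. \<pi> permutes ?D}) \<subseteq> ?I"
    proof (rule image_subsetI)
      fix a assume "a \<in> ksubsets n d \<times> {\<pi>. \<pi> permutes ?D}"
      then obtain S \<pi> where a: "a = (S, \<pi>)" "S \<in> ksubsets n d" "\<pi> permutes ?D" by blast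
      show "enc a \<in> ?I" unfolding a(1) by (rule enc_in[OF a(2,3)])
    qed
    show "(\<lambda>f. (f ` ?D, pos (f ` ?D) f)) ` ?I \<subseteq> ksubsets n d \<times> {\<pi>. \<pi> permutes ?D}"
      using im pos_perm by (intro image_subsetI SigmaI CollectI)
  qed
qed

text \<open>Noninjective column maps vanish by a repeated column. On injective ones the sign of the
  ordering occurs in both determinants and cancels, so the summand depends on the image
  only.\<close>

theorem cauchy_binet_diag:
  fixes A B :: "'a::field_char_0 mat"
  assumes A: "A \<in> carrier_mat d n" and B: "B \<in> carrier_mat d n"
  shows "Determinant.det (Matrix.mat d d (\<lambda>(r,s). \<Sum>j<n. A $$ (r,j) * z j * B $$ (s,j))) =
    (\<Sum>S\<in>ksubsets n d. maximal_minors d n A S * maximal_minors d n B S * (\<Prod>i\<in>S. z i))"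
proof -
  let ?F = "{..<d} \<rightarrow>\<^sub>E {..<n}"
  let ?g = "\<lambda>f. cols_det d A f * cols_det d B f * (\<Prod>k<d. z (f k))"
  let ?t = "\<lambda>S. maximal_minors d n A S * maximal_minors d n B S * (\<Prod>i\<in>S. z i)"
  have "(\<Sum>f\<in>?F. ?g f) = (\<Sum>f\<in>{f \<in> ?F. inj_on f {..<d}}. ?g f)"
  proof (rule sum.mono_neutral_right)
    show "finite ?F" by (intro finite_PiE) auto
    show "\<forall>f\<in>?F - {f \<in> ?F. inj_on f {..<d}}. ?g f = 0"
    proof
      fix f assume "f \<in> ?F - {f \<in> ?F. inj_on f {..<d}}"
      then obtain k k' where "k < d" "k' < d" "k \<noteq> k'" "f k = f k'" by (auto simp: inj_on_def)
      then have "cols_det d A f = 0" by (rule cols_det_repeated)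
      then show "?g f = 0" by simp
    qed
  qed auto
  also have "\<dots> = (\<Sum>(S,\<pi>)\<in>ksubsets n d \<times> {\<pi>. \<pi> permutes {..<d}}. ?g (restrict (pick S \<circ> \<pi>) {..<d}))"
    by (subst sum.reindex_bij_betw[OF bij_betw_injections, symmetric]) (simp add: case_prod_unfold)
  also have "\<dots> = (\<Sum>S\<in>ksubsets n d. \<Sum>\<pi> | \<pi> permutes {..<d}. ?g (restrict (pick S \<circ> \<pi>) {..<d}))"
    by (rule sum.cartesian_product[symmetric])
  also have "\<dots> = (\<Sum>S\<in>ksubsets n d. \<Sum>\<pi> | \<pi> permutes {..<d}. ?t S)"
  proof (intro sum.cong refl)
    fix S \<pi> assume S: "S \<in> ksubsets n d" and "\<pi> \<in> {\<pi>. \<pi> permutes {..<d}}"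
    then have \<pi>: "\<pi> permutes {..<d}" by simp
    have "cols_det d C (restrict (pick S \<circ> \<pi>) {..<d}) = signof \<pi> * maximal_minors d n C S"
      if C: "C \<in> carrier_mat d n" for C :: "'a mat"
      unfolding maximal_minors_eq_cols_det[OF C S] cols_det_permute[OF \<pi>, symmetric]
      by (rule cols_det_cong) simp
    moreover have "(\<Prod>k<d. z (restrict (pick S \<circ> \<pi>) {..<d} k)) = (\<Prod>i\<in>S. z i)"
    proof -
      have "bij_betw (pick S) {..<d} S"
        using bij_betw_pick[of S] ksubsets_finite[OF S] S by (auto simp: ksubsets_def)
      then have "bij_betw (pick S \<circ> \<pi>) {..<d} S"
        by (rule bij_betw_trans[OF permutes_imp_bij[OF \<pi>]])
      from prod.reindex_bij_betw[OF this, of z] show ?thesis by simp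
    qed
    moreover have "signof \<pi> * a * (signof \<pi> * b) * c = a * b * c" for a b c :: 'a
      by (simp add: sign_def)
    ultimately show "?g (restrict (pick S \<circ> \<pi>) {..<d}) = ?t S" using A B by simp
  qed
  also have "\<dots> = fact d * (\<Sum>S\<in>ksubsets n d. ?t S)"
    using card_permutations[of "{..<d}" d] by (simp add: sum_distrib_left)
  finally have "fact d * Determinant.det (Matrix.mat d d (\<lambda>(r,s). \<Sum>j<n. A $$ (r,j) * z j * B $$ (s,j))) =
    fact d * (\<Sum>S\<in>ksubsets n d. ?t S)"
    unfolding sum_maps_cols_det .
  then show ?thesis by simp
qed

lemma eval_mpoly_multiaffine_poly:
  assumes \<S>: "\<S> \<subseteq> ksubsets n d"
  shows "eval_mpoly (multiaffine_poly \<S> c) z = (\<Sum>S\<in>\<S>. of_real (c S) * (\<Prod>i\<in>S. z i))"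
proof -
  let ?f = "multiaffine_poly \<S> c"
  let ?t = "\<lambda>m. of_real (Poly_Mapping.lookup ?f m) * (\<Prod>i\<in>Poly_Mapping.keys m. z i ^ Poly_Mapping.lookup m i)"
  have fin: "finite \<S>" using \<S> finite_ksubsets finite_subset by blast
  have inj: "inj_on exponent_of \<S>" using inj_on_exponent_of \<S> inj_on_subset by blast
  have "eval_mpoly ?f z = (\<Sum>m\<in>exponent_of ` \<S>. ?t m)"
    unfolding eval_mpoly_def
  proof (rule sum.mono_neutral_left)
    show "Poly_Mapping.keys ?f \<subseteq> exponent_of ` \<S>" unfolding keys_multiaffine_poly[OF \<S>] by blast
  qed (use fin in \<open>simp_all add: in_keys_iff\<close>)
  also have "\<dots> = (\<Sum>S\<in>\<S>. ?t (exponent_of S))"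
    by (simp add: sum.reindex[OF inj])
  also have "\<dots> = (\<Sum>S\<in>\<S>. of_real (c S) * (\<Prod>i\<in>S. z i))"
  proof (rule sum.cong[OF refl])
    fix S assume S: "S \<in> \<S>"
    then have finS: "finite S" using \<S> ksubsets_finite by blast
    have "Poly_Mapping.lookup ?f (exponent_of S) = c S"
      using coeff_at_multiaffine_poly[OF \<S> finS, of c] S by (simp add: coeff_at_def)
    moreover have "(\<Prod>i\<in>S. z i ^ Poly_Mapping.lookup (exponent_of S) i) = (\<Prod>i\<in>S. z i)"
      by (rule prod.cong) (simp_all add: lookup_exponent_of finS)
    ultimately show "?t (exponent_of S) = of_real (c S) * (\<Prod>i\<in>S. z i)"
      by (simp add: keys_exponent_of finS)
  qed
  finally show ?thesis .
qed

lemma realizations_zero_outside: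
  assumes "p \<in> realizations d n \<B>" "\<B> \<subseteq> ksubsets n d" "S \<notin> \<B>"
  shows "p S = 0"
  using assms unfolding realizations_def minor_vectors_def maximal_minors_def by auto

text \<open>If \<open>Im z\<^sub>j > 0\<close> for all \<open>j\<close>, the imaginary part of the Hermitian form of \<open>A diag(z) A\<^sup>*\<close> is positive definite.\<close>

lemma stable_sq_abs_poly:
  fixes p :: "nat set \<Rightarrow> complex"
  assumes M: "matroid_bases n d \<B>" and p: "p \<in> realizations d n \<B>"
  shows "stable_mpoly n (sq_abs_poly \<B> p)"
  unfolding stable_mpoly_def
proof (intro disjI2 allI impI)
  fix z :: "nat \<Rightarrow> complex" assume z: "\<forall>i<n. Im (z i) > 0"
  have sub: "\<B> \<subseteq> ksubsets n d" and ne: "\<B> \<noteq> {}" using M unfolding matroid_bases_def by auto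
  obtain A where A: "A \<in> carrier_mat d n" and pA: "p = maximal_minors d n A"
    using p unfolding realizations_def minor_vectors_def by auto
  let ?B = "map_mat cnj A"
  have B: "?B \<in> carrier_mat d n" using A by simp
  have pB: "maximal_minors d n ?B S = cnj (p S)" if S: "S \<in> ksubsets n d" for S
  proof -
    have "pick S k < n" if "k < d" for k
    proof -
      have "bij_betw (pick S) {..<d} S"
        using bij_betw_pick[of S] ksubsets_finite[OF S] S by (simp add: ksubsets_def)
      then have "pick S k \<in> S" using that bij_betwE by blast
      then show ?thesis using S by (auto simp: ksubsets_def)
    qed
    then have "Matrix.mat d d (\<lambda>(r,k). ?B $$ (r, pick S k)) = map_mat cnj (Matrix.mat d d (\<lambda>(r,k). A $$ (r, pick S k)))"
      using A by (intro eq_matI) simp_all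
    moreover have "Determinant.det (map_mat cnj X) = cnj (Determinant.det X)" for X :: "complex mat"
    proof -
      interpret comm_ring_hom cnj by unfold_locales auto
      show ?thesis by (rule hom_det)
    qed
    ultimately show ?thesis
      unfolding pA maximal_minors_eq_cols_det[OF A S] maximal_minors_eq_cols_det[OF B S] cols_det_def
      by simp
  qed
  define H where "H = Matrix.mat d d (\<lambda>(r,s). \<Sum>j<n. A $$ (r,j) * z j * ?B $$ (s,j))"
  have Hc: "H \<in> carrier_mat d d" by (simp add: H_def)
  have "eval_mpoly (sq_abs_poly \<B> p) z = (\<Sum>S\<in>\<B>. of_real ((cmod (p S))\<^sup>2) * (\<Prod>i\<in>S. z i))"
    unfolding sq_abs_poly_def by (rule eval_mpoly_multiaffine_poly[OF sub])
  also have "\<dots> = (\<Sum>S\<in>ksubsets n d. of_real ((cmod (p S))\<^sup>2) * (\<Prod>i\<in>S. z i))"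
    by (rule sum.mono_neutral_left[OF finite_ksubsets sub])
      (use realizations_zero_outside[OF p sub] in simp)
  also have "\<dots> = (\<Sum>S\<in>ksubsets n d. maximal_minors d n A S * maximal_minors d n ?B S * (\<Prod>i\<in>S. z i))"
  proof (rule sum.cong[OF refl])
    fix S assume S: "S \<in> ksubsets n d"
    show "of_real ((cmod (p S))\<^sup>2) * (\<Prod>i\<in>S. z i) =
        maximal_minors d n A S * maximal_minors d n ?B S * (\<Prod>i\<in>S. z i)"
      unfolding pB[OF S] pA[symmetric] complex_norm_square ..
  qed
  also have "\<dots> = Determinant.det H" unfolding H_def by (rule cauchy_binet_diag[OF A B, symmetric])
  finally have eval: "eval_mpoly (sq_abs_poly \<B> p) z = Determinant.det H" .
  show "eval_mpoly (sq_abs_poly \<B> p) z \<noteq> 0"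
  proof
    assume "eval_mpoly (sq_abs_poly \<B> p) z = 0"
    then have "Determinant.det H = 0" using eval by simp
    then obtain v where v: "v \<in> carrier_vec d" "v \<noteq> 0\<^sub>v d" "H *\<^sub>v v = 0\<^sub>v d"
      using det_0_iff_vec_prod_zero[OF Hc] by blast
    \<comment> \<open>Here \<open>w\<close> is \<open>A\<^sup>*\<close> applied to the kernel vector
      \<open>v\<close>. Pairing \<open>H v = 0\<close> with \<open>v\<close> gives a sum of
      \<open>z j\<close> times squared moduli of \<open>w j\<close>, whose imaginary part has only
      nonnegative terms.\<close>
    define w where "w j = (\<Sum>s<d. cnj (A $$ (s,j)) * v $ s)" for j
    have row: "(\<Sum>j<n. A $$ (r,j) * z j * w j) = 0" if r: "r < d" for r
    proof -
      have "0 = (H *\<^sub>v v) $ r" using v r by simp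
      also have "\<dots> = (\<Sum>s<d. H $$ (r,s) * v $ s)"
        using Hc v(1) r by (simp add: scalar_prod_def lessThan_atLeast0)
      also have "\<dots> = (\<Sum>s<d. \<Sum>j<n. A $$ (r,j) * z j * (cnj (A $$ (s,j)) * v $ s))"
        using r A by (intro sum.cong refl) (simp add: H_def sum_distrib_right mult.assoc)
      also have "\<dots> = (\<Sum>j<n. \<Sum>s<d. A $$ (r,j) * z j * (cnj (A $$ (s,j)) * v $ s))"
        by (rule sum.swap)
      also have "\<dots> = (\<Sum>j<n. A $$ (r,j) * z j * w j)"
        by (simp add: w_def sum_distrib_left)
      finally show ?thesis by simp
    qed
    have "0 = (\<Sum>r<d. cnj (v $ r) * (\<Sum>j<n. A $$ (r,j) * z j * w j))" using row by simp
    also have "\<dots> = (\<Sum>r<d. \<Sum>j<n. z j * w j * (A $$ (r,j) * cnj (v $ r)))"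
      by (simp add: sum_distrib_left ac_simps)
    also have "\<dots> = (\<Sum>j<n. \<Sum>r<d. z j * w j * (A $$ (r,j) * cnj (v $ r)))"
      by (rule sum.swap)
    also have "\<dots> = (\<Sum>j<n. z j * w j * cnj (w j))"
      by (simp add: w_def sum_distrib_left)
    also have "\<dots> = (\<Sum>j<n. z j * of_real ((cmod (w j))\<^sup>2))"
      by (simp only: complex_norm_square mult.assoc)
    finally have "Im (\<Sum>j<n. z j * of_real ((cmod (w j))\<^sup>2)) = 0" by simp
    then have "(\<Sum>j<n. Im (z j) * (cmod (w j))\<^sup>2) = 0"
      by simp
    then have "\<forall>j\<in>{..<n}. Im (z j) * (cmod (w j))\<^sup>2 = 0"
      using z by (subst (asm) sum_nonneg_eq_0_iff) (simp_all add: less_imp_le)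
    then have w0: "w j = 0" if "j < n" for j
      using z that by (metis lessThan_iff less_irrefl mult_eq_0_iff norm_eq_zero power_eq_0_iff)
    \<comment> \<open>A nonzero \<open>v\<close> annihilated by \<open>A\<^sup>*\<close> is a linear
      dependency among the conjugated rows, so every maximal minor vanishes, although there is at
      least one basis.\<close>
    have "p S = 0" if S: "S \<in> ksubsets n d" for S
    proof -
      let ?X = "Matrix.mat d d (\<lambda>(r,k). cnj (A $$ (r, pick S k)))"
      have pk: "pick S k < n" if "k < d" for k
      proof -
        have "bij_betw (pick S) {..<d} S"
          using bij_betw_pick[of S] ksubsets_finite[OF S] S by (simp add: ksubsets_def)
        then have "pick S k \<in> S" using that bij_betwE by blast
        then show ?thesis using S by (auto simp: ksubsets_def)
      qed
      have "?X\<^sup>T *\<^sub>v v = 0\<^sub>v d"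
      proof (rule eq_vecI)
        fix k assume "k < dim_vec (0\<^sub>v d :: complex Matrix.vec)"
        then have k: "k < d" by simp
        have "(?X\<^sup>T *\<^sub>v v) $ k = w (pick S k)"
          using k v(1) by (simp add: w_def scalar_prod_def lessThan_atLeast0)
        then show "(?X\<^sup>T *\<^sub>v v) $ k = 0\<^sub>v d $ k" using w0[OF pk[OF k]] k by simp
      qed simp
      then have "Determinant.det ?X\<^sup>T = 0"
        using v det_0_iff_vec_prod_zero[of "?X\<^sup>T" d] by auto
      then have "Determinant.det ?X = 0" by (subst (asm) det_transpose[of _ d]) simp_all
      moreover have "Matrix.mat d d (\<lambda>(r,k). ?B $$ (r, pick S k)) = ?X"
        using A pk by (intro eq_matI) simp_all
      ultimately have "cnj (p S) = 0"
        unfolding pB[OF S, symmetric] maximal_minors_eq_cols_det[OF B S] cols_det_def by simp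
      then show ?thesis by simp
    qed
    moreover obtain S where "S \<in> \<B>" using ne by blast
    ultimately show False using p sub unfolding realizations_def by blast
  qed
qed

section \<open>Squared moduli of 2 by 2 minors and the Lorentzian property\<close>

text \<open>The functions \<open>(\<alpha> + \<beta>)/\<surd>2\<close>, \<open>(\<alpha> - \<beta>)/\<surd>2\<close>, \<open>u\<close>, \<open>v\<close> are the coordinates of the Hermitian matrices
  \<open>x x\<^sup>*\<close> for vectors \<open>x\<close> with two entries, on which the determinant is a form of signature \<open>(1,3)\<close>.\<close>

lemma sq_norm_two_minors_complex:
  fixes a b :: "nat \<Rightarrow> complex"
  shows "\<exists>\<alpha> \<beta> u v. \<forall>i j. (norm (a i * b j - a j * b i))\<^sup>2 = \<alpha> i * \<beta> j + \<alpha> j * \<beta> i - 2 * u i * u j - 2 * v i * v j"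
proof (intro exI allI)
  fix i j
  show "(norm (a i * b j - a j * b i))\<^sup>2 = (norm (a i))\<^sup>2 * (norm (b j))\<^sup>2 + (norm (a j))\<^sup>2 * (norm (b i))\<^sup>2
     - 2 * (\<lambda>i. Re (a i * cnj (b i))) i * (\<lambda>i. Re (a i * cnj (b i))) j
     - 2 * (\<lambda>i. Im (a i * cnj (b i))) i * (\<lambda>i. Im (a i * cnj (b i))) j"
    unfolding cmod_power2 by (simp add: algebra_simps power2_eq_square)
qed

text \<open>Real vectors give real symmetric 2 by 2 matrices, and the imaginary coordinate
  disappears. Three functions instead of four is the whole difference between the real and the
  complex threshold.\<close>

lemma sq_norm_two_minors_real:
  fixes a b :: "nat \<Rightarrow> real"
  shows "\<exists>\<alpha> \<beta> u. \<forall>i j. (norm (a i * b j - a j * b i))\<^sup>2 = \<alpha> i * \<beta> j + \<alpha> j * \<beta> i - 2 * u i * u j"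
proof (intro exI allI)
  fix i j
  show "(norm (a i * b j - a j * b i))\<^sup>2 = (a i)\<^sup>2 * (b j)\<^sup>2 + (a j)\<^sup>2 * (b i)\<^sup>2 - 2 * (\<lambda>i. a i * b i) i * (\<lambda>i. a i * b i) j"
    by (simp add: algebra_simps power2_eq_square)
qed

lemma keys_sq_abs_poly:
  fixes p :: "nat set \<Rightarrow> 'a::real_normed_field"
  assumes p: "p \<in> realizations d n \<B>" and sub: "\<B> \<subseteq> ksubsets n d"
  shows "Poly_Mapping.keys (sq_abs_poly \<B> p) = exponent_of ` \<B>"
proof -
  have "{S \<in> \<B>. (norm (p S))\<^sup>2 \<noteq> 0} = \<B>" using p sub unfolding realizations_def by auto
  then show ?thesis unfolding sq_abs_poly_def keys_multiaffine_poly[OF sub] by simp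
qed

lemma coeff_at_sq_abs_poly:
  fixes p :: "nat set \<Rightarrow> 'a::real_normed_field"
  assumes p: "p \<in> realizations d n \<B>" and sub: "\<B> \<subseteq> ksubsets n d" and fin: "finite S"
  shows "coeff_at (sq_abs_poly \<B> p) S = (norm (p S))\<^sup>2"
  using realizations_zero_outside[OF p sub, of S]
  by (simp add: sq_abs_poly_def coeff_at_multiaffine_poly[OF sub fin])

lemma contraction_matrix_realization:
  fixes p :: "nat set \<Rightarrow> 'a::real_normed_field"
  assumes p: "p \<in> realizations d n \<B>" and sub: "\<B> \<subseteq> ksubsets n d"
    and T: "T \<subseteq> {..<n}" "card T + 2 = d"
  shows "\<exists>a b :: nat \<Rightarrow> 'a. \<forall>i<n. \<forall>j<n. contraction_matrix n (coeff_at (sq_abs_poly \<B> p)) T $$ (i,j) =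
     (norm (a i * b j - a j * b i))\<^sup>2"
proof -
  obtain A where A: "A \<in> carrier_mat d n" and pA: "p = maximal_minors d n A"
    using p unfolding realizations_def minor_vectors_def by auto
  obtain a b :: "nat \<Rightarrow> 'a" where ab: "\<forall>x<n. \<forall>y<n. norm (a x * b y - a y * b x) =
      (if x \<noteq> y \<and> x \<notin> T \<and> y \<notin> T then norm (p (insert x (insert y T))) else 0)"
    using minors_rank_two[OF A T] unfolding pA by blast
  have fin: "finite (insert i (insert j T))" for i j using T(1) finite_subset by auto
  have "contraction_matrix n (coeff_at (sq_abs_poly \<B> p)) T $$ (i,j) = (norm (a i * b j - a j * b i))\<^sup>2"
    if ij: "i < n" "j < n" for i j
    unfolding ab[rule_format, OF ij] contraction_matrix_index[OF ij] coeff_at_sq_abs_poly[OF p sub fin] by simp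
  then show ?thesis by blast
qed

text \<open>By the identity \<open>K\<close> the form at \<open>x\<close> is at most twice the
  product of the linear forms of \<open>\<alpha>\<close> and \<open>\<beta>\<close>, hence at most
  half the square of their sum: a single square. The identity is a hypothesis so that both fields
  share the argument.\<close>

lemma sq_abs_poly_in_L_mat:
  fixes p :: "nat set \<Rightarrow> 'a::real_normed_field"
  assumes M: "matroid_bases n d \<B>" and p: "p \<in> realizations d n \<B>"
    and K: "\<And>a b :: nat \<Rightarrow> 'a. \<exists>\<alpha> \<beta> u v. \<forall>i j. (norm (a i * b j - a j * b i))\<^sup>2 =
      \<alpha> i * \<beta> j + \<alpha> j * \<beta> i - 2 * u i * u j - 2 * v i * v j"
  shows "sq_abs_poly \<B> p \<in> L_mat n d \<B>"
proof -
  have sub: "\<B> \<subseteq> ksubsets n d" using M unfolding matroid_bases_def by auto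
  let ?f = "sq_abs_poly \<B> p"
  have nonneg: "coeff_at ?f S \<ge> 0" if "S \<in> \<B>" for S
  proof -
    have "finite S" using that sub ksubsets_finite by blast
    then show ?thesis by (simp add: coeff_at_sq_abs_poly[OF p sub])
  qed
  have "at_most_one_positive_eigenvalue (contraction_matrix n (coeff_at ?f) T)"
    if T: "T \<subseteq> {..<n}" "card T + 2 = d" for T
  proof -
    let ?C = "contraction_matrix n (coeff_at ?f) T"
    obtain a b :: "nat \<Rightarrow> 'a" where ab: "\<forall>i<n. \<forall>j<n. ?C $$ (i,j) = (norm (a i * b j - a j * b i))\<^sup>2"
      using contraction_matrix_realization[OF p sub T] by blast
    obtain \<alpha> \<beta> u v where K: "\<And>i j. (norm (a i * b j - a j * b i))\<^sup>2 =
      \<alpha> i * \<beta> j + \<alpha> j * \<beta> i - 2 * u i * u j - 2 * v i * v j" using K by metis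
    show ?thesis
    proof (rule at_most_one_positive_eigenvalueI[OF contraction_matrix_carrier contraction_matrix_sym])
      fix x :: "nat \<Rightarrow> real"
      let ?s = "\<lambda>g. \<Sum>i<n. x i * g i"
      have prod: "?s g * ?s h = (\<Sum>i<n. \<Sum>j<n. x i * x j * (g i * h j))" for g h :: "nat \<Rightarrow> real"
        unfolding sum_product by (intro sum.cong refl) simp
      have prod': "?s g * ?s h = (\<Sum>i<n. \<Sum>j<n. x i * x j * (g j * h i))" for g h :: "nat \<Rightarrow> real"
        using prod[of h g] by (simp only: mult.commute[of "?s g"] mult.commute[of "g _"])
      have "(\<Sum>i<n. \<Sum>j<n. x i * x j * ?C $$ (i,j)) = (\<Sum>i<n. \<Sum>j<n. x i * x j * (\<alpha> i * \<beta> j) +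
          x i * x j * (\<alpha> j * \<beta> i) - 2 * (x i * x j * (u i * u j)) - 2 * (x i * x j * (v i * v j)))"
        by (intro sum.cong refl) (simp add: ab K algebra_simps)
      also have "\<dots> = 2 * (?s \<alpha> * ?s \<beta>) - 2 * (?s u * ?s u) - 2 * (?s v * ?s v)"
        unfolding sum_subtractf sum.distrib sum_distrib_left[symmetric] prod[symmetric] prod'[symmetric] by simp
      also have "\<dots> \<le> 2 * (?s \<alpha> * ?s \<beta>)" by simp
      also have "\<dots> \<le> (?s \<alpha> + ?s \<beta>)\<^sup>2 / 2"
        using zero_le_power2[of "?s \<alpha> - ?s \<beta>"] by (simp add: power2_eq_square algebra_simps)
      also have "\<dots> = (\<Sum>i<n. (\<alpha> i + \<beta> i) / sqrt 2 * x i)\<^sup>2"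
      proof -
        have "(\<Sum>i<n. (\<alpha> i + \<beta> i) / sqrt 2 * x i) = (?s \<alpha> + ?s \<beta>) / sqrt 2"
          unfolding sum.distrib[symmetric] sum_divide_distrib by (intro sum.cong refl) (simp add: algebra_simps)
        then show ?thesis by (simp add: power_divide)
      qed
      finally show "(\<Sum>i<n. \<Sum>j<n. x i * x j * ?C $$ (i,j)) \<le> (\<Sum>i<n. (\<alpha> i + \<beta> i) / sqrt 2 * x i)\<^sup>2" .
    qed
  qed
  then show ?thesis using nonneg L_mat_iff[OF M keys_sq_abs_poly[OF p sub]] by blast
qed

lemma sq_abs_poly_in_L_mat_complex:
  fixes p :: "nat set \<Rightarrow> complex"
  assumes "matroid_bases n d \<B>" "p \<in> realizations d n \<B>"
  shows "sq_abs_poly \<B> p \<in> L_mat n d \<B>"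
  by (rule sq_abs_poly_in_L_mat[OF assms sq_norm_two_minors_complex])

lemma sq_abs_poly_in_L_mat_real:
  fixes p :: "nat set \<Rightarrow> real"
  assumes "matroid_bases n d \<B>" "p \<in> realizations d n \<B>"
  shows "sq_abs_poly \<B> p \<in> L_mat n d \<B>"
proof (rule sq_abs_poly_in_L_mat[OF assms])
  fix a b :: "nat \<Rightarrow> real"
  obtain \<alpha> \<beta> u where "\<forall>i j. (norm (a i * b j - a j * b i))\<^sup>2 = \<alpha> i * \<beta> j + \<alpha> j * \<beta> i - 2 * u i * u j"
    using sq_norm_two_minors_real by blast
  then show "\<exists>\<alpha> \<beta> u v. \<forall>i j. (norm (a i * b j - a j * b i))\<^sup>2 =
      \<alpha> i * \<beta> j + \<alpha> j * \<beta> i - 2 * u i * u j - 2 * v i * v j"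
    by (intro exI[of _ \<alpha>] exI[of _ \<beta>] exI[of _ u] exI[of _ "\<lambda>_. 0"]) simp
qed

section \<open>Uniform minors\<close>

lemma matroid_bases_exchange:
  assumes "matroid_bases n d \<B>" "A \<in> \<B>" "B \<in> \<B>" "x \<in> A - B"
  shows "\<exists>y\<in>B - A. insert y (A - {x}) \<in> \<B>"
  using assms unfolding matroid_bases_def by blast

lemma matroid_bases_finite:
  assumes "matroid_bases n d \<B>" "A \<in> \<B>"
  shows "finite A" "card A = d" "A \<subseteq> {..<n}"
proof -
  have "A \<in> ksubsets n d" using assms unfolding matroid_bases_def by blast
  then show "finite A" "card A = d" "A \<subseteq> {..<n}"
    by (rule ksubsets_finite) (use \<open>A \<in> ksubsets n d\<close> in \<open>simp_all add: ksubsets_def\<close>)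
qed

text \<open>Elements of \<open>A\<close> outside \<open>I \<union> B\<close> are exchanged one at a
  time against elements of \<open>B\<close>; each exchange shrinks \<open>A - B\<close> and leaves
  \<open>I\<close> alone.\<close>

lemma matroid_bases_extension:
  assumes M: "matroid_bases n d \<B>" and "A \<in> \<B>" "I \<subseteq> A" and B: "B \<in> \<B>"
  shows "\<exists>C\<in>\<B>. I \<subseteq> C \<and> C \<subseteq> I \<union> B"
  using assms(2,3)
proof (induction "card (A - B)" arbitrary: A rule: less_induct)
  case less
  show ?case
  proof (cases "A \<subseteq> I \<union> B")
    case True
    then show ?thesis using less.prems by blast
  next
    case False
    then obtain x where x: "x \<in> A - B" "x \<notin> I" by blast
    from matroid_bases_exchange[OF M less.prems(1) B x(1)]
    obtain y where y: "y \<in> B - A" "insert y (A - {x}) \<in> \<B>" by (rule bexE)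
    have "insert y (A - {x}) - B = A - B - {x}" using y(1) by auto
    then have "insert y (A - {x}) - B \<subset> A - B" using x(1) by auto
    then have "card (insert y (A - {x}) - B) < card (A - B)"
      using matroid_bases_finite(1)[OF M less.prems(1)] by (intro psubset_card_mono) simp_all
    moreover have "I \<subseteq> insert y (A - {x})" using less.prems(2) x by blast
    ultimately show ?thesis using less.hyps[OF _ y(2)] by simp
  qed
qed

text \<open>Extend \<open>I\<close> to a basis \<open>C\<close> using elements of \<open>B\<close>
  only. If \<open>C\<close> missed \<open>J - I\<close>, then \<open>C - I\<close> would fit into
  \<open>B - J\<close>, which has too few elements.\<close>

lemma matroid_bases_augmentation:
  assumes M: "matroid_bases n d \<B>" and A: "A \<in> \<B>" "I \<subseteq> A" and B: "B \<in> \<B>" "J \<subseteq> B"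
    and less: "card I < card J"
  shows "\<exists>y\<in>J - I. \<exists>C\<in>\<B>. insert y I \<subseteq> C"
proof -
  obtain C where C: "C \<in> \<B>" "I \<subseteq> C" "C \<subseteq> I \<union> B"
    using matroid_bases_extension[OF M A B(1)] by blast
  note finC = matroid_bases_finite[OF M C(1)] and finB = matroid_bases_finite[OF M B(1)]
  have "\<exists>y. y \<in> J - I \<and> y \<in> C"
  proof (rule ccontr)
    assume "\<not> ?thesis"
    then have "C - I \<subseteq> B - J" using C by blast
    then have "card (C - I) \<le> card (B - J)" using finB by (intro card_mono) simp_all
    moreover have "card (C - I) = d - card I"
      using C finC by (simp add: card_Diff_subset finite_subset)
    moreover have "card (B - J) = d - card J"
      using B finB by (simp add: card_Diff_subset finite_subset)
    moreover have "card J \<le> d" using B finB card_mono by blast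
    ultimately show False using less by simp
  qed
  then show ?thesis using C by blast
qed

text \<open>Unfolding the minor yields for each \<open>Y\<close> a basis of its own. The point is a
  completion \<open>T\<close> common to all \<open>Y\<close>: it is cut out of one fixed basis
  \<open>B0\<close>, and exchange transports it to every other \<open>Y\<close>.\<close>

lemma uniform_minor_common_completion:
  assumes M: "matroid_bases n d \<B>" and minor: "has_uniform_minor n \<B> r m" and rm: "r \<le> m"
  shows "\<exists>T E. E \<subseteq> {..<n} \<and> card E = m \<and> T \<subseteq> {..<n} \<and> T \<inter> E = {} \<and> (\<forall>Y. Y \<subseteq> E \<and> card Y = r \<longrightarrow> T \<union> Y \<in> \<B>)"
proof -
  let ?N = "{..<n}"
  obtain I J where IJ: "I \<subseteq> ?N" "J \<subseteq> ?N" "I \<inter> J = {}" "card (?N - I - J) = m"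
    and del: "delete_bases (contract_bases ?N \<B> I) J = {S. S \<subseteq> ?N - I - J \<and> card S = r}"
    using minor unfolding has_uniform_minor_def by blast
  define E where "E = ?N - I - J"
  note fin = matroid_bases_finite[OF M]
  \<comment> \<open>The bases with minimal trace outside \<open>I\<close>; their traces are the
    bases of the contraction. By \<open>rank_le\<close> and \<open>rank_eq\<close> below they are
    the bases that meet \<open>I\<close> in as many elements as possible.\<close>
  define CC where "CC = {B\<in>\<B>. \<forall>B'\<in>\<B>. B' - I \<subseteq> B - I \<longrightarrow> B' - I = B - I}"
  have contract: "contract_bases ?N \<B> I \<subseteq> (\<lambda>B. B - I) ` CC"
    and contract': "(\<lambda>B. B - I) ` CC \<subseteq> contract_bases ?N \<B> I"
  proof -
    show "contract_bases ?N \<B> I \<subseteq> (\<lambda>B. B - I) ` CC"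
    proof
      fix X assume "X \<in> contract_bases ?N \<B> I"
      then obtain B where B: "B \<in> \<B>" "X = (?N - I) - ((?N - B) - I)"
        and max: "\<forall>B'\<in>\<B>. (?N - B) - I \<subseteq> (?N - B') - I \<longrightarrow> (?N - B) - I = (?N - B') - I"
        unfolding contract_bases_def dual_bases_def delete_bases_def by auto
      have X: "X = B - I" using B fin(3)[OF B(1)] by blast
      have "B' - I = B - I" if B': "B' \<in> \<B>" "B' - I \<subseteq> B - I" for B'
      proof -
        have "(?N - B) - I \<subseteq> (?N - B') - I" using B' by blast
        then have "(?N - B) - I = (?N - B') - I" using max B'(1) by blast
        then show ?thesis using fin(3)[OF B'(1)] fin(3)[OF B(1)] by blast
      qed
      then show "X \<in> (\<lambda>B. B - I) ` CC" using X B(1) unfolding CC_def by blast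
    qed
    show "(\<lambda>B. B - I) ` CC \<subseteq> contract_bases ?N \<B> I"
    proof
      fix X assume "X \<in> (\<lambda>B. B - I) ` CC"
      then obtain B where B: "B \<in> \<B>" "X = B - I"
        and min: "\<forall>B'\<in>\<B>. B' - I \<subseteq> B - I \<longrightarrow> B' - I = B - I"
        unfolding CC_def by blast
      have "(?N - B) - I = (?N - B') - I" if B': "B' \<in> \<B>" "(?N - B) - I \<subseteq> (?N - B') - I" for B'
      proof -
        have "B' - I \<subseteq> B - I" using B' fin(3)[OF B'(1)] by blast
        then have "B' - I = B - I" using min B' by blast
        then show ?thesis by blast
      qed
      then have "(?N - B) - I \<in> delete_bases (dual_bases ?N \<B>) I"
        using B(1) unfolding dual_bases_def delete_bases_def by blast
      moreover have "X = (?N - I) - ((?N - B) - I)" using B fin(3)[OF B(1)] by blast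
      ultimately show "X \<in> contract_bases ?N \<B> I"
        unfolding contract_bases_def dual_bases_def[of "?N - I"] by blast
    qed
  qed
  have uniform: "\<exists>B\<in>CC. B - I - J = Y \<and> (\<forall>B'\<in>CC. Y \<subseteq> B' - I - J \<longrightarrow> Y = B' - I - J)"
    if "Y \<subseteq> E" "card Y = r" for Y
  proof -
    have "Y \<in> delete_bases (contract_bases ?N \<B> I) J" using that unfolding del E_def by blast
    then have "(\<exists>X\<in>contract_bases ?N \<B> I. Y = X - J) \<and> (\<forall>X\<in>contract_bases ?N \<B> I. Y \<subseteq> X - J \<longrightarrow> Y = X - J)"
      unfolding delete_bases_def by blast
    then obtain X where X: "X \<in> contract_bases ?N \<B> I" "Y = X - J"
      and max: "\<And>X'. X' \<in> contract_bases ?N \<B> I \<Longrightarrow> Y \<subseteq> X' - J \<Longrightarrow> Y = X' - J"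
      by auto
    obtain B where B: "B \<in> CC" "X = B - I" using X(1) contract by (auto simp del: Diff_iff)
    show ?thesis
    proof (intro bexI[of _ B] conjI ballI impI)
      show "B - I - J = Y" using X(2) B(2) by simp
      fix B' assume B': "B' \<in> CC" "Y \<subseteq> B' - I - J"
      show "Y = B' - I - J" by (rule max[OF _ B'(2)]) (use contract' B'(1) in \<open>auto simp del: Diff_iff\<close>)
    qed (rule B(1))
  qed
  have inCC: "B \<in> \<B>" if "B \<in> CC" for B using that unfolding CC_def by blast
  \<comment> \<open>Otherwise \<open>B \<inter> I\<close> can be augmented by some \<open>y\<close>
    of \<open>C \<inter> I\<close> and extended inside \<open>B\<close>. Minimality of the trace of
    \<open>B\<close> forces the new basis to contain \<open>insert y B\<close>, which is too
    large.\<close>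
  have rank_le: "card (C \<inter> I) \<le> card (B \<inter> I)" if B: "B \<in> CC" and C: "C \<in> \<B>" for B C
  proof (rule ccontr)
    assume "\<not> ?thesis"
    then obtain y B1 where y: "y \<in> C \<inter> I - B \<inter> I" "B1 \<in> \<B>" "insert y (B \<inter> I) \<subseteq> B1"
      using matroid_bases_augmentation[OF M inCC[OF B] _ C, of "B \<inter> I" "C \<inter> I"] by auto
    obtain B2 where B2: "B2 \<in> \<B>" "insert y (B \<inter> I) \<subseteq> B2" "B2 \<subseteq> insert y (B \<inter> I) \<union> B"
      using matroid_bases_extension[OF M y(2,3) inCC[OF B]] by blast
    have "B2 - I \<subseteq> B - I" using B2 y by blast
    then have "B2 - I = B - I" using B B2(1) unfolding CC_def by blast
    then have "insert y B \<subseteq> B2" using B2 by blast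
    then have "card (insert y B) \<le> card B2" using fin(1)[OF B2(1)] by (rule card_mono[rotated])
    moreover have "y \<notin> B" using y(1) by blast
    ultimately show False using fin[OF inCC[OF B]] fin(2)[OF B2(1)] by simp
  qed
  have diff_card: "card (B - I) = d - card (B \<inter> I)" "card (B \<inter> I) \<le> d" if "B \<in> \<B>" for B
  proof -
    show "card (B \<inter> I) \<le> d" using fin[OF that] card_mono[of B "B \<inter> I"] by simp
    show "card (B - I) = d - card (B \<inter> I)"
      using fin[OF that] card_Diff_subset_Int[of B I] by simp
  qed
  have rank_eq: "B \<in> CC" if B: "B \<in> \<B>" "card (B \<inter> I) = card (B0 \<inter> I)" and B0: "B0 \<in> CC" for B B0
  proof -
    have "B' - I = B - I" if B': "B' \<in> \<B>" "B' - I \<subseteq> B - I" for B'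
    proof (rule card_subset_eq)
      show "finite (B - I)" using fin[OF B(1)] by simp
      show "B' - I \<subseteq> B - I" by (rule B')
      have "card (B' \<inter> I) \<le> card (B \<inter> I)" using rank_le[OF B0 B'(1)] B(2) by simp
      moreover have "card (B' - I) \<le> card (B - I)" using B' fin[OF B(1)] by (intro card_mono) simp_all
      ultimately show "card (B' - I) = card (B - I)"
        using diff_card[OF B(1)] diff_card[OF B'(1)] by linarith
    qed
    then show ?thesis using B(1) unfolding CC_def by blast
  qed
  have finE: "finite E" "card E = m" using IJ(4) by (auto simp: E_def)
  obtain Y0 where Y0: "Y0 \<subseteq> E" "card Y0 = r"
    using obtain_subset_with_card_n[of r E] rm finE by auto
  obtain B0 where B0: "B0 \<in> CC" "B0 - I - J = Y0" using uniform[OF Y0] by blast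
  note B0B = inCC[OF B0(1)]
  define T where "T = B0 - Y0"
  have T: "T = (B0 \<inter> I) \<union> (B0 \<inter> J)" using B0 Y0 unfolding T_def E_def by blast
  have main: "T \<union> Y \<in> \<B>" if Y: "Y \<subseteq> E" "card Y = r" for Y
  proof -
    have finY: "finite Y" using Y finE finite_subset by blast
    obtain BY where BY: "BY \<in> CC" "BY - I - J = Y" "\<forall>B'\<in>CC. Y \<subseteq> B' - I - J \<longrightarrow> Y = B' - I - J"
      using uniform[OF Y] by blast
    note BYB = inCC[OF BY(1)]
    have r0: "card (BY \<inter> I) = card (B0 \<inter> I)"
      using rank_le[OF BY(1) B0B] rank_le[OF B0(1) BYB] by simp
    \<comment> \<open>Completing from \<open>B0\<close> replaces the part of \<open>BY\<close> in
      \<open>J\<close> by elements of \<open>B0\<close>. The intersection with \<open>I\<close>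
      cannot grow, so the new basis is again in \<open>CC\<close>, and maximality of
      \<open>Y\<close> makes its trace on the ground set of the minor equal to
      \<open>Y\<close>.\<close>
    have "Y \<union> (BY \<inter> I) \<subseteq> BY" using BY(2) by blast
    then obtain B' where B': "B' \<in> \<B>" "Y \<union> (BY \<inter> I) \<subseteq> B'" "B' \<subseteq> Y \<union> (BY \<inter> I) \<union> B0"
      using matroid_bases_extension[OF M BYB _ B0B] by blast
    have B'I: "BY \<inter> I = B' \<inter> I"
    proof (rule card_subset_eq)
      show "finite (B' \<inter> I)" using fin[OF B'(1)] by simp
      show sub: "BY \<inter> I \<subseteq> B' \<inter> I" using B' by blast
      have "card (BY \<inter> I) \<le> card (B' \<inter> I)" using sub fin[OF B'(1)] by (intro card_mono) simp_all
      then show "card (BY \<inter> I) = card (B' \<inter> I)" using rank_le[OF BY(1) B'(1)] by simp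
    qed
    have "B' \<in> CC" using rank_eq[OF B'(1) _ BY(1)] B'I by simp
    moreover have "Y \<subseteq> B' - I - J" using B'(2) Y unfolding E_def by blast
    ultimately have B'Y: "B' - I - J = Y" using BY(3) by blast
    have B'J: "B' \<inter> J \<subseteq> B0 \<inter> J" using B'(3) Y IJ(3) unfolding E_def by blast
    \<comment> \<open>Completing \<open>T\<close> from \<open>B'\<close> adds nothing in
      \<open>I\<close>, where \<open>T\<close> is already maximal, and nothing in \<open>J\<close>,
      where \<open>B'\<close> lies inside \<open>B0\<close>. So \<open>C\<close> is contained in
      \<open>T \<union> Y\<close>, and counting gives equality.\<close>
    obtain C where C: "C \<in> \<B>" "T \<subseteq> C" "C \<subseteq> T \<union> B'"
      using matroid_bases_extension[OF M B0B _ B'(1), of T] unfolding T_def by blast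
    have CI: "B0 \<inter> I = C \<inter> I"
    proof (rule card_subset_eq)
      show "finite (C \<inter> I)" using fin[OF C(1)] by simp
      show sub: "B0 \<inter> I \<subseteq> C \<inter> I" using C T by blast
      have "card (B0 \<inter> I) \<le> card (C \<inter> I)" using sub fin[OF C(1)] by (intro card_mono) simp_all
      then show "card (B0 \<inter> I) = card (C \<inter> I)" using rank_le[OF B0(1) C(1)] by simp
    qed
    have sub: "C \<subseteq> T \<union> Y"
    proof
      fix x assume x: "x \<in> C"
      show "x \<in> T \<union> Y"
      proof (cases "x \<in> I")
        case True
        then show ?thesis using x CI T by blast
      next
        case False
        then show ?thesis using x C(3) B'J B'Y T by blast
      qed
    qed
    have "card T = d - r"
      using fin[OF B0B] B0(2) Y0 unfolding T_def by (subst card_Diff_subset) (auto simp: finite_subset)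
    moreover have "r \<le> d"
      using fin[OF B0B] B0(2) Y0(2) card_mono[of B0 Y0] by auto
    ultimately have "card (T \<union> Y) \<le> card C"
      using card_Un_le[of T Y] Y(2) fin(2)[OF C(1)] by simp
    moreover have "finite (T \<union> Y)" using finY fin[OF B0B] unfolding T_def by simp
    ultimately have "C = T \<union> Y" using sub by (metis card_seteq)
    then show ?thesis using C(1) by simp
  qed
  have "T \<subseteq> ?N" using fin[OF B0B] unfolding T_def by blast
  moreover have "T \<inter> E = {}" unfolding T E_def by blast
  ultimately show ?thesis using main finE by (intro exI[of _ T] exI[of _ E]) (auto simp: E_def)
qed

section \<open>Powers of Lorentzian forms and the boundary\<close>

text \<open>Gaussian elimination: a coordinate \<open>e\<close> with \<open>f e \<noteq> 0\<close>
  is solved for, and \<open>?h\<close> subtracts the multiple of \<open>f\<close> that removes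
  \<open>e\<close> from the other equations.\<close>

lemma homogeneous_system_nontrivial_solution:
  fixes fs :: "('i \<Rightarrow> real) list"
  assumes "finite E" "length fs < card E"
  shows "\<exists>x. (\<exists>i\<in>E. x i \<noteq> 0) \<and> (\<forall>f\<in>set fs. (\<Sum>i\<in>E. f i * x i) = 0)"
  using assms
proof (induction "length fs" arbitrary: fs E)
  case 0
  then have "E \<noteq> {}" "fs = []" by auto
  then show ?case by (intro exI[of _ "\<lambda>_. 1"]) auto
next
  case (Suc k)
  then obtain f gs where fs: "fs = f # gs" by (cases fs) auto
  show ?case
  proof (cases "\<forall>i\<in>E. f i = 0")
    case True
    obtain x where x: "\<exists>i\<in>E. x i \<noteq> 0" "\<forall>g\<in>set gs. (\<Sum>i\<in>E. g i * x i) = 0"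
      using Suc.hyps(1)[of gs E] Suc.hyps(2) Suc.prems fs by auto
    have "(\<Sum>i\<in>E. f i * x i) = 0" using True by simp
    then show ?thesis using x fs by auto
  next
    case False
    then obtain e where e: "e \<in> E" "f e \<noteq> 0" by blast
    let ?E = "E - {e}"
    let ?h = "\<lambda>g i. g i - g e / f e * f i"
    have "length (map ?h gs) < card ?E" using Suc.prems fs e by simp
    moreover have "k = length (map ?h gs)" using Suc.hyps(2) fs by simp
    ultimately obtain x where x: "\<exists>i\<in>?E. x i \<noteq> 0" "\<forall>g\<in>set (map ?h gs). (\<Sum>i\<in>?E. g i * x i) = 0"
      using Suc.hyps(1)[of "map ?h gs" ?E] Suc.prems(1) by blast
    define y where "y i = (if i = e then - (\<Sum>i\<in>?E. f i * x i) / f e else x i)" for i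
    have split: "(\<Sum>i\<in>E. g i * y i) = g e * y e + (\<Sum>i\<in>?E. g i * x i)" for g
    proof -
      have "(\<Sum>i\<in>E. g i * y i) = g e * y e + (\<Sum>i\<in>?E. g i * y i)"
        using Suc.prems(1) e by (simp add: sum.remove)
      also have "(\<Sum>i\<in>?E. g i * y i) = (\<Sum>i\<in>?E. g i * x i)"
        by (rule sum.cong) (simp_all add: y_def)
      finally show ?thesis .
    qed
    have "(\<Sum>i\<in>E. f i * y i) = 0" unfolding split using e by (simp add: y_def)
    moreover have "(\<Sum>i\<in>E. g i * y i) = 0" if "g \<in> set gs" for g
    proof -
      have "(\<Sum>i\<in>?E. ?h g i * x i) = 0" using x(2) that by simp
      then have "(\<Sum>i\<in>?E. g i * x i) - g e / f e * (\<Sum>i\<in>?E. f i * x i) = 0"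
        by (simp add: left_diff_distrib sum_subtractf sum_distrib_left mult.assoc)
      then show ?thesis unfolding split by (simp add: y_def)
    qed
    moreover have "\<exists>i\<in>E. y i \<noteq> 0" using x(1) by (auto simp: y_def)
    ultimately show ?thesis using fs by auto
  qed
qed

text \<open>Geometrically, the rows of the Gram representation are lightlike vectors with positive
  mutual products. Their sum is timelike, and a Lorentz transformation taking the normalized sum to
  the first basis vector turns first coordinates into products with that sum, which are
  positive.\<close>

lemma lorentzian_gram_positive_first_coordinate:
  fixes K :: "'i \<Rightarrow> 'i \<Rightarrow> real" and v :: "nat \<Rightarrow> 'i \<Rightarrow> real"
  assumes fin: "finite E" and E2: "\<exists>i\<in>E. \<exists>j\<in>E. i \<noteq> j"
    and K: "\<And>i j. i \<in> E \<Longrightarrow> j \<in> E \<Longrightarrow> K i j = h i * h j - (\<Sum>k<N. v k i * v k j)"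
    and diag: "\<And>i. i \<in> E \<Longrightarrow> K i i = 0"
    and pos: "\<And>i j. i \<in> E \<Longrightarrow> j \<in> E \<Longrightarrow> i \<noteq> j \<Longrightarrow> K i j > 0"
  shows "\<exists>t (w :: nat \<Rightarrow> _). (\<forall>i\<in>E. t i > 0) \<and> (\<forall>i\<in>E. \<forall>j\<in>E. K i j = t i * t j - (\<Sum>k<N. w k i * w k j))"
proof -
  have nonneg: "K i j \<ge> 0" if "i \<in> E" "j \<in> E" for i j
    using diag pos that by (cases "i = j") (auto intro: less_imp_le)
  define R where "R i = (\<Sum>j\<in>E. K i j)" for i
  define q where "q = (\<Sum>i\<in>E. R i)"
  have R: "R i > 0" if "i \<in> E" for i
  proof -
    obtain j where "j \<in> E" "i \<noteq> j" using E2 that by metis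
    then show ?thesis unfolding R_def using fin nonneg pos that
      by (intro sum_pos2[where i = j]) auto
  qed
  have q: "q > 0" unfolding q_def using fin R E2 by (intro sum_pos) auto
  \<comment> \<open>The pair \<open>(a0, b)\<close> is the sum of the vectors divided by its Lorentz
    length \<open>sqrt q\<close>. The sign \<open>\<epsilon>\<close> arranges
    \<open>a \<ge> 0\<close>, so that \<open>1 + a\<close> may serve as a denominator.\<close>
  define a0 where "a0 = (\<Sum>i\<in>E. h i) / sqrt q"
  define \<epsilon> :: real where "\<epsilon> = (if a0 \<ge> 0 then 1 else - 1)"
  define a where "a = \<epsilon> * a0"
  define b where "b k = (\<Sum>i\<in>E. v k i) / sqrt q" for k
  define g where "g i = \<epsilon> * h i" for i
  define t where "t i = R i / sqrt q" for i
  have \<epsilon>: "\<epsilon> * \<epsilon> = 1" "a \<ge> 0" by (auto simp: \<epsilon>_def a_def)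
  have K': "K i j = g i * g j - (\<Sum>k<N. v k i * v k j)" if "i \<in> E" "j \<in> E" for i j
    using K[OF that] \<epsilon>(1) unfolding g_def by (simp add: algebra_simps)
  have ga: "(\<Sum>i\<in>E. g i) = a * sqrt q"
    using q by (simp add: g_def a_def a0_def sum_distrib_left)
  have vb: "(\<Sum>i\<in>E. v k i) = b k * sqrt q" for k
    using q by (simp add: b_def)
  have t: "t i = a * g i - (\<Sum>k<N. b k * v k i)" if i: "i \<in> E" for i
  proof -
    have "R i = (\<Sum>j\<in>E. g i * g j - (\<Sum>k<N. v k i * v k j))"
      unfolding R_def by (rule sum.cong) (use K' i in auto)
    also have "\<dots> = g i * (\<Sum>j\<in>E. g j) - (\<Sum>k<N. v k i * (\<Sum>j\<in>E. v k j))"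
      unfolding sum_subtractf sum_distrib_left by (subst sum.swap) simp
    also have "\<dots> = sqrt q * (a * g i - (\<Sum>k<N. b k * v k i))"
      unfolding ga vb by (simp add: sum_distrib_left algebra_simps)
    finally show ?thesis using q by (simp add: t_def)
  qed
  have unit: "a * a - (\<Sum>k<N. b k * b k) = 1"
  proof -
    have "q = (\<Sum>i\<in>E. sqrt q * t i)" using q by (simp add: q_def t_def)
    also have "\<dots> = sqrt q * (a * (\<Sum>i\<in>E. g i) - (\<Sum>i\<in>E. \<Sum>k<N. b k * v k i))"
      using t by (simp add: sum_distrib_left[symmetric] sum_subtractf)
    also have "(\<Sum>i\<in>E. \<Sum>k<N. b k * v k i) = (\<Sum>k<N. b k * (\<Sum>i\<in>E. v k i))"
      by (subst sum.swap) (simp add: sum_distrib_left)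
    also have "(\<Sum>k<N. b k * (\<Sum>i\<in>E. v k i)) = sqrt q * (\<Sum>k<N. b k * b k)"
      unfolding vb sum_distrib_left by (intro sum.cong refl) simp
    also have "sqrt q * (a * (\<Sum>i\<in>E. g i) - sqrt q * (\<Sum>k<N. b k * b k)) =
        sqrt q * sqrt q * (a * a - (\<Sum>k<N. b k * b k))"
      unfolding ga by (simp only: algebra_simps)
    finally show ?thesis using q by simp
  qed
  \<comment> \<open>The formula of the boost that takes \<open>(a, b)\<close> to the first basis
    vector: time coordinate \<open>t\<close>, space coordinates
    \<open>w = v - b (g + t) / (1 + a)\<close>.\<close>
  define c where "c i = (g i + t i) / (1 + a)" for i
  define w where "w k i = v k i - b k * c i" for k i
  have "K i j = t i * t j - (\<Sum>k<N. w k i * w k j)" if ij: "i \<in> E" "j \<in> E" for i j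
  proof -
    have bv: "(\<Sum>k<N. b k * v k l) = a * g l - t l" if "l \<in> E" for l using t[OF that] by simp
    have cg: "g l = (1 + a) * c l - t l" for l using \<epsilon>(2) by (simp add: c_def)
    have "(\<Sum>k<N. w k i * w k j) = (\<Sum>k<N. v k i * v k j - c j * (b k * v k i) - c i * (b k * v k j) + c i * c j * (b k * b k))"
      unfolding w_def by (intro sum.cong refl) (simp add: algebra_simps)
    also have "\<dots> = (\<Sum>k<N. v k i * v k j) - c j * (a * g i - t i) - c i * (a * g j - t j) + c i * c j * (a * a - 1)"
      unfolding sum_subtractf sum.distrib sum_distrib_left[symmetric] bv[OF ij(1)] bv[OF ij(2)]
      using unit by (simp add: algebra_simps)
    also have "\<dots> = (\<Sum>k<N. v k i * v k j) + t i * t j - g i * g j"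
      unfolding cg[of i] cg[of j] by (simp add: algebra_simps)
    finally show ?thesis using K'[OF ij] by simp
  qed
  moreover have "t i > 0" if "i \<in> E" for i using R[OF that] q by (simp add: t_def)
  ultimately show ?thesis by blast
qed

text \<open>The Schur product theorem for powers. One more Gram factor splits the form into a sum
  over \<open>k\<close> of forms with one factor fewer, evaluated at
  \<open>x i * g k i\<close>.\<close>

lemma psd_gram_power:
  fixes g :: "nat \<Rightarrow> 'i \<Rightarrow> real"
  shows "(\<Sum>i\<in>E. \<Sum>j\<in>E. x i * x j * (\<Sum>k<N. g k i * g k j) ^ m) \<ge> 0"
proof (induction m arbitrary: x)
  case 0
  have "(\<Sum>i\<in>E. \<Sum>j\<in>E. x i * x j) = (\<Sum>i\<in>E. x i)\<^sup>2" by (simp add: power2_eq_square sum_product)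
  then show ?case by simp
next
  case (Suc m)
  let ?G = "\<lambda>i j. \<Sum>k<N. g k i * g k j"
  have "(\<Sum>i\<in>E. \<Sum>j\<in>E. x i * x j * ?G i j ^ Suc m) =
    (\<Sum>i\<in>E. \<Sum>j\<in>E. \<Sum>k<N. (x i * g k i) * (x j * g k j) * ?G i j ^ m)"
  proof (intro sum.cong refl)
    fix i j
    have "x i * x j * ?G i j ^ Suc m = (\<Sum>k<N. g k i * g k j) * (x i * x j * ?G i j ^ m)" by simp
    also have "\<dots> = (\<Sum>k<N. (x i * g k i) * (x j * g k j) * ?G i j ^ m)"
      unfolding sum_distrib_right[of _ "{..<N}" "x i * x j * ?G i j ^ m"] by (intro sum.cong refl) simp
    finally show "x i * x j * ?G i j ^ Suc m = (\<Sum>k<N. (x i * g k i) * (x j * g k j) * ?G i j ^ m)" .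
  qed
  also have "\<dots> = (\<Sum>i\<in>E. \<Sum>k<N. \<Sum>j\<in>E. (x i * g k i) * (x j * g k j) * ?G i j ^ m)"
    by (intro sum.cong refl sum.swap)
  also have "\<dots> = (\<Sum>k<N. \<Sum>i\<in>E. \<Sum>j\<in>E. (x i * g k i) * (x j * g k j) * ?G i j ^ m)"
    by (rule sum.swap)
  also have "\<dots> \<ge> 0" by (intro sum_nonneg Suc.IH)
  finally show ?case .
qed

text \<open>The first value is \<open>- s\<close>, and passing from \<open>m\<close> to
  \<open>m + 1\<close> multiplies by \<open>(m + 1 - s) / (m + 2)\<close>, which is positive because
  \<open>s < 1\<close>.\<close>

lemma gbinomial_alternating_neg:
  fixes s :: real
  assumes s: "0 < s" "s < 1"
  shows "(s gchoose Suc m) * (- 1) ^ Suc m < 0"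
proof (induction m)
  case 0 then show ?case using s by simp
next
  case (Suc m)
  let ?G = "s gchoose Suc m" and ?M = "real (Suc (Suc m))"
  have "s * ?G = real (Suc m) * ?G + ?M * (s gchoose Suc (Suc m))"
    by (rule gbinomial_mult_1)
  then have "?M * (s gchoose Suc (Suc m)) = (s - real (Suc m)) * ?G"
    by (simp only: left_diff_distrib)
  then have "?M * (s gchoose Suc (Suc m)) * (- 1) ^ m = (s - real (Suc m)) * ?G * (- 1) ^ m" by (simp only:)
  also have "\<dots> = (real (Suc m) - s) * (?G * (- 1) ^ Suc m)" by (simp add: algebra_simps)
  finally have "?M * ((s gchoose Suc (Suc m)) * (- 1) ^ Suc (Suc m)) = (real (Suc m) - s) * (?G * (- 1) ^ Suc m)"
    by simp
  moreover have "(real (Suc m) - s) * (?G * (- 1) ^ Suc m) < 0"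
    by (rule mult_pos_neg[OF _ Suc]) (use s in simp)
  ultimately have "?M * ((s gchoose Suc (Suc m)) * (- 1) ^ Suc (Suc m)) < 0" by simp
  then show ?case unfolding mult_less_0_iff[of ?M] by simp
qed

lemma gram_abs_le_1:
  fixes g :: "nat \<Rightarrow> 'i \<Rightarrow> real"
  assumes "(\<Sum>k<N. g k i * g k i) = 1" "(\<Sum>k<N. g k j * g k j) = 1"
  shows "\<bar>\<Sum>k<N. g k i * g k j\<bar> \<le> 1"
proof -
  have "0 \<le> (\<Sum>k<N. (g k i + g k j)\<^sup>2)" "0 \<le> (\<Sum>k<N. (g k i - g k j)\<^sup>2)"
    by (simp_all add: sum_nonneg)
  moreover have "(\<Sum>k<N. (g k i + g k j)\<^sup>2) = 2 + 2 * (\<Sum>k<N. g k i * g k j)"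
    using assms by (simp add: power2_eq_square algebra_simps sum.distrib sum_distrib_left[symmetric])
  moreover have "(\<Sum>k<N. (g k i - g k j)\<^sup>2) = 2 - 2 * (\<Sum>k<N. g k i * g k j)"
    using assms by (simp add: power2_eq_square algebra_simps sum.distrib sum_subtractf sum_distrib_left[symmetric])
  ultimately show ?thesis by (simp add: abs_le_iff)
qed

text \<open>Schoenberg's argument: in \<open>(1 - y)\<^sup>s = 1 - \<Sum>\<^sub>m c\<^sub>m y\<^sup>m\<close> with \<open>0 < s < 1\<close> all \<open>c\<^sub>m\<close> are positive, and
  the entrywise powers of a Gram matrix are positive semidefinite. The series is used at \<open>\<theta> G\<close>, \<open>\<theta> \<rightarrow> 1\<close>,
  since the entries of \<open>G\<close> may be \<open>\<plusminus>1\<close>.\<close>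

lemma one_minus_gram_powr_le:
  fixes g :: "nat \<Rightarrow> 'i \<Rightarrow> real" and E :: "'i set" and N :: nat
  defines "G \<equiv> \<lambda>i j. \<Sum>k<N. g k i * g k j"
  assumes fin: "finite E" and diag: "\<And>i. i \<in> E \<Longrightarrow> G i i = 1" and s: "0 < s" "s < 1"
  shows "(\<Sum>i\<in>E. \<Sum>j\<in>E. x i * x j * (1 - G i j) powr s) \<le>
    (\<Sum>i\<in>E. x i)\<^sup>2 + (\<Sum>m<M. (s gchoose Suc m) * (- 1) ^ Suc m * (\<Sum>i\<in>E. \<Sum>j\<in>E. x i * x j * G i j ^ Suc m))"
proof -
  have G1: "\<bar>G i j\<bar> \<le> 1" if "i \<in> E" "j \<in> E" for i j
    using gram_abs_le_1[where g = g and N = N and i = i and j = j] diag that unfolding G_def by blast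
  define P where "P m = (\<Sum>i\<in>E. \<Sum>j\<in>E. x i * x j * G i j ^ m)" for m
  have P: "P m \<ge> 0" for m unfolding P_def G_def by (rule psd_gram_power)
  have P0: "P 0 = (\<Sum>i\<in>E. x i)\<^sup>2" by (simp add: P_def power2_eq_square sum_product)
  define c where "c m = (s gchoose m) * (- 1) ^ m" for m
  have c: "c (Suc m) \<le> 0" for m unfolding c_def by (rule less_imp_le[OF gbinomial_alternating_neg[OF s]])
  define Q where "Q \<theta> = (\<Sum>i\<in>E. \<Sum>j\<in>E. x i * x j * (1 - \<theta> * G i j) powr s)" for \<theta>
  have le: "Q \<theta> \<le> P 0 + (\<Sum>m<M. c (Suc m) * \<theta> ^ Suc m * P (Suc m))" if \<theta>: "0 < \<theta>" "\<theta> < 1" for \<theta>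
  proof -
    have one: "(\<lambda>m. x i * x j * ((s gchoose m) * (- (\<theta> * G i j)) ^ m)) sums (x i * x j * (1 - \<theta> * G i j) powr s)"
      if "i \<in> E" "j \<in> E" for i j
    proof -
      have "\<bar>- (\<theta> * G i j)\<bar> \<le> \<theta>" using G1[OF that] \<theta> by (simp add: abs_mult mult_left_le)
      then have "\<bar>- (\<theta> * G i j)\<bar> < 1" using \<theta> by simp
      from sums_mult[OF gen_binomial_real[OF this, of s], of "x i * x j"] show ?thesis by simp
    qed
    have "(\<lambda>m. \<Sum>i\<in>E. \<Sum>j\<in>E. x i * x j * ((s gchoose m) * (- (\<theta> * G i j)) ^ m)) sums Q \<theta>"
      unfolding Q_def by (intro sums_sum one)
    moreover have "(\<Sum>i\<in>E. \<Sum>j\<in>E. x i * x j * ((s gchoose m) * (- (\<theta> * G i j)) ^ m)) = c m * \<theta> ^ m * P m" for m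
    proof -
      have "(- (\<theta> * G i j)) ^ m = (- 1) ^ m * (\<theta> ^ m * G i j ^ m)" for i j
        unfolding power_minus[of "\<theta> * G i j"] power_mult_distrib ..
      then show ?thesis
        unfolding P_def c_def sum_distrib_left by (intro sum.cong refl) (simp only: ac_simps)
    qed
    ultimately have sums: "(\<lambda>m. c m * \<theta> ^ m * P m) sums Q \<theta>" by simp
    \<comment> \<open>All omitted terms are nonpositive, so every truncation is an upper bound. The
      retained terms are what makes the equality case accessible in
      \<open>one_minus_gram_powr_nonsingular\<close>.\<close>
    have "Q \<theta> \<le> (\<Sum>m<Suc M. c m * \<theta> ^ m * P m)"
    proof -
      have sums': "(\<lambda>m. - (c m * \<theta> ^ m * P m)) sums - Q \<theta>" using sums by (rule sums_minus)
      have "(\<Sum>m<Suc M. - (c m * \<theta> ^ m * P m)) \<le> suminf (\<lambda>m. - (c m * \<theta> ^ m * P m))"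
      proof (rule sum_le_suminf[OF sums_summable[OF sums']])
        fix m assume "m \<in> - {..<Suc M}"
        then obtain l where "m = Suc l" by (cases m) auto
        then show "0 \<le> - (c m * \<theta> ^ m * P m)"
          using c[of l] P[of m] \<theta> by (simp add: mult_nonpos_nonneg)
      qed simp
      then show ?thesis using sums_unique[OF sums'] by (simp add: sum_negf)
    qed
    also have "\<dots> = P 0 + (\<Sum>m<M. c (Suc m) * \<theta> ^ Suc m * P (Suc m))"
      by (subst sum.lessThan_Suc_shift) (simp add: c_def)
    finally show ?thesis .
  qed
  have "Q 1 \<le> P 0 + (\<Sum>m<M. c (Suc m) * 1 ^ Suc m * P (Suc m))"
  proof (rule tendsto_le[where F = "at_left (1::real)"])
    show "(Q \<longlongrightarrow> Q 1) (at_left 1)"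
      unfolding Q_def
    proof (intro tendsto_sum tendsto_mult tendsto_const)
      fix i j assume ij: "i \<in> E" "j \<in> E"
      \<comment> \<open>On the diagonal the base tends to 0; the power still converges because
        \<open>s > 0\<close> and the base stays nonnegative on the way.\<close>
      show "((\<lambda>\<theta>. (1 - \<theta> * G i j) powr s) \<longlongrightarrow> (1 - 1 * G i j) powr s) (at_left 1)"
      proof (rule tendsto_powr')
        show "((\<lambda>\<theta>. 1 - \<theta> * G i j) \<longlongrightarrow> 1 - 1 * G i j) (at_left 1)" by (intro tendsto_intros)
        have "\<forall>\<^sub>F \<theta> in at_left (1::real). \<theta> \<in> {0<..<1}"
          by (rule eventually_at_leftI[of 0]) auto
        then have "\<forall>\<^sub>F \<theta> in at_left 1. 0 \<le> 1 - \<theta> * G i j"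
        proof (rule eventually_mono)
          fix \<theta> :: real assume \<theta>: "\<theta> \<in> {0<..<1}"
          have "\<theta> * G i j \<le> \<theta> * 1" using \<theta> abs_le_D1[OF G1[OF ij]] by (intro mult_left_mono) simp_all
          moreover have "\<theta> < 1" using \<theta> by simp
          ultimately show "0 \<le> 1 - \<theta> * G i j" by linarith
        qed
        then show "1 - 1 * G i j \<noteq> 0 \<or> 0 < s \<and> (\<forall>\<^sub>F \<theta> in at_left 1. 0 \<le> 1 - \<theta> * G i j)"
          using s by simp
      qed (rule tendsto_const)
    qed
    show "((\<lambda>\<theta>. P 0 + (\<Sum>m<M. c (Suc m) * \<theta> ^ Suc m * P (Suc m))) \<longlongrightarrow>
        P 0 + (\<Sum>m<M. c (Suc m) * 1 ^ Suc m * P (Suc m))) (at_left 1)"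
      by (intro tendsto_intros)
    show "\<forall>\<^sub>F \<theta> in at_left 1. Q \<theta> \<le> P 0 + (\<Sum>m<M. c (Suc m) * \<theta> ^ Suc m * P (Suc m))"
      by (rule eventually_at_leftI[of 0]) (use le in auto)
  qed simp
  then show ?thesis unfolding P0 unfolding Q_def P_def c_def by simp
qed

text \<open>On vectors with sum zero the form is bounded by a series of nonpositive terms. For a
  kernel vector the form is zero, so each term vanishes; for large exponents the powers of
  \<open>G\<close> retain only the diagonal, which kills the vector.\<close>

lemma one_minus_gram_powr_nonsingular:
  fixes g :: "nat \<Rightarrow> 'i \<Rightarrow> real" and E :: "'i set" and N :: nat
  defines "G \<equiv> \<lambda>i j. \<Sum>k<N. g k i * g k j"
  assumes fin: "finite E" and E2: "\<exists>i\<in>E. \<exists>j\<in>E. i \<noteq> j"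
    and diag: "\<And>i. i \<in> E \<Longrightarrow> G i i = 1" and off: "\<And>i j. i \<in> E \<Longrightarrow> j \<in> E \<Longrightarrow> i \<noteq> j \<Longrightarrow> G i j < 1"
    and s: "0 < s" "s < 1" and ker: "\<And>i. i \<in> E \<Longrightarrow> (\<Sum>j\<in>E. (1 - G i j) powr s * y j) = 0"
    and i: "i \<in> E"
  shows "y i = 0"
proof -
  let ?H = "\<lambda>i j. (1 - G i j) powr s"
  define Q where "Q x = (\<Sum>i\<in>E. \<Sum>j\<in>E. x i * x j * ?H i j)" for x
  define P where "P x m = (\<Sum>i\<in>E. \<Sum>j\<in>E. x i * x j * G i j ^ m)" for x m
  define c where "c m = (s gchoose m) * (- 1) ^ m" for m
  have P: "P x m \<ge> 0" for x m unfolding P_def G_def by (rule psd_gram_power)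
  have c: "c (Suc m) < 0" for m unfolding c_def by (rule gbinomial_alternating_neg[OF s])
  have le: "Q x \<le> (\<Sum>i\<in>E. x i)\<^sup>2 + (\<Sum>m<M. c (Suc m) * P x (Suc m))" for x M
    unfolding Q_def P_def c_def G_def
    by (rule one_minus_gram_powr_le[OF fin _ s]) (use diag in \<open>simp add: G_def\<close>)
  have sym: "G i j = G j i" for i j unfolding G_def by (intro sum.cong refl) simp
  define e where "e = (\<Sum>i\<in>E. \<Sum>j\<in>E. ?H i j)"
  have e: "e > 0"
  proof -
    obtain i j where ij: "i \<in> E" "j \<in> E" "i \<noteq> j" using E2 by blast
    have "0 < ?H i j" using off[OF ij] by simp
    also have "\<dots> \<le> (\<Sum>j\<in>E. ?H i j)" by (rule member_le_sum) (use fin ij in auto)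
    also have "\<dots> \<le> e" unfolding e_def
      by (rule member_le_sum[of i E "\<lambda>i. \<Sum>j\<in>E. ?H i j"]) (use fin ij in \<open>auto intro: sum_nonneg\<close>)
    finally show ?thesis .
  qed
  \<comment> \<open>The mean of \<open>y\<close>. Shifting \<open>y\<close> by it gives a vector of
    sum zero, where the form is nonpositive; but since \<open>y\<close> is in the kernel the form
    there equals \<open>r * r * e\<close> with \<open>e > 0\<close>. Hence
    \<open>r = 0\<close>.\<close>
  define r where "r = (\<Sum>i\<in>E. y i) / card E"
  have cardE: "card E > 0" using fin i by (auto simp: card_gt_0_iff)
  have ker': "(\<Sum>i\<in>E. \<Sum>j\<in>E. f i * (?H i j * y j)) = 0" for f
    unfolding sum_distrib_left[symmetric] using ker by simp
  have "Q (\<lambda>i. y i - r) = r * r * e"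
  proof -
    have "Q (\<lambda>i. y i - r) = (\<Sum>i\<in>E. \<Sum>j\<in>E. y i * (?H i j * y j) - r * (?H i j * y j) - r * (?H i j * y i) + r * r * ?H i j)"
      unfolding Q_def by (intro sum.cong refl) (simp add: algebra_simps)
    also have "\<dots> = (\<Sum>i\<in>E. \<Sum>j\<in>E. y i * (?H i j * y j)) - (\<Sum>i\<in>E. \<Sum>j\<in>E. r * (?H i j * y j))
        - (\<Sum>i\<in>E. \<Sum>j\<in>E. r * (?H i j * y i)) + r * r * e"
      by (simp add: sum.distrib sum_subtractf e_def sum_distrib_left)
    also have "(\<Sum>i\<in>E. \<Sum>j\<in>E. r * (?H i j * y i)) = (\<Sum>j\<in>E. \<Sum>i\<in>E. r * (?H j i * y i))"
      by (subst sum.swap) (simp add: sym)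
    finally show ?thesis unfolding ker' by simp
  qed
  moreover have "Q (\<lambda>i. y i - r) \<le> 0"
  proof -
    have "(\<Sum>i\<in>E. y i - r) = 0" using cardE by (simp add: sum_subtractf r_def)
    then show ?thesis using le[of "\<lambda>i. y i - r" 0] by simp
  qed
  ultimately have "r * r * e \<le> 0" by simp
  moreover have "r * r * e > 0" if "r \<noteq> 0"
  proof -
    have "r * r > 0" using that by (simp add: zero_less_mult_iff) linarith
    then show ?thesis using e by (rule mult_pos_pos)
  qed
  ultimately have "r = 0" by linarith
  then have sumy: "(\<Sum>i\<in>E. y i) = 0" using cardE by (simp add: r_def)
  have Qy: "Q y = 0"
    using ker'[of y] unfolding Q_def by (simp add: mult.assoc mult.commute[of "?H _ _"])
  have P0: "P y (Suc m) = 0" for m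
  proof (rule antisym[OF _ P])
    have "0 \<le> (\<Sum>l<Suc m. c (Suc l) * P y (Suc l))"
      using le[of y "Suc m"] unfolding Qy sumy by simp
    also have "\<dots> \<le> c (Suc m) * P y (Suc m)"
      using c P by (simp add: sum_nonpos mult_nonpos_nonneg less_imp_le)
    finally have "0 \<le> c (Suc m) * P y (Suc m)" .
    then show "P y (Suc m) \<le> 0" using mult_neg_pos[OF c[of m], of "P y (Suc m)"] by linarith
  qed
  \<comment> \<open>Entries equal to \<open>-1\<close> have oscillating powers. Adding two
    consecutive powers brings in the factor \<open>1 + G i j\<close>, which removes them and makes
    the diagonal tend to 2.\<close>
  have "(\<lambda>m. \<Sum>i\<in>E. \<Sum>j\<in>E. y i * y j * (G i j ^ Suc m * (1 + G i j))) \<longlonglongrightarrow>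
      (\<Sum>i\<in>E. \<Sum>j\<in>E. y i * y j * (if i = j then 2 else 0))"
  proof (intro tendsto_sum tendsto_mult_left)
    fix i j assume ij: "i \<in> E" "j \<in> E"
    show "(\<lambda>m. G i j ^ Suc m * (1 + G i j)) \<longlonglongrightarrow> (if i = j then 2 else 0)"
    proof (cases "i = j")
      case True then show ?thesis using diag[OF ij(1)] by simp
    next
      case False
      have "\<bar>G i j\<bar> \<le> 1" using gram_abs_le_1[where g = g and N = N and i = i and j = j] diag ij unfolding G_def by blast
      then have "G i j = - 1 \<or> \<bar>G i j\<bar> < 1" using off[OF ij False] by linarith
      then show ?thesis
      proof
        assume "G i j = - 1" then show ?thesis using False by simp
      next
        assume "\<bar>G i j\<bar> < 1"
        then have "(\<lambda>m. G i j ^ Suc m) \<longlonglongrightarrow> 0" by (intro LIMSEQ_Suc LIMSEQ_power_zero) simp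
        then have "(\<lambda>m. G i j ^ Suc m * (1 + G i j)) \<longlonglongrightarrow> 0 * (1 + G i j)" by (rule tendsto_mult_right)
        then show ?thesis using False by simp
      qed
    qed
  qed
  moreover have "(\<Sum>i\<in>E. \<Sum>j\<in>E. y i * y j * (G i j ^ Suc m * (1 + G i j))) = P y (Suc m) + P y (Suc (Suc m))" for m
    unfolding P_def sum.distrib[symmetric] by (intro sum.cong refl) (simp add: algebra_simps)
  ultimately have "(\<lambda>m::nat. 0) \<longlonglongrightarrow> (\<Sum>i\<in>E. \<Sum>j\<in>E. y i * y j * (if i = j then 2 else 0))"
    using P0 by simp
  then have "(\<Sum>i\<in>E. \<Sum>j\<in>E. y i * y j * (if i = j then 2 else 0)) = 0"
    using LIMSEQ_unique tendsto_const by blast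
  moreover have "(\<Sum>j\<in>E. y i * y j * (if i = j then 2 else 0)) = 2 * (y i)\<^sup>2" if "i \<in> E" for i
    using fin that by (simp add: if_distrib[of "\<lambda>a. _ * a"] power2_eq_square cong: if_cong)
  ultimately have "(\<Sum>i\<in>E. 2 * (y i)\<^sup>2) = 0" by simp
  then show ?thesis using fin i by (subst (asm) sum_nonneg_eq_0_iff) auto
qed

text \<open>Dividing by the positive first coordinates writes \<open>K i j\<close> as
  \<open>t i * t j * (1 - G i j)\<close>; the zero diagonal of \<open>K\<close> makes
  \<open>G\<close> a Gram matrix of unit vectors. The \<open>s\<close>-th power is then congruent,
  by the diagonal matrix of \<open>t i powr s\<close>, to the one treated before.\<close>

lemma lorentzian_powr_nonsingular:
  fixes K :: "'i \<Rightarrow> 'i \<Rightarrow> real" and v :: "nat \<Rightarrow> 'i \<Rightarrow> real"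
  assumes fin: "finite E" and E2: "\<exists>i\<in>E. \<exists>j\<in>E. i \<noteq> j"
    and K: "\<And>i j. i \<in> E \<Longrightarrow> j \<in> E \<Longrightarrow> K i j = h i * h j - (\<Sum>k<N. v k i * v k j)"
    and diag: "\<And>i. i \<in> E \<Longrightarrow> K i i = 0"
    and pos: "\<And>i j. i \<in> E \<Longrightarrow> j \<in> E \<Longrightarrow> i \<noteq> j \<Longrightarrow> K i j > 0"
    and s: "0 < s" "s < 1" and ker: "\<And>i. i \<in> E \<Longrightarrow> (\<Sum>j\<in>E. K i j powr s * y j) = 0"
    and i: "i \<in> E"
  shows "y i = 0"
proof -
  have "\<exists>t (w :: nat \<Rightarrow> 'i \<Rightarrow> real). (\<forall>i\<in>E. t i > 0) \<and> (\<forall>i\<in>E. \<forall>j\<in>E. K i j = t i * t j - (\<Sum>k<N. w k i * w k j))"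
    by (rule lorentzian_gram_positive_first_coordinate[OF fin E2 K diag pos])
  then obtain t and w :: "nat \<Rightarrow> 'i \<Rightarrow> real" where tw: "\<forall>i\<in>E. t i > 0"
    "\<forall>i\<in>E. \<forall>j\<in>E. K i j = t i * t j - (\<Sum>k<N. w k i * w k j)"
    by (elim exE conjE)
  note t = tw(1)[rule_format] and K' = tw(2)[rule_format]
  define g where "g k i = w k i / t i" for k i
  have G: "(\<Sum>k<N. g k i * g k j) = 1 - K i j / (t i * t j)" if ij: "i \<in> E" "j \<in> E" for i j
  proof -
    have "(\<Sum>k<N. g k i * g k j) = (\<Sum>k<N. w k i * w k j) / (t i * t j)"
      unfolding g_def sum_divide_distrib by (intro sum.cong refl) simp
    then show ?thesis using K'[OF ij] t[OF ij(1)] t[OF ij(2)] by (simp add: field_simps)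
  qed
  have "t i powr s * y i = 0"
  proof (rule one_minus_gram_powr_nonsingular[where g = g and N = N and E = E and s = s and y = "\<lambda>i. t i powr s * y i"])
    fix i assume i: "i \<in> E"
    show "(\<Sum>k<N. g k i * g k i) = 1" using G[OF i i] diag[OF i] by simp
    have "K i j powr s * y j = t i powr s * ((1 - (\<Sum>k<N. g k i * g k j)) powr s * (t j powr s * y j))"
      if j: "j \<in> E" for j
    proof -
      have "K i j \<ge> 0" using diag pos i j by (cases "i = j") (auto intro: less_imp_le)
      then have "K i j powr s = (t i * t j * (K i j / (t i * t j))) powr s"
        using t[OF i] t[OF j] by simp
      also have "\<dots> = t i powr s * t j powr s * (K i j / (t i * t j)) powr s"
        using t[OF i] t[OF j] \<open>K i j \<ge> 0\<close> by (simp only: powr_mult less_imp_le mult_nonneg_nonneg divide_nonneg_nonneg)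
      finally show ?thesis unfolding G[OF i j] by simp
    qed
    then have "(\<Sum>j\<in>E. K i j powr s * y j) = t i powr s * (\<Sum>j\<in>E. (1 - (\<Sum>k<N. g k i * g k j)) powr s * (t j powr s * y j))"
      unfolding sum_distrib_left by (intro sum.cong refl)
    then show "(\<Sum>j\<in>E. (1 - (\<Sum>k<N. g k i * g k j)) powr s * (t j powr s * y j)) = 0"
      using ker[OF i] t[OF i] by simp
  next
    fix i j assume ij: "i \<in> E" "j \<in> E" "i \<noteq> j"
    show "(\<Sum>k<N. g k i * g k j) < 1" using G[OF ij(1,2)] pos[OF ij] t ij by simp
  qed (use fin E2 s i in auto)
  then show ?thesis using t[OF i] by simp
qed

section \<open>Powers of hyperfield representations\<close>

lemma tinf_null_powr:
  assumes g: "\<And>x. x \<in> A \<Longrightarrow> g x \<ge> 0" and t: "t > 0" and null: "tinf_null A g"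
  shows "tinf_null A (\<lambda>x. g x powr t)"
proof -
  consider "\<forall>x\<in>A. g x = 0"
    | x y where "x \<in> A" "y \<in> A" "x \<noteq> y" "g x = g y" "\<forall>z\<in>A. g z \<le> g x"
    | "card {x\<in>A. g x \<noteq> 0} \<ge> 3"
    using null unfolding tinf_null_def by blast
  then show ?thesis
  proof cases
    case 1
    then show ?thesis unfolding tinf_null_def by simp
  next
    case 2
    have "\<forall>z\<in>A. g z powr t \<le> g x powr t"
      using 2(5) g t by (intro ballI powr_mono2) simp_all
    then show ?thesis unfolding tinf_null_def using 2(1-4)
      by (intro disjI2 disjI1 bexI[of _ x] bexI[of _ y]) simp_all
  next
    case 3
    have "{x\<in>A. g x powr t \<noteq> 0} = {x\<in>A. g x \<noteq> 0}" by auto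
    then show ?thesis unfolding tinf_null_def using 3 by simp
  qed
qed

lemma strong_tinf_representation_powr:
  assumes \<rho>: "strong_tinf_representation n d \<B> \<rho>" and nonneg: "\<And>S. \<rho> S \<ge> 0" and t: "t > 0"
  shows "strong_tinf_representation n d \<B> (\<lambda>S. \<rho> S powr t)"
proof -
  have "tinf_null (S2 - S1) (\<lambda>x. \<rho> (insert x S1) powr t * \<rho> (S2 - {x}) powr t)"
    if "tinf_null (S2 - S1) (\<lambda>x. \<rho> (insert x S1) * \<rho> (S2 - {x}))" for S1 S2
  proof -
    have "tinf_null (S2 - S1) (\<lambda>x. (\<rho> (insert x S1) * \<rho> (S2 - {x})) powr t)"
      by (rule tinf_null_powr[OF _ t that]) (simp add: nonneg)
    then show ?thesis by (simp only: powr_mult nonneg)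
  qed
  then show ?thesis using \<rho> unfolding strong_tinf_representation_def by simp
qed

text \<open>For infinite \<open>S\<close> the sum defining \<open>exponent_of S\<close> collapses to
  0, so \<open>coeff_at\<close> is meaningful on finite sets only; the Pluecker relations involve no
  others.\<close>

lemma strong_tinf_representation_cong:
  assumes "strong_tinf_representation n d \<B> \<rho>" "\<And>S. finite S \<Longrightarrow> \<rho> S = \<rho>' S"
  shows "strong_tinf_representation n d \<B> \<rho>'"
proof -
  define \<sigma> where "\<sigma> = (\<lambda>S. if finite S then \<rho> S else \<rho>' S)"
  have eq: "\<sigma> = \<rho>'"
  proof
    fix S show "\<sigma> S = \<rho>' S" unfolding \<sigma>_def using assms(2)[of S] by (cases "finite S") simp_all
  qed
  have "tinf_null (S2 - S1) (\<lambda>x. \<sigma> (insert x S1) * \<sigma> (S2 - {x}))"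
    if "tinf_null (S2 - S1) (\<lambda>x. \<rho> (insert x S1) * \<rho> (S2 - {x}))" "S1 \<subseteq> {..<n}" "S2 \<subseteq> {..<n}" for S1 S2
  proof -
    have "finite S1" "finite S2" using that finite_subset by auto
    then have "(\<lambda>x. \<sigma> (insert x S1) * \<sigma> (S2 - {x})) = (\<lambda>x. \<rho> (insert x S1) * \<rho> (S2 - {x}))"
      by (simp add: \<sigma>_def)
    then show ?thesis using that(1) by simp
  qed
  moreover have "\<sigma> S = \<rho> S" if "S \<in> ksubsets n d" for S
    using ksubsets_finite[OF that] by (simp add: \<sigma>_def)
  ultimately have "strong_tinf_representation n d \<B> \<sigma>"
    using assms(1) unfolding strong_tinf_representation_def by simp
  then show ?thesis unfolding eq .
qed

lemma sq_abs_poly_in_tinf_polys: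
  fixes p :: "nat set \<Rightarrow> 'a::real_normed_field"
  assumes M: "matroid_bases n d \<B>" and p: "p \<in> realizations d n \<B>"
  shows "sq_abs_poly \<B> p \<in> tinf_polys n d \<B>"
proof -
  have sub: "\<B> \<subseteq> ksubsets n d" using M unfolding matroid_bases_def by simp
  have "strong_tinf_representation n d \<B> (coeff_at (sq_abs_poly \<B> p))"
    by (rule strong_tinf_representation_cong[OF realizations_tinf[OF p]])
      (simp add: coeff_at_sq_abs_poly[OF p sub])
  then show ?thesis unfolding tinf_polys_def using keys_sq_abs_poly[OF p sub] by simp
qed

text \<open>The coefficientwise powers \<open>f\<^sup>t\<close> stay among the representations over the hyperfield. Were \<open>f\<^sup>t\<close> Lorentzian
  for some \<open>t > 1\<close>, then \<open>f = (f\<^sup>t)\<^bsup>1/t\<^esup>\<close> would be strictly so on every uniform minor, contradicting the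
  singularity of its Hessian.\<close>

lemma sq_abs_poly_in_boundary:
  fixes p :: "nat set \<Rightarrow> 'a::real_normed_field"
  assumes M: "matroid_bases n d \<B>" and p: "p \<in> realizations d n \<B>"
    and L: "sq_abs_poly \<B> p \<in> L_mat n d \<B>"
    and E: "E \<subseteq> {..<n}" "card E \<ge> 2" and T: "T \<subseteq> {..<n}" "T \<inter> E = {}"
    and basis: "\<And>Y. Y \<subseteq> E \<Longrightarrow> card Y = 2 \<Longrightarrow> T \<union> Y \<in> \<B>"
    and ker: "\<And>i. i \<in> E \<Longrightarrow> (\<Sum>j\<in>E. contraction_matrix n (coeff_at (sq_abs_poly \<B> p)) T $$ (i,j) * x j) = 0"
    and x: "\<exists>i\<in>E. x i \<noteq> 0"
  shows "sq_abs_poly \<B> p \<in> boundary_L_mat n d \<B>"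
proof -
  have sub: "\<B> \<subseteq> ksubsets n d" using M unfolding matroid_bases_def by simp
  have finB: "finite S" if "S \<in> \<B>" for S using that sub ksubsets_finite by blast
  let ?f = "sq_abs_poly \<B> p"
  let ?c = "coeff_at ?f"
  have finE: "finite E" using E finite_subset by blast
  have f_tinf: "?f \<in> tinf_polys n d \<B>" by (rule sq_abs_poly_in_tinf_polys[OF M p])
  have cpos: "?c S > 0" if "S \<in> \<B>" for S
  proof -
    have "S \<in> ksubsets n d" using that sub by blast
    then have "p S \<noteq> 0" using p that unfolding realizations_def by simp
    then show ?thesis using coeff_at_sq_abs_poly[OF p sub finB[OF that]] by simp
  qed
  have cnonneg: "?c S \<ge> 0" if "finite S" for S
    using coeff_at_sq_abs_poly[OF p sub that] by simp
  define g where "g t = multiaffine_poly \<B> (\<lambda>S. ?c S powr t)" for t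
  have cg: "coeff_at (g t) S = ?c S powr t" if "finite S" for S t
    unfolding g_def coeff_at_multiaffine_poly[OF sub that] coeff_at_sq_abs_poly[OF p sub that]
    using realizations_zero_outside[OF p sub, of S] by (cases "S \<in> \<B>") simp_all
  have keys_g: "Poly_Mapping.keys (g t) = exponent_of ` \<B>" for t
  proof -
    have "?c S powr t \<noteq> 0" if "S \<in> \<B>" for S using cpos[OF that] by simp
    then have "{S \<in> \<B>. ?c S powr t \<noteq> 0} = \<B>" by blast
    then show ?thesis unfolding g_def keys_multiaffine_poly[OF sub] by simp
  qed
  have g1: "g 1 = ?f"
  proof -
    have "g 1 = multiaffine_poly \<B> ?c"
      unfolding g_def multiaffine_poly_def
      by (intro sum.cong refl arg_cong[of _ _ "Poly_Mapping.single _"]) (use cpos in \<open>simp add: less_imp_le\<close>)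
    also have "\<dots> = ?f" using multiaffine_poly_coeff_at[OF sub] keys_sq_abs_poly[OF p sub] by simp
    finally show ?thesis .
  qed
  have g_tinf: "g t \<in> tinf_polys n d \<B>" if "t > 0" for t
  proof -
    have "strong_tinf_representation n d \<B> (\<lambda>S. (norm (p S))\<^sup>2 powr t)"
      by (rule strong_tinf_representation_powr[OF realizations_tinf[OF p] _ that]) simp
    then have "strong_tinf_representation n d \<B> (coeff_at (g t))"
      by (rule strong_tinf_representation_cong) (simp add: cg coeff_at_sq_abs_poly[OF p sub])
    then show ?thesis using keys_g unfolding tinf_polys_def by simp
  qed
  have not_L: "g t \<notin> L_mat n d \<B>" if t: "t > 1" for t
  proof
    assume "g t \<in> L_mat n d \<B>"
    moreover have "card T + 2 = d"
    proof -
      obtain Y where Y: "Y \<subseteq> E" "card Y = 2" by (rule obtain_subset_with_card_n[OF E(2)])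
      have "finite T" using T(1) by (rule finite_subset) simp
      moreover have "finite Y" using Y(1) finE by (rule finite_subset)
      moreover have "T \<inter> Y = {}" using T(2) Y(1) by blast
      ultimately show ?thesis using matroid_bases_finite(2)[OF M basis[OF Y]] Y(2) by (simp add: card_Un_disjoint)
    qed
    ultimately have "at_most_one_positive_eigenvalue (contraction_matrix n (coeff_at (g t)) T)"
      using T(1) L_mat_iff[OF M keys_g] by blast
    from at_most_one_positive_eigenvalueD[OF contraction_matrix_carrier contraction_matrix_sym this]
    obtain h v where hv: "\<forall>i<n. \<forall>j<n.
        contraction_matrix n (coeff_at (g t)) T $$ (i,j) = h i * h j - (\<Sum>k<n. v k i * v k j)"
      by (elim exE)
    define K where "K i j = contraction_matrix n (coeff_at (g t)) T $$ (i,j)" for i j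
    have finT: "finite (insert i (insert j T))" for i j using T(1) finite_subset by auto
    have Kij: "K i j = (if i \<noteq> j then ?c (insert i (insert j T)) powr t else 0)" if "i \<in> E" "j \<in> E" for i j
    proof -
      have "i < n" "j < n" "i \<notin> T" "j \<notin> T" using that E(1) T(2) by auto
      then show ?thesis unfolding K_def by (simp add: contraction_matrix_index cg[OF finT])
    qed
    have pos: "?c (insert i (insert j T)) > 0" if "i \<in> E" "j \<in> E" "i \<noteq> j" for i j
    proof -
      have "T \<union> {i, j} \<in> \<B>" using that by (intro basis) auto
      then show ?thesis using cpos[of "T \<union> {i, j}"] by simp
    qed
    have En: "i < n" if "i \<in> E" for i using that E(1) by auto
    have "x i = 0" if i: "i \<in> E" for i
    proof (rule lorentzian_powr_nonsingular[OF finE _ _ _ _ _ _ _ i, where K = K and s = "1 / t" and N = n and h = h and v = v])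
      show "\<exists>i\<in>E. \<exists>j\<in>E. i \<noteq> j"
      proof -
        obtain Y where "Y \<subseteq> E" "card Y = 2" by (rule obtain_subset_with_card_n[OF E(2)])
        then show ?thesis by (auto simp: card_2_iff)
      qed
      show "K i j = h i * h j - (\<Sum>k<n. v k i * v k j)" if "i \<in> E" "j \<in> E" for i j
        unfolding K_def using that En hv by simp
      show "K i i = 0" if "i \<in> E" for i using Kij[OF that that] by simp
      show "K i j > 0" if "i \<in> E" "j \<in> E" "i \<noteq> j" for i j
        using Kij[OF that(1,2)] pos[OF that] that(3) by simp
      show "0 < 1 / t" "1 / t < 1" using t by auto
      fix i assume i: "i \<in> E"
      have "K i j powr (1 / t) = contraction_matrix n ?c T $$ (i,j)" if j: "j \<in> E" for j
      proof -
        have "i \<notin> T" "j \<notin> T" using i j T(2) by auto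
        then show ?thesis
          using Kij[OF i j] contraction_matrix_index[OF En[OF i] En[OF j], of ?c T] t cnonneg[OF finT]
          by (simp add: powr_powr)
      qed
      then have "(\<Sum>j\<in>E. K i j powr (1 / t) * x j) = (\<Sum>j\<in>E. contraction_matrix n ?c T $$ (i,j) * x j)"
        by (intro sum.cong refl) simp
      then show "(\<Sum>j\<in>E. K i j powr (1 / t) * x j) = 0" using ker[OF i] by simp
    qed
    then show False using x by blast
  qed
  have "?f \<notin> top_of_set (tinf_polys n d \<B>) interior_of L_mat n d \<B>"
  proof
    assume "?f \<in> top_of_set (tinf_polys n d \<B>) interior_of L_mat n d \<B>"
    then obtain U where U: "openin (top_of_set (tinf_polys n d \<B>)) U" "?f \<in> U" "U \<subseteq> L_mat n d \<B>"
      unfolding interior_of_def by blast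
    then obtain V where V: "open V" "U = tinf_polys n d \<B> \<inter> V" unfolding openin_open by blast
    have "continuous_on UNIV g"
      unfolding g_def
    proof (rule continuous_on_multiaffine_poly)
      fix S assume "S \<in> \<B>"
      then have "?c S \<noteq> 0" using cpos[of S] by simp
      then show "continuous_on UNIV (\<lambda>t. ?c S powr t)"
        by (intro continuous_on_powr continuous_on_const continuous_on_id) simp
    qed
    then have "open (g -` V)" using V(1) continuous_on_open_vimage[OF open_UNIV, of g] by simp
    moreover have "1 \<in> g -` V" using U(2) V(2) g1 by simp
    ultimately obtain e where e: "e > 0" "ball 1 e \<subseteq> g -` V" unfolding open_contains_ball by blast
    have "1 + e / 2 \<in> ball 1 e" using e(1) by (simp add: dist_real_def)
    then have "g (1 + e / 2) \<in> V" using e(2) by blast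
    moreover have "g (1 + e / 2) \<in> tinf_polys n d \<B>" using e(1) by (intro g_tinf) simp
    ultimately have "g (1 + e / 2) \<in> L_mat n d \<B>" using V(2) U(3) by blast
    then show False using not_L[of "1 + e / 2"] e(1) by simp
  qed
  moreover have "?f \<in> top_of_set (tinf_polys n d \<B>) closure_of L_mat n d \<B>"
    using closure_of_subset_Int[of "top_of_set (tinf_polys n d \<B>)" "L_mat n d \<B>"] f_tinf L
    unfolding topspace_euclidean_subtopology by blast
  ultimately show ?thesis unfolding boundary_L_mat_def frontier_of_def by blast
qed

section \<open>Singular contractions on uniform minors\<close>

text \<open>Each row is a linear combination of \<open>\<alpha>\<close>, \<open>\<beta>\<close>,
  \<open>u\<close>, \<open>v\<close> on \<open>E\<close>, so a vector orthogonal to these functions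
  lies in the kernel.\<close>

lemma contraction_kernel:
  fixes \<alpha> \<beta> u v :: "nat \<Rightarrow> real"
  assumes "\<And>j. j \<in> E \<Longrightarrow> c j = \<alpha> i * \<beta> j + \<alpha> j * \<beta> i - 2 * u i * u j - 2 * v i * v j"
    and "(\<Sum>j\<in>E. \<alpha> j * x j) = 0" "(\<Sum>j\<in>E. \<beta> j * x j) = 0" "(\<Sum>j\<in>E. u j * x j) = 0" "(\<Sum>j\<in>E. v j * x j) = 0"
  shows "(\<Sum>j\<in>E. c j * x j) = 0"
proof -
  have "(\<Sum>j\<in>E. c j * x j) = (\<Sum>j\<in>E. \<alpha> i * (\<beta> j * x j) + \<beta> i * (\<alpha> j * x j) - 2 * u i * (u j * x j) - 2 * v i * (v j * x j))"
    by (intro sum.cong refl) (simp add: assms(1) algebra_simps)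
  also have "\<dots> = 0"
    unfolding sum_subtractf sum.distrib sum_distrib_left[symmetric] using assms(2-5) by simp
  finally show ?thesis .
qed

lemma sq_abs_poly_boundary_real:
  fixes p :: "nat set \<Rightarrow> real"
  assumes M: "matroid_bases n d \<B>" and p: "p \<in> realizations d n \<B>" and minor: "has_uniform_minor n \<B> 2 4"
  shows "sq_abs_poly \<B> p \<in> boundary_L_mat n d \<B>"
proof -
  have sub: "\<B> \<subseteq> ksubsets n d" using M unfolding matroid_bases_def by simp
  have "2 \<le> (4::nat)" by simp
  from uniform_minor_common_completion[OF M minor this]
  obtain T E where TE: "E \<subseteq> {..<n}" "card E = 4" "T \<subseteq> {..<n}" "T \<inter> E = {}"
    and basis': "\<forall>Y. Y \<subseteq> E \<and> card Y = 2 \<longrightarrow> T \<union> Y \<in> \<B>" by (elim exE conjE)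
  note basis = basis'[rule_format, OF conjI]
  have finE: "finite E" using TE finite_subset by blast
  have "2 \<le> card E" using TE(2) by simp
  then obtain Y where Y: "Y \<subseteq> E" "card Y = 2" by (rule obtain_subset_with_card_n)
  have "finite T" using TE(3) by (rule finite_subset) simp
  moreover have "finite Y" using Y(1) finE by (rule finite_subset)
  moreover have "T \<inter> Y = {}" using TE(4) Y(1) by blast
  ultimately have cT: "card T + 2 = d"
    using matroid_bases_finite(2)[OF M basis[OF Y]] Y(2) by (simp add: card_Un_disjoint)
  obtain a b :: "nat \<Rightarrow> real" where ab: "\<forall>i<n. \<forall>j<n.
      contraction_matrix n (coeff_at (sq_abs_poly \<B> p)) T $$ (i,j) = (norm (a i * b j - a j * b i))\<^sup>2"
    using contraction_matrix_realization[OF p sub TE(3) cT] by blast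
  obtain \<alpha> \<beta> u where K: "\<And>i j. (norm (a i * b j - a j * b i))\<^sup>2 = \<alpha> i * \<beta> j + \<alpha> j * \<beta> i - 2 * u i * u j"
    using sq_norm_two_minors_real[of a b] by blast
  \<comment> \<open>Three equations in four unknowns.\<close>
  have "length [\<alpha>, \<beta>, u] < card E" using TE(2) by simp
  from homogeneous_system_nontrivial_solution[OF finE this]
  obtain x where x: "\<exists>i\<in>E. x i \<noteq> 0" "\<forall>f\<in>set [\<alpha>, \<beta>, u]. (\<Sum>i\<in>E. f i * x i) = 0"
    by (elim exE conjE)
  show ?thesis
  proof (rule sq_abs_poly_in_boundary[OF M p sq_abs_poly_in_L_mat_real[OF M p] TE(1) _ TE(3,4) basis _ x(1)])
    fix i assume i: "i \<in> E"
    show "(\<Sum>j\<in>E. contraction_matrix n (coeff_at (sq_abs_poly \<B> p)) T $$ (i,j) * x j) = 0"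
    proof (rule contraction_kernel[where \<alpha> = \<alpha> and \<beta> = \<beta> and u = u and v = "\<lambda>_. 0" and i = i])
      fix j assume j: "j \<in> E"
      have "i < n" "j < n" using i j TE(1) by auto
      then show "contraction_matrix n (coeff_at (sq_abs_poly \<B> p)) T $$ (i,j) =
          \<alpha> i * \<beta> j + \<alpha> j * \<beta> i - 2 * u i * u j - 2 * 0 * 0" using ab K by simp
    qed (use x(2) in simp_all)
  qed (use TE(2) in simp_all)
qed

lemma sq_abs_poly_boundary_complex:
  fixes p :: "nat set \<Rightarrow> complex"
  assumes M: "matroid_bases n d \<B>" and p: "p \<in> realizations d n \<B>" and minor: "has_uniform_minor n \<B> 2 5"
  shows "sq_abs_poly \<B> p \<in> boundary_L_mat n d \<B>"
proof -
  have sub: "\<B> \<subseteq> ksubsets n d" using M unfolding matroid_bases_def by simp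
  have "2 \<le> (5::nat)" by simp
  from uniform_minor_common_completion[OF M minor this]
  obtain T E where TE: "E \<subseteq> {..<n}" "card E = 5" "T \<subseteq> {..<n}" "T \<inter> E = {}"
    and basis': "\<forall>Y. Y \<subseteq> E \<and> card Y = 2 \<longrightarrow> T \<union> Y \<in> \<B>" by (elim exE conjE)
  note basis = basis'[rule_format, OF conjI]
  have finE: "finite E" using TE finite_subset by blast
  have "2 \<le> card E" using TE(2) by simp
  then obtain Y where Y: "Y \<subseteq> E" "card Y = 2" by (rule obtain_subset_with_card_n)
  have "finite T" using TE(3) by (rule finite_subset) simp
  moreover have "finite Y" using Y(1) finE by (rule finite_subset)
  moreover have "T \<inter> Y = {}" using TE(4) Y(1) by blast
  ultimately have cT: "card T + 2 = d"
    using matroid_bases_finite(2)[OF M basis[OF Y]] Y(2) by (simp add: card_Un_disjoint)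
  obtain a b :: "nat \<Rightarrow> complex" where ab: "\<forall>i<n. \<forall>j<n.
      contraction_matrix n (coeff_at (sq_abs_poly \<B> p)) T $$ (i,j) = (norm (a i * b j - a j * b i))\<^sup>2"
    using contraction_matrix_realization[OF p sub TE(3) cT] by blast
  obtain \<alpha> \<beta> u v where K: "\<And>i j. (norm (a i * b j - a j * b i))\<^sup>2 =
      \<alpha> i * \<beta> j + \<alpha> j * \<beta> i - 2 * u i * u j - 2 * v i * v j"
    using sq_norm_two_minors_complex[of a b] by blast
  \<comment> \<open>The imaginary coordinate contributes a fourth equation, which is why a fifth
    element is asked for.\<close>
  have "length [\<alpha>, \<beta>, u, v] < card E" using TE(2) by simp
  from homogeneous_system_nontrivial_solution[OF finE this]
  obtain x where x: "\<exists>i\<in>E. x i \<noteq> 0" "\<forall>f\<in>set [\<alpha>, \<beta>, u, v]. (\<Sum>i\<in>E. f i * x i) = 0"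
    by (elim exE conjE)
  show ?thesis
  proof (rule sq_abs_poly_in_boundary[OF M p sq_abs_poly_in_L_mat_complex[OF M p] TE(1) _ TE(3,4) basis _ x(1)])
    fix i assume i: "i \<in> E"
    show "(\<Sum>j\<in>E. contraction_matrix n (coeff_at (sq_abs_poly \<B> p)) T $$ (i,j) * x j) = 0"
    proof (rule contraction_kernel[where \<alpha> = \<alpha> and \<beta> = \<beta> and u = u and v = v and i = i])
      fix j assume j: "j \<in> E"
      have "i < n" "j < n" using i j TE(1) by auto
      then show "contraction_matrix n (coeff_at (sq_abs_poly \<B> p)) T $$ (i,j) =
          \<alpha> i * \<beta> j + \<alpha> j * \<beta> i - 2 * u i * u j - 2 * v i * v j" using ab K by simp
    qed (use x(2) in simp_all)
  qed (use TE(2) in simp_all)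
qed
 

section \<open>Lorentzian forms in four variables\<close>

lemma ksubsets_4_2: "ksubsets 4 2 = {{0,1},{0,2},{0,3},{1,2},{1,3},{2,3}}"
proof (intro equalityI subsetI)
  fix S assume "S \<in> ksubsets 4 2"
  then obtain x y where S: "S = {x, y}" "x \<noteq> y" and "{x, y} \<subseteq> {..<4}"
    by (auto simp: ksubsets_def card_2_iff)
  then have "x \<in> {0,1,2,3}" "y \<in> {0,1,2,3}" by auto
  then show "S \<in> {{0,1},{0,2},{0,3},{1,2},{1,3},{2,3}}"
    unfolding S(1) using S(2) by (elim insertE emptyE) (simp_all add: doubleton_eq_iff)
qed (auto simp: ksubsets_def)

section \<open>Eigenvalues of 4 by 4 symmetric matrices with zero diagonal\<close>

lemma det_mat_Suc:
  fixes f :: "nat \<times> nat \<Rightarrow> 'a::comm_ring_1"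
  shows "Determinant.det (Matrix.mat (Suc n) (Suc n) f) =
    (\<Sum>i<Suc n. f (i, 0) * ((- 1) ^ i * Determinant.det (Matrix.mat n n (\<lambda>(a,b). f (if a < i then a else Suc a, Suc b)))))"
proof -
  let ?M = "Matrix.mat (Suc n) (Suc n) f"
  have "Determinant.det ?M = (\<Sum>i<Suc n. ?M $$ (i,0) * cofactor ?M i 0)"
    by (rule laplace_expansion_column) simp_all
  also have "\<dots> = (\<Sum>i<Suc n. f (i, 0) * ((- 1) ^ i * Determinant.det (Matrix.mat n n (\<lambda>(a,b). f (if a < i then a else Suc a, Suc b)))))"
  proof (rule sum.cong[OF refl])
    fix i assume "i \<in> {..<Suc n}"
    then have i: "i < Suc n" by simp
    have "mat_delete ?M i 0 = Matrix.mat n n (\<lambda>(a,b). f (if a < i then a else Suc a, Suc b))"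
      by (rule eq_matI) (auto simp: mat_delete_def)
    then show "?M $$ (i,0) * cofactor ?M i 0 =
       f (i, 0) * ((- 1) ^ i * Determinant.det (Matrix.mat n n (\<lambda>(a,b). f (if a < i then a else Suc a, Suc b))))"
      using i by (simp add: cofactor_def)
  qed
  finally show ?thesis .
qed

text \<open>This and the next two quantities are, up to sign and a factor 2, the elementary
  symmetric functions of the eigenvalues of the symmetric matrix with entries \<open>c {i,j}\<close>
  and zero diagonal: the determinant, the principal minors of size 3 (one per triangle) and those of
  size 2.\<close>

definition plucker_discr :: "(nat set \<Rightarrow> real) \<Rightarrow> real" where
  "plucker_discr c = (let A = c {0,1} * c {2,3}; B = c {0,2} * c {1,3}; C = c {0,3} * c {1,2}
     in A\<^sup>2 + B\<^sup>2 + C\<^sup>2 - 2*A*B - 2*A*C - 2*B*C)"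

definition triangle_sum :: "(nat set \<Rightarrow> real) \<Rightarrow> real" where
  "triangle_sum c = c {0,1} * c {0,2} * c {1,2} + c {0,1} * c {0,3} * c {1,3} +
     c {0,2} * c {0,3} * c {2,3} + c {1,2} * c {1,3} * c {2,3}"

definition square_sum :: "(nat set \<Rightarrow> real) \<Rightarrow> real" where
  "square_sum c = (c {0,1})\<^sup>2 + (c {0,2})\<^sup>2 + (c {0,3})\<^sup>2 + (c {1,2})\<^sup>2 + (c {1,3})\<^sup>2 + (c {2,3})\<^sup>2"

lemma det_mat_2:
  fixes f :: "nat \<times> nat \<Rightarrow> 'a::comm_ring_1"
  shows "Determinant.det (Matrix.mat (Suc (Suc 0)) (Suc (Suc 0)) f) =
    f (0,0) * f (Suc 0, Suc 0) - f (Suc 0, 0) * f (0, Suc 0)"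
  unfolding det_mat_Suc by simp

lemma det_mat_3:
  fixes f :: "nat \<times> nat \<Rightarrow> 'a::comm_ring_1"
  shows "Determinant.det (Matrix.mat (Suc (Suc (Suc 0))) (Suc (Suc (Suc 0))) f) =
    f (0,0) * (f (Suc 0, Suc 0) * f (Suc (Suc 0), Suc (Suc 0)) - f (Suc (Suc 0), Suc 0) * f (Suc 0, Suc (Suc 0)))
    - f (Suc 0, 0) * (f (0, Suc 0) * f (Suc (Suc 0), Suc (Suc 0)) - f (Suc (Suc 0), Suc 0) * f (0, Suc (Suc 0)))
    + f (Suc (Suc 0), 0) * (f (0, Suc 0) * f (Suc 0, Suc (Suc 0)) - f (Suc 0, Suc 0) * f (0, Suc (Suc 0)))"
  unfolding det_mat_Suc[of "Suc (Suc 0)"] det_mat_2 by (simp add: algebra_simps)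

lemma det_zero_diagonal_4:
  fixes a b c d e f x :: real
  shows "Determinant.det (Matrix.mat 4 4 (\<lambda>(i,j). [[x,a,b,c],[a,x,d,e],[b,d,x,f],[c,e,f,x]] ! i ! j)) =
    x^4 - (a\<^sup>2 + b\<^sup>2 + c\<^sup>2 + d\<^sup>2 + e\<^sup>2 + f\<^sup>2) * x\<^sup>2 + 2 * (a*b*d + a*c*e + b*c*f + d*e*f) * x +
    ((a*f)\<^sup>2 + (b*e)\<^sup>2 + (c*d)\<^sup>2 - 2*(a*f)*(b*e) - 2*(a*f)*(c*d) - 2*(b*e)*(c*d))"
proof -
  have n: "4 = Suc (Suc (Suc (Suc 0)))" by simp
  let ?m = "\<lambda>i j. [[x,a,b,c],[a,x,d,e],[b,d,x,f],[c,e,f,x]] ! i ! j"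
  have "Determinant.det (Matrix.mat 4 4 (\<lambda>(i,j). ?m i j)) =
      x * (x * (x * x - f * f) - d * (d * x - f * e) + e * (d * f - x * e))
    - a * (a * (x * x - f * f) - d * (b * x - f * c) + e * (b * f - x * c))
    + b * (a * (d * x - f * e) - x * (b * x - f * c) + e * (b * e - d * c))
    - c * (a * (d * f - x * e) - x * (b * f - x * c) + d * (b * e - d * c))"
    unfolding n det_mat_Suc[of "Suc (Suc (Suc 0))"] det_mat_3 by (simp add: algebra_simps)
  then show ?thesis by (simp only:) (simp add: algebra_simps power2_eq_square power4_eq_xxxx)
qed

lemma char_poly_contraction_matrix_4:
  "char_poly (contraction_matrix 4 c {}) =
    [:plucker_discr c, - 2 * triangle_sum c, - square_sum c, 0, 1:]" (is "?p = ?q")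
proof -
  let ?M = "contraction_matrix 4 c {}"
  have "poly ?p x = poly ?q x" for x
  proof -
    have M: "?M \<in> carrier_mat 4 4" by (rule contraction_matrix_carrier)
    have "- (char_matrix ?M x) = Matrix.mat 4 4 (\<lambda>(i,j). [[x, - c {0,1}, - c {0,2}, - c {0,3}], [- c {0,1}, x, - c {1,2}, - c {1,3}],
        [- c {0,2}, - c {1,2}, x, - c {2,3}], [- c {0,3}, - c {1,3}, - c {2,3}, x]] ! i ! j)" (is "_ = ?N")
    proof (rule eq_matI)
      fix i j assume "i < dim_row ?N" "j < dim_col ?N"
      then have ij: "i \<in> {0,1,2,3}" "j \<in> {0,1,2,3}" by auto
      have "(- (char_matrix ?M x)) $$ (i,j) = (if i = j then x else - c {i,j})"
        using ij M by (auto simp: char_matrix_def contraction_matrix_index)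
      also have "\<dots> = ?N $$ (i,j)" using ij by (auto simp: insert_commute)
      finally show "(- (char_matrix ?M x)) $$ (i,j) = ?N $$ (i,j)" .
    qed (use M in \<open>auto simp: char_matrix_def\<close>)
    then have "poly ?p x = Determinant.det ?N" unfolding char_poly_matrix[OF M] by (simp only:)
    then show ?thesis unfolding det_zero_diagonal_4
      by (simp add: plucker_discr_def triangle_sum_def square_sum_def Let_def algebra_simps power2_eq_square power4_eq_xxxx)
  qed
  then have "poly ?p = poly ?q" by (rule ext)
  then show ?thesis by (simp only: poly_eq_poly_eq_iff)
qed

text \<open>Dividing by a positive root \<open>r\<close> leaves a cubic with constant term
  \<open>e = - D / r \<ge> 0\<close>. From \<open>r * (r\<^sup>2 - s) = e + 2 * t\<close> its linear
  coefficient is nonnegative as well, so the cubic has no positive root.\<close>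

lemma quartic_at_most_one_positive_root:
  fixes D t s :: real
  assumes "D \<le> 0" "t \<ge> 0"
  shows "size (filter_mset (\<lambda>x. x > 0) (proots [:D, - 2 * t, - s, 0, 1:])) \<le> 1"
proof (cases "\<exists>r>0. poly [:D, - 2 * t, - s, 0, 1:] r = 0")
  case True
  then obtain r where r: "r > 0" "poly [:D, - 2 * t, - s, 0, 1:] r = 0" by blast
  define e where "e = r^3 - s * r - 2 * t"
  have D: "r * e = - D" using r(2) by (simp add: e_def algebra_simps power3_eq_cube)
  then have "r * e \<ge> 0" using assms(1) by simp
  then have e: "e \<ge> 0" using r(1) by (simp add: zero_le_mult_iff)
  have "r * (r\<^sup>2 - s) = e + 2 * t" by (simp add: e_def power2_eq_square power3_eq_cube algebra_simps)
  then have "r * (r\<^sup>2 - s) \<ge> 0" using e assms(2) by simp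
  then have rs: "r\<^sup>2 - s \<ge> 0" using r(1) by (simp add: zero_le_mult_iff)
  let ?q = "[:e, r\<^sup>2 - s, r, 1:]"
  have fact: "[:D, - 2 * t, - s, 0, 1:] = [:- r, 1:] * ?q"
    using D by (simp add: e_def power2_eq_square power3_eq_cube algebra_simps)
  have "\<not> x > 0" if "x \<in># proots ?q" for x
  proof
    assume x: "x > 0"
    have "poly ?q x = e + (r\<^sup>2 - s) * x + r * x\<^sup>2 + x^3"
      by (simp add: power2_eq_square power3_eq_cube algebra_simps)
    also have "\<dots> > 0" using x e rs r(1) by (intro add_nonneg_pos add_nonneg_nonneg mult_nonneg_nonneg) auto
    finally show False using that by simp
  qed
  then have "filter_mset (\<lambda>x. x > 0) (proots ?q) = {#}" by (rule filter_mset_eq_mempty_iff[THEN iffD2, rule_format])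
  moreover have "proots [:D, - 2 * t, - s, 0, 1:] = {#r#} + proots ?q"
    unfolding fact by (subst proots_mult) simp_all
  ultimately have "filter_mset (\<lambda>x. x > 0) (proots [:D, - 2 * t, - s, 0, 1:]) = {#r#}"
    using r(1) by (simp only: filter_union_mset) simp
  then show ?thesis by (simp only:) simp
next
  case False
  have "filter_mset (\<lambda>x. x > 0) (proots [:D, - 2 * t, - s, 0, 1:]) = {#}"
  proof (rule filter_mset_eq_mempty_iff[THEN iffD2, rule_format])
    fix x assume "x \<in># proots [:D, - 2 * t, - s, 0, 1:]"
    then have "poly [:D, - 2 * t, - s, 0, 1:] x = 0" by (subst (asm) set_count_proots) simp_all
    then show "\<not> x > 0" using False by blast
  qed
  then show ?thesis by (simp only:) simp
qed

text \<open>At the fourth root \<open>x\<close> of \<open>D\<close> the value is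
  \<open>2 * D - s * sqrt D - 2 * t * x\<close>, negative under the strictness hypothesis, while the
  quartic is positive at 0 and far out. In the borderline case
  \<open>(x\<^sup>2 - S)\<^sup>2\<close> the two roots merge and no sign change is left to
  detect.\<close>

lemma quartic_two_positive_roots:
  fixes D t s :: real
  assumes D: "D > 0" and S: "S \<ge> 0" "D \<le> S\<^sup>2" and s: "2 * S \<le> s" and t: "t \<ge> 0" and strict: "D < S\<^sup>2 \<or> t > 0"
  shows "size (filter_mset (\<lambda>x. x > 0) (proots [:D, - 2 * t, - s, 0, 1:])) > 1"
proof -
  let ?p = "[:D, - 2 * t, - s, 0, 1:]"
  define x where "x = sqrt (sqrt D)"
  have x: "x > 0" "x\<^sup>2 = sqrt D" "x^4 = D"
  proof -
    show "x > 0" "x\<^sup>2 = sqrt D" using D by (auto simp: x_def)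
    then have "(x\<^sup>2)\<^sup>2 = D" using D by simp
    then show "x^4 = D" by simp
  qed
  have DS: "sqrt D \<le> S" using S real_sqrt_le_mono[of D "S\<^sup>2"] by simp
  have neg: "poly ?p x < 0"
  proof -
    have px: "poly ?p x = 2 * D - s * sqrt D - 2 * t * x"
      using x(2,3) by (simp add: power2_eq_square power4_eq_xxxx algebra_simps)
    have sq: "sqrt D * sqrt D = D" "sqrt D > 0" using D by auto
    show ?thesis using strict
    proof
      assume "D < S\<^sup>2"
      then have "sqrt D < S" using S real_sqrt_less_mono[of D "S\<^sup>2"] by simp
      then have "2 * sqrt D < s" using s by simp
      then have "2 * sqrt D * sqrt D < s * sqrt D" using sq by simp
      then show ?thesis unfolding px using sq t x(1) by (simp add: mult.assoc) (smt (verit) mult_nonneg_nonneg)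
    next
      assume "t > 0"
      then have "t * x > 0" using x by simp
      moreover have "2 * sqrt D * sqrt D \<le> s * sqrt D" using sq s DS by (intro mult_right_mono) auto
      ultimately show ?thesis unfolding px using sq by (simp add: mult.assoc)
    qed
  qed
  have p0: "poly ?p 0 > 0" using D by simp
  obtain r1 where r1: "0 < r1" "r1 < x" "poly ?p r1 = 0" using poly_IVT_neg[OF x(1) p0 neg] by blast
  \<comment> \<open>Chosen with \<open>y \<ge> 1\<close> and \<open>s + 2 * t < y\<^sup>2\<close>,
    so that the leading term dominates at \<open>y\<close>.\<close>
  define y where "y = x + \<bar>s\<bar> + 2 * t + 1"
  have y: "x < y" "y \<ge> 1" using t x by (auto simp: y_def)
  have "poly ?p y > 0"
  proof -
    have "s + 2 * t < y" using x by (simp add: y_def)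
    moreover have "y * 1 \<le> y * y" using y by (intro mult_left_mono) auto
    ultimately have "s + 2 * t < y * y" by linarith
    then have "(s + 2 * t) * y\<^sup>2 < y * y * y\<^sup>2" using y by (intro mult_strict_right_mono) auto
    moreover have "2 * t * y \<le> 2 * t * y\<^sup>2" using t y by (intro mult_left_mono) (auto simp: power2_eq_square)
    moreover have "poly ?p y = D - 2 * t * y - s * y\<^sup>2 + y * y * y\<^sup>2"
      by (simp add: power2_eq_square algebra_simps)
    ultimately show ?thesis using D by (simp add: algebra_simps)
  qed
  then obtain r2 where r2: "x < r2" "poly ?p r2 = 0" using poly_IVT_pos[OF y(1) neg] by blast
  have "?p \<noteq> 0" by simp
  then have "r1 \<in># proots ?p" "r2 \<in># proots ?p" using r1(3) r2(2) by (simp_all only: set_count_proots mem_Collect_eq not_False_eq_True)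
  then have "r1 \<in># filter_mset (\<lambda>x. x > 0) (proots ?p)" "r2 \<in># filter_mset (\<lambda>x. x > 0) (proots ?p)"
    using r1(1) less_trans[OF x(1) r2(1)] by (simp_all only: set_mset_filter mem_Collect_eq simp_thms)
  moreover have "r1 \<noteq> r2" using r1 r2 by simp
  moreover have "size F > 1" if ab: "a \<in># F" "b \<in># F" "a \<noteq> b" for a b :: real and F
  proof -
    obtain F' where F': "F = add_mset a F'" using ab(1) by (rule mset_add)
    then have "b \<in># F'" using ab by simp
    then obtain F'' where "F' = add_mset b F''" by (rule mset_add)
    then show ?thesis using F' by simp
  qed
  ultimately show ?thesis by blast
qed

lemma contraction_matrix_4_at_most_one:
  assumes c: "\<And>S. S \<in> ksubsets 4 2 \<Longrightarrow> c S \<ge> 0" and D: "plucker_discr c \<le> 0"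
  shows "at_most_one_positive_eigenvalue (contraction_matrix 4 c {})"
proof -
  have "triangle_sum c \<ge> 0" unfolding triangle_sum_def using c by (simp add: ksubsets_4_2)
  from quartic_at_most_one_positive_root[OF D this]
  show ?thesis unfolding at_most_one_positive_eigenvalue_def char_poly_contraction_matrix_4 .
qed

text \<open>Applies \<open>quartic_two_positive_roots\<close> with \<open>S = A + B + C\<close>: the
  discriminant is \<open>S\<^sup>2 - 4 * (A*B + A*C + B*C)\<close>, and
  \<open>square_sum c \<ge> 2 * S\<close> follows from
  \<open>2 * x * y \<le> x\<^sup>2 + y\<^sup>2\<close>. The hypothesis \<open>ne\<close> supplies
  the strictness.\<close>

lemma plucker_discr_le_0:
  assumes c: "\<And>S. S \<in> ksubsets 4 2 \<Longrightarrow> c S \<ge> 0"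
    and one: "at_most_one_positive_eigenvalue (contraction_matrix 4 c {})"
    and ne: "triangle_sum c > 0 \<or> (c {0,1} * c {2,3}) * (c {0,2} * c {1,3}) > 0 \<or>
       (c {0,1} * c {2,3}) * (c {0,3} * c {1,2}) > 0 \<or> (c {0,2} * c {1,3}) * (c {0,3} * c {1,2}) > 0 \<or>
       plucker_discr c \<le> 0"
  shows "plucker_discr c \<le> 0"
proof (rule ccontr)
  assume "\<not> ?thesis"
  then have D: "plucker_discr c > 0" by simp
  define A B C where "A = c {0,1} * c {2,3}" and "B = c {0,2} * c {1,3}" and "C = c {0,3} * c {1,2}"
  have ABC: "A \<ge> 0" "B \<ge> 0" "C \<ge> 0" using c by (simp_all add: A_def B_def C_def ksubsets_4_2)
  have Deq: "plucker_discr c = (A + B + C)\<^sup>2 - 4 * (A * B + A * C + B * C)"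
    unfolding plucker_discr_def Let_def A_def B_def C_def by (simp add: power2_eq_square algebra_simps)
  have prods: "A * B \<ge> 0" "A * C \<ge> 0" "B * C \<ge> 0" using ABC by simp_all
  have t: "triangle_sum c \<ge> 0" unfolding triangle_sum_def using c by (simp add: ksubsets_4_2)
  have two: "2 * (x * y) \<le> x\<^sup>2 + y\<^sup>2" for x y :: real
    using zero_le_power2[of "x - y"] by (simp add: power2_eq_square algebra_simps)
  have "2 * (A + B + C) \<le> square_sum c"
    unfolding square_sum_def A_def B_def C_def
    using two[of "c {0,1}" "c {2,3}"] two[of "c {0,2}" "c {1,3}"] two[of "c {0,3}" "c {1,2}"] by simp
  moreover have "plucker_discr c < (A + B + C)\<^sup>2 \<or> triangle_sum c > 0"
  proof -
    have "A * B + A * C + B * C > 0" if "A * B > 0 \<or> A * C > 0 \<or> B * C > 0"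
      using that prods by linarith
    then show ?thesis using ne D unfolding A_def[symmetric] B_def[symmetric] C_def[symmetric] by (auto simp: Deq)
  qed
  moreover have "plucker_discr c \<le> (A + B + C)\<^sup>2" using prods unfolding Deq by simp
  ultimately have "size (filter_mset (\<lambda>x. x > 0) (proots (char_poly (contraction_matrix 4 c {})))) > 1"
    unfolding char_poly_contraction_matrix_4
    using D t ABC by (intro quartic_two_positive_roots[of _ "A + B + C"]) simp_all
  then show False using one unfolding at_most_one_positive_eigenvalue_def by simp
qed

section \<open>Uniform matroids and Pluecker coordinates in rank two\<close>

lemma matroid_bases_uniform:
  assumes "d \<le> n"
  shows "matroid_bases n d (ksubsets n d)"
proof -
  obtain S where "S \<subseteq> {..<n}" "card S = d" using obtain_subset_with_card_n[of d "{..<n}"] assms by auto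
  then have "ksubsets n d \<noteq> {}" unfolding ksubsets_def by blast
  moreover have "\<exists>y\<in>B - A. insert y (A - {x}) \<in> ksubsets n d"
    if A: "A \<in> ksubsets n d" and B: "B \<in> ksubsets n d" and x: "x \<in> A - B" for A B x
  proof -
    have fin: "finite A" "finite B" using A B by (auto intro: ksubsets_finite)
    have AB: "A \<subseteq> {..<n}" "card A = d" "B \<subseteq> {..<n}" "card B = d" using A B by (auto simp: ksubsets_def)
    have "\<not> B \<subseteq> A" using card_subset_eq[OF fin(1)] AB x by blast
    then obtain y where y: "y \<in> B - A" by blast
    have "card A > 0" using fin x by (auto simp: card_gt_0_iff)
    then have "card (insert y (A - {x})) = d"
      using fin x y AB by (simp add: card_Suc_Diff1)
    moreover have "insert y (A - {x}) \<subseteq> {..<n}" using AB y by blast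
    ultimately show ?thesis using y unfolding ksubsets_def by blast
  qed
  ultimately show ?thesis unfolding matroid_bases_def by blast
qed

lemma maximal_minors_2:
  assumes A: "A \<in> carrier_mat 2 n" and ij: "i < j" "j < n"
  shows "maximal_minors 2 n A {i,j} = A $$ (0,i) * A $$ (1,j) - A $$ (1,i) * A $$ (0,j)"
proof -
  have sets: "{a \<in> {i,j}. a < i} = {}" "{a \<in> {i,j}. a < j} = {i}" using ij by auto
  have pick: "pick {i,j} 0 = i" "pick {i,j} (Suc 0) = j"
    using pick_card_in_set[of i "{i,j}", unfolded sets] pick_card_in_set[of j "{i,j}", unfolded sets]
    by (simp_all del: pick.simps)
  have "{i,j} \<in> ksubsets n 2" using ij by (simp add: ksubsets_def)
  then have "maximal_minors 2 n A {i,j} = cols_det 2 A (pick {i,j})"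
    by (rule maximal_minors_eq_cols_det[OF A])
  also have "\<dots> = A $$ (0,i) * A $$ (1,j) - A $$ (1,i) * A $$ (0,j)"
    unfolding cols_det_def numeral_2_eq_2 det_mat_2 by (simp add: pick del: pick.simps)
  finally show ?thesis .
qed

lemma ksubsets_2_pair: "S \<in> ksubsets n 2 \<Longrightarrow> \<exists>i j. S = {i,j} \<and> i < j \<and> j < n"
proof -
  assume "S \<in> ksubsets n 2"
  then obtain x y where S: "S = {x,y}" "x \<noteq> y" "x < n" "y < n" by (auto simp: ksubsets_def card_2_iff)
  show ?thesis
  proof (cases "x < y")
    case True
    then show ?thesis using S by blast
  next
    case False
    then have "S = {y,x}" "y < x" using S by auto
    then show ?thesis using S by blast
  qed
qed

definition plucker_form :: "(nat set \<Rightarrow> real) \<Rightarrow> real" where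
  "plucker_form p = p {0,1} * p {2,3} - p {0,2} * p {1,3} + p {0,3} * p {1,2}"

text \<open>The cone over \<open>Gr(2,4)\<close> is the Pluecker quadric. A nonzero solution is the
  vector of minors of a matrix whose rows are two rows of the antisymmetric matrix \<open>P\<close>,
  selected by a nonzero entry.\<close>

lemma minor_vectors_2_4_iff:
  fixes p :: "nat set \<Rightarrow> real"
  shows "p \<in> minor_vectors 2 4 \<longleftrightarrow> (\<forall>S. S \<notin> ksubsets 4 2 \<longrightarrow> p S = 0) \<and> plucker_form p = 0"
proof (intro iffI conjI)
  assume "p \<in> minor_vectors 2 4"
  then obtain A where A: "A \<in> carrier_mat 2 4" "p = maximal_minors 2 4 A" unfolding minor_vectors_def by blast
  then show "\<forall>S. S \<notin> ksubsets 4 2 \<longrightarrow> p S = 0" by (simp add: maximal_minors_def)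
  note m = maximal_minors_2[OF A(1)]
  show "plucker_form p = 0"
    unfolding plucker_form_def A(2)
    by (subst m, simp, simp)+ (simp add: algebra_simps)
next
  assume p: "(\<forall>S. S \<notin> ksubsets 4 2 \<longrightarrow> p S = 0) \<and> plucker_form p = 0"
  show "p \<in> minor_vectors 2 4"
  proof (cases "\<forall>S\<in>ksubsets 4 2. p S = 0")
    case True
    have "maximal_minors 2 4 (0\<^sub>m 2 4) S = p S" for S
    proof (cases "S \<in> ksubsets 4 2")
      case S: True
      from ksubsets_2_pair[OF this] obtain i j where "S = {i,j}" "i < j" "j < 4" by blast
      then show ?thesis using maximal_minors_2[of "0\<^sub>m 2 4" 4 i j] True S by simp
    qed (use p in \<open>simp add: maximal_minors_def\<close>)
    then have "p = maximal_minors 2 4 (0\<^sub>m 2 4)" by (intro ext) simp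
    then show ?thesis unfolding minor_vectors_def by (metis imageI zero_carrier_mat)
  next
    case False
    define P where "P i j = (if i < j then p {i,j} else if j < i then - p {i,j} else 0)" for i j :: nat
    have enum: "(a,b) \<in> {(0,1),(0,2),(0,3),(1,2),(1,3),(2,3)}" if "a < b" "b < 4" for a b :: nat
      using that by simp presburger
    obtain u0 u1 u2 u3 u4 u5 where u: "p {0,1} = u0" "p {0,2} = u1" "p {0,3} = u2" "p {1,2} = u3" "p {1,3} = u4" "p {2,3} = u5"
      by blast
    have vals: "P 0 0 = 0" "P 1 1 = 0" "P 2 2 = 0" "P 3 3 = 0"
      "P 0 1 = u0" "P 0 2 = u1" "P 0 3 = u2" "P 1 2 = u3" "P 1 3 = u4" "P 2 3 = u5"
      "P 1 0 = - u0" "P 2 0 = - u1" "P 3 0 = - u2" "P 2 1 = - u3" "P 3 1 = - u4" "P 3 2 = - u5"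
      using u by (simp_all add: P_def insert_commute)
    have rel: "u0 * u5 = u1 * u4 - u2 * u3"
      using p unfolding plucker_form_def u by simp
    have PL: "P a b * P i j = P a i * P b j - P a j * P b i" if "a < b" "b < 4" "i < j" "j < 4" for a b i j
      using enum[OF that(1,2)] enum[OF that(3,4)]
      by (elim insertE emptyE; simp only: prod.inject; elim conjE; simp only: vals; use rel in \<open>simp add: algebra_simps\<close>)
    obtain S where S: "S \<in> ksubsets 4 2" "p S \<noteq> 0" using False by blast
    obtain a b where ab: "S = {a,b}" "a < b" "b < 4" using ksubsets_2_pair[OF S(1)] by blast
    have Pab: "P a b \<noteq> 0" using S ab by (simp add: P_def)
    \<comment> \<open>The rows are \<open>P b\<close>, divided by \<open>- P a b\<close>, and
      \<open>P a\<close>; the division makes the minor at \<open>i\<close>, \<open>j\<close> exactly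
      \<open>P i j\<close> instead of a multiple of it.\<close>
    define A where "A = Matrix.mat 2 4 (\<lambda>(r,j). if r = 0 then - P b j / P a b else P a j)"
    have A: "A \<in> carrier_mat 2 4" by (simp add: A_def)
    have "p R = maximal_minors 2 4 A R" for R
    proof (cases "R \<in> ksubsets 4 2")
      case True
      obtain i j where ij: "R = {i,j}" "i < j" "j < 4" using ksubsets_2_pair[OF True] by blast
      have "P a b * P i j = P a i * P b j - P a j * P b i"
        by (rule PL[OF ab(2,3) ij(2,3)])
      moreover have "P i j = p R" using ij by (simp add: P_def)
      moreover have "maximal_minors 2 4 A R = (- P b i / P a b) * P a j - P a i * (- P b j / P a b)"
        unfolding ij(1) maximal_minors_2[OF A ij(2,3)] using ij by (simp add: A_def)
      then have "P a b * maximal_minors 2 4 A R = P a i * P b j - P a j * P b i"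
        using Pab by (simp add: field_simps)
      ultimately have "P a b * p R = P a b * maximal_minors 2 4 A R" by simp
      then show ?thesis using Pab by simp
    next
      case False
      then show ?thesis using p by (simp add: maximal_minors_def)
    qed
    then have "p = maximal_minors 2 4 A" by (rule ext)
    then show ?thesis using A unfolding minor_vectors_def by blast
  qed
qed

section \<open>Square roots of forms with vanishing discriminant\<close>

text \<open>A nonnegative vector whose products \<open>A\<close>, \<open>B\<close>, \<open>C\<close> satisfy one of the equalities among
  \<open>\<surd>A\<close>, \<open>\<surd>B\<close>, \<open>\<surd>C\<close> in the triangle inequalities becomes a Pluecker vector after choosing
  square roots; \<open>k\<close> tells which equality.\<close>

definition root_sign :: "nat \<Rightarrow> nat set \<Rightarrow> real" where
  "root_sign k S = (if k = 1 \<and> S = {0,3} \<or> k = 2 \<and> S = {0,1} then - 1 else 1)"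

text \<open>Because of the absolute value \<open>c\<close> and \<open>- c\<close> have the same root
  vector, which is convenient in projective space.\<close>

definition root_vector :: "nat \<Rightarrow> (nat set \<Rightarrow> real) \<Rightarrow> nat set \<Rightarrow> real" where
  "root_vector k c S = (if S \<in> ksubsets 4 2 then root_sign k S * sqrt \<bar>c S\<bar> else 0)"

lemma root_vector_square: "S \<in> ksubsets 4 2 \<Longrightarrow> (root_vector k c S)\<^sup>2 = \<bar>c S\<bar>"
  by (simp add: root_vector_def root_sign_def power_mult_distrib)

lemma discr_factorization:
  fixes x y z :: real
  shows "(x\<^sup>2)\<^sup>2 + (y\<^sup>2)\<^sup>2 + (z\<^sup>2)\<^sup>2 - 2*x\<^sup>2*y\<^sup>2 - 2*x\<^sup>2*z\<^sup>2 - 2*y\<^sup>2*z\<^sup>2 =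
    (x + y + z) * (x - y + z) * (x - y - z) * (x + y - z)"
  by (simp add: power2_eq_square algebra_simps)

text \<open>Of the four factors of the discriminant, \<open>x + y + z\<close> vanishes for
  nonnegative numbers only if all three do. The remaining factors are, up to sign, the Pluecker
  forms for \<open>k = 0, 1, 2\<close>.\<close>

lemma root_vector_plucker:
  assumes c: "\<And>S. S \<in> ksubsets 4 2 \<Longrightarrow> c S \<ge> 0" and D: "plucker_discr c = 0"
  shows "\<exists>k<3. plucker_form (root_vector k c) = 0"
proof -
  define x y z where "x = sqrt (c {0,1} * c {2,3})" and "y = sqrt (c {0,2} * c {1,3})"
    and "z = sqrt (c {0,3} * c {1,2})"
  have nn: "c {0,1} \<ge> 0" "c {0,2} \<ge> 0" "c {0,3} \<ge> 0" "c {1,2} \<ge> 0" "c {1,3} \<ge> 0" "c {2,3} \<ge> 0"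
    using c by (simp_all add: ksubsets_4_2)
  have sq: "x\<^sup>2 = c {0,1} * c {2,3}" "y\<^sup>2 = c {0,2} * c {1,3}" "z\<^sup>2 = c {0,3} * c {1,2}"
    using nn by (simp_all add: x_def y_def z_def)
  have nonneg: "x \<ge> 0" "y \<ge> 0" "z \<ge> 0" using nn by (simp_all add: x_def y_def z_def)
  have "(x + y + z) * (x - y + z) * (x - y - z) * (x + y - z) = 0"
    using D discr_factorization[of x y z] unfolding plucker_discr_def Let_def sq by simp
  then have "x - y + z = 0 \<or> x - y - z = 0 \<or> - x - y + z = 0 \<or> x + y - z = 0"
    using nonneg by auto
  moreover have "plucker_form (root_vector 0 c) = x - y + z" "plucker_form (root_vector 1 c) = x - y - z"
    "plucker_form (root_vector 2 c) = - x - y + z"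
    using nn by (simp_all add: plucker_form_def root_vector_def root_sign_def ksubsets_4_2 doubleton_eq_iff
        x_def y_def z_def real_sqrt_mult)
  ultimately have "\<exists>k\<in>{0,1,2}. plucker_form (root_vector k c) = 0" by auto
  then obtain k where "k \<in> {0,1,2}" "plucker_form (root_vector k c) = 0" by (rule bexE)
  then show ?thesis by (intro exI[of _ k]) auto
qed

lemma plucker_discr_square:
  assumes "plucker_form p = 0"
  shows "plucker_discr (\<lambda>S. (p S)\<^sup>2) = 0"
proof -
  let ?x = "p {0,1} * p {2,3}" and ?y = "p {0,2} * p {1,3}" and ?z = "p {0,3} * p {1,2}"
  have "plucker_discr (\<lambda>S. (p S)\<^sup>2) = (?x + ?y + ?z) * (?x - ?y + ?z) * (?x - ?y - ?z) * (?x + ?y - ?z)"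
    using discr_factorization[of ?x ?y ?z] unfolding plucker_discr_def Let_def by (simp add: power_mult_distrib)
  moreover have "?x - ?y + ?z = 0" using assms by (simp add: plucker_form_def)
  ultimately show ?thesis by simp
qed

lemma plucker_discr_cong:
  assumes "\<And>S. S \<in> ksubsets 4 2 \<Longrightarrow> c S = c' S"
  shows "plucker_discr c = plucker_discr c'"
  using assms by (simp add: plucker_discr_def ksubsets_4_2)

text \<open>A zero coefficient removes one of the three products and leaves the squared difference
  of the other two.\<close>

lemma plucker_discr_nonneg_if_zero:
  assumes "S \<in> ksubsets 4 2" "c S = 0"
  shows "plucker_discr c \<ge> 0"
proof -
  define A B C where "A = c {0,1} * c {2,3}" and "B = c {0,2} * c {1,3}" and "C = c {0,3} * c {1,2}"
  have two: "x\<^sup>2 + y\<^sup>2 - 2 * x * y \<ge> 0" for x y :: real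
    using zero_le_power2[of "x - y"] by (simp add: power2_eq_square algebra_simps)
  have "A = 0 \<or> B = 0 \<or> C = 0" using assms unfolding ksubsets_4_2 A_def B_def C_def
    by (elim insertE emptyE) simp_all
  moreover have "plucker_discr c = A\<^sup>2 + B\<^sup>2 + C\<^sup>2 - 2*A*B - 2*A*C - 2*B*C"
    unfolding plucker_discr_def Let_def A_def B_def C_def ..
  ultimately show ?thesis using two[of A B] two[of A C] two[of B C] by (elim disjE) simp_all
qed

section \<open>Lorentzian quadrics in four variables\<close>

lemma M_convex_exchange:
  assumes conv: "M_convex (Poly_Mapping.keys f)"
    and ij: "coeff_at f {i,j} \<noteq> 0" and kl: "coeff_at f {k,l} \<noteq> 0" and dist: "distinct [i,j,k,l]"
  shows "coeff_at f {j,k} \<noteq> 0 \<or> coeff_at f {j,l} \<noteq> 0"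
proof -
  let ?e = "exponent_of {i,j}"
  have "?e \<in> Poly_Mapping.keys f" "exponent_of {k,l} \<in> Poly_Mapping.keys f"
    using ij kl by (simp_all add: coeff_at_def in_keys_iff)
  moreover have "Poly_Mapping.lookup (exponent_of {k,l}) i < Poly_Mapping.lookup ?e i"
    using dist by (simp add: lookup_exponent_of)
  ultimately obtain m where m: "Poly_Mapping.lookup ?e m < Poly_Mapping.lookup (exponent_of {k,l}) m"
    "?e - Poly_Mapping.single i 1 + Poly_Mapping.single m 1 \<in> Poly_Mapping.keys f"
    using conv unfolding M_convex_def by blast
  have mkl: "m = k \<or> m = l" using m(1) by (simp add: lookup_exponent_of split: if_splits)
  have "?e - Poly_Mapping.single i 1 + Poly_Mapping.single m 1 = exponent_of {j,m}"
  proof (rule poly_mapping_eqI)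
    fix x
    show "Poly_Mapping.lookup (?e - Poly_Mapping.single i 1 + Poly_Mapping.single m 1) x =
       Poly_Mapping.lookup (exponent_of {j,m}) x"
      using dist mkl unfolding lookup_add lookup_minus
      by (cases "x = i"; cases "x = j"; cases "x = m") (auto simp: lookup_single lookup_exponent_of when_def)
  qed
  then have "coeff_at f {j,m} \<noteq> 0" using m(2) by (simp add: coeff_at_def in_keys_iff)
  then show ?thesis using mkl by blast
qed

text \<open>M-convexity provides the strictness demanded by \<open>plucker_discr_le_0\<close>: a
  support that contains a complementary pair also contains a triangle or a second complementary
  pair.\<close>

lemma lorentzian_2_4_discr:
  assumes f: "f \<in> multiaffine_forms 2 4" and L: "lorentzian 4 2 f"
  shows "\<And>S. coeff_at f S \<ge> 0" "plucker_discr (coeff_at f) \<le> 0"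
proof -
  let ?c = "coeff_at f"
  have keys: "Poly_Mapping.keys f \<subseteq> exponent_of ` ksubsets 4 2" using f by (simp add: multiaffine_forms_def)
  show nn: "?c S \<ge> 0" for S using L by (simp add: lorentzian_def coeff_at_def)
  have conv: "M_convex (Poly_Mapping.keys f)" using L by (simp add: lorentzian_def)
  have "\<forall>k \<alpha>. k + 2 = 2 \<and> \<alpha> \<in> exponents 4 k \<longrightarrow> at_most_one_positive_eigenvalue (hessian 4 (partials 4 \<alpha> f))"
    using L unfolding lorentzian_def by blast
  then have "\<forall>T. T \<subseteq> {..<4} \<and> card T + 2 = 2 \<longrightarrow> at_most_one_positive_eigenvalue (contraction_matrix 4 ?c T)"
    unfolding hessians_iff_contraction_matrices[OF keys] .
  then have one: "at_most_one_positive_eigenvalue (contraction_matrix 4 ?c {})" by simp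
  \<comment> \<open>Regard the support as a graph with the disjoint edges \<open>ij\<close> and
    \<open>kl\<close>. Exchange joins each of \<open>i\<close> and \<open>j\<close> to
    \<open>k\<close> or \<open>l\<close>: a common neighbour gives a triangle, distinct neighbours
    give another perfect matching.\<close>
  have matching: "triangle_sum ?c > 0 \<or> (?c {i,k} * ?c {j,l}) > 0 \<or> (?c {i,l} * ?c {j,k}) > 0"
    if "?c {i,j} * ?c {k,l} > 0" "(i,j,k,l) \<in> {(0,1,2,3),(0,2,1,3),(0,3,1,2)}" for i j k l
  proof -
    have pos: "?c {i,j} > 0" "?c {k,l} > 0"
      using that(1) nn[of "{i,j}"] nn[of "{k,l}"] by (auto simp: zero_less_mult_iff)
    have dist: "distinct [i,j,k,l]" "distinct [j,i,k,l]" using that(2) by auto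
    have "?c {j,i} > 0" using pos(1) by (simp add: insert_commute)
    then have "?c {j,k} > 0 \<or> ?c {j,l} > 0" "?c {i,k} > 0 \<or> ?c {i,l} > 0"
      using M_convex_exchange[OF conv _ _ dist(1)] M_convex_exchange[OF conv _ _ dist(2)] pos nn
      by (metis less_le)+
    moreover have "triangle_sum ?c > 0" if "?c {i,j} * ?c {i,m} * ?c {j,m} > 0" "m = k \<or> m = l" for m
    proof -
      have n4: "?c {0,1} * ?c {0,2} * ?c {1,2} \<ge> 0" "?c {0,1} * ?c {0,3} * ?c {1,3} \<ge> 0"
        "?c {0,2} * ?c {0,3} * ?c {2,3} \<ge> 0" "?c {1,2} * ?c {1,3} * ?c {2,3} \<ge> 0" using nn by simp_all
      show ?thesis using that \<open>(i,j,k,l) \<in> _\<close> n4 unfolding triangle_sum_def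
        by (auto simp: insert_commute mult.commute mult.left_commute)
    qed
    ultimately show ?thesis using pos by (metis mult_pos_pos)
  qed
  have prods: "?c {0,1} * ?c {2,3} \<ge> 0" "?c {0,2} * ?c {1,3} \<ge> 0" "?c {0,3} * ?c {1,2} \<ge> 0" using nn by simp_all
  show "plucker_discr ?c \<le> 0"
  proof (rule plucker_discr_le_0[OF nn one])
    show "triangle_sum ?c > 0 \<or> (?c {0,1} * ?c {2,3}) * (?c {0,2} * ?c {1,3}) > 0 \<or>
       (?c {0,1} * ?c {2,3}) * (?c {0,3} * ?c {1,2}) > 0 \<or> (?c {0,2} * ?c {1,3}) * (?c {0,3} * ?c {1,2}) > 0 \<or>
       plucker_discr ?c \<le> 0"
    proof (cases "?c {0,1} * ?c {2,3} = 0 \<and> ?c {0,2} * ?c {1,3} = 0 \<and> ?c {0,3} * ?c {1,2} = 0")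
      case True
      then have "plucker_discr ?c = 0" unfolding plucker_discr_def Let_def by (elim conjE) (simp only:, simp)
      then show ?thesis by simp
    next
      case False
      then consider "?c {0,1} * ?c {2,3} > 0" | "?c {0,2} * ?c {1,3} > 0" | "?c {0,3} * ?c {1,2} > 0"
        using prods by linarith
      then show ?thesis
      proof cases
        case 1
        from matching[OF 1] 1 show ?thesis by (auto simp: mult_pos_pos)
      next
        case 2
        from matching[OF 2] 2 show ?thesis by (auto simp: mult_pos_pos insert_commute)
      next
        case 3
        from matching[OF 3] 3 show ?thesis by (auto simp: mult_pos_pos insert_commute)
      qed
    qed
  qed
qed

lemma sq_abs_poly_root_vector:
  assumes f: "f \<in> multiaffine_forms 2 4" and c: "\<And>S. S \<in> ksubsets 4 2 \<Longrightarrow> coeff_at f S \<ge> 0"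
  shows "multiaffine_poly (ksubsets 4 2) (\<lambda>S. (root_vector k (coeff_at f) S)\<^sup>2) = f"
proof -
  have "multiaffine_poly (ksubsets 4 2) (\<lambda>S. (root_vector k (coeff_at f) S)\<^sup>2) =
      multiaffine_poly (ksubsets 4 2) (coeff_at f)"
    unfolding multiaffine_poly_def
    by (intro sum.cong refl arg_cong[of _ _ "Poly_Mapping.single _"]) (simp add: root_vector_square c)
  also have "\<dots> = f" using f by (intro multiaffine_poly_coeff_at[of _ 4 2]) (simp_all add: multiaffine_forms_def)
  finally show ?thesis .
qed

lemma multiaffine_poly_restrict_support:
  fixes p :: "nat set \<Rightarrow> real"
  shows "sq_abs_poly {S \<in> ksubsets n d. p S \<noteq> 0} p = multiaffine_poly (ksubsets n d) (\<lambda>S. (p S)\<^sup>2)"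
  unfolding sq_abs_poly_def multiaffine_poly_def real_norm_def power2_abs
  by (rule sum.mono_neutral_left) (auto simp: finite_ksubsets)

lemma minor_vector_in_realizations:
  fixes p :: "nat set \<Rightarrow> real"
  assumes "p \<in> minor_vectors d n"
  shows "p \<in> realizations d n {S \<in> ksubsets n d. p S \<noteq> 0}"
  using assms unfolding realizations_def by auto

lemma lorentzian_minor_squares:
  fixes p :: "nat set \<Rightarrow> real"
  assumes "p \<in> minor_vectors d n" "p \<noteq> (\<lambda>_. 0)"
  shows "lorentzian n d (multiaffine_poly (ksubsets n d) (\<lambda>S. (p S)\<^sup>2))"
  using sq_abs_poly_in_L_mat_real[OF minors_support_matroid[OF assms] minor_vector_in_realizations[OF assms(1)]]
  unfolding multiaffine_poly_restrict_support L_mat_def by simp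

text \<open>If all coefficients are positive, the support is uniform and the quartic criterion
  applies. With a zero coefficient the discriminant is forced to be 0, so the form consists of
  squares of a Pluecker vector, whose support is a matroid; M-convexity need not be checked by
  hand.\<close>

lemma lorentzian_2_4_iff:
  assumes f: "f \<in> multiaffine_forms 2 4"
  shows "lorentzian 4 2 f \<longleftrightarrow>
    f \<noteq> 0 \<and> (\<forall>S\<in>ksubsets 4 2. coeff_at f S \<ge> 0) \<and> plucker_discr (coeff_at f) \<le> 0"
proof
  assume L: "lorentzian 4 2 f"
  then show "f \<noteq> 0 \<and> (\<forall>S\<in>ksubsets 4 2. coeff_at f S \<ge> 0) \<and> plucker_discr (coeff_at f) \<le> 0"
    using lorentzian_2_4_discr[OF f L] by (simp add: lorentzian_def)
next
  assume *: "f \<noteq> 0 \<and> (\<forall>S\<in>ksubsets 4 2. coeff_at f S \<ge> 0) \<and> plucker_discr (coeff_at f) \<le> 0"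
  then have c: "\<And>S. S \<in> ksubsets 4 2 \<Longrightarrow> coeff_at f S \<ge> 0" by blast
  have keys: "Poly_Mapping.keys f \<subseteq> exponent_of ` ksubsets 4 2" using f by (simp add: multiaffine_forms_def)
  show "lorentzian 4 2 f"
  proof (cases "\<forall>S\<in>ksubsets 4 2. coeff_at f S \<noteq> 0")
    case True
    have "exponent_of ` ksubsets 4 2 \<subseteq> Poly_Mapping.keys f"
    proof (rule image_subsetI)
      fix S assume "S \<in> ksubsets 4 2"
      then show "exponent_of S \<in> Poly_Mapping.keys f" using True by (simp add: coeff_at_def in_keys_iff)
    qed
    then have k: "Poly_Mapping.keys f = exponent_of ` ksubsets 4 2" using keys by blast
    have M: "matroid_bases 4 2 (ksubsets 4 2)" by (rule matroid_bases_uniform) simp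
    have "at_most_one_positive_eigenvalue (contraction_matrix 4 (coeff_at f) {})"
      by (rule contraction_matrix_4_at_most_one[OF c]) (use * in auto)
    moreover have "T = {}" if "T \<subseteq> {..<4}" "card T + 2 = 2" for T :: "nat set"
    proof -
      have "finite T" using that(1) by (rule finite_subset) simp
      then show ?thesis using that(2) by simp
    qed
    ultimately have "f \<in> L_mat 4 2 (ksubsets 4 2)" unfolding L_mat_iff[OF M k] using c by blast
    then show ?thesis by (simp add: L_mat_def)
  next
    case False
    then obtain S where "S \<in> ksubsets 4 2" "coeff_at f S = 0" by blast
    then have "plucker_discr (coeff_at f) = 0" using plucker_discr_nonneg_if_zero * by (metis order_antisym)
    then obtain k where k: "plucker_form (root_vector k (coeff_at f)) = 0" using root_vector_plucker[of "coeff_at f"] c by blast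
    let ?p = "root_vector k (coeff_at f)"
    have "?p \<in> minor_vectors 2 4" unfolding minor_vectors_2_4_iff using k by (simp add: root_vector_def)
    moreover have "?p \<noteq> (\<lambda>_. 0)"
    proof
      assume "?p = (\<lambda>_. 0)"
      then have "multiaffine_poly (ksubsets 4 2) (\<lambda>S. (?p S)\<^sup>2) = 0" by (simp add: multiaffine_poly_def)
      then show False using sq_abs_poly_root_vector[OF f, of k] c * by simp
    qed
    ultimately have "lorentzian 4 2 (multiaffine_poly (ksubsets 4 2) (\<lambda>S. (?p S)\<^sup>2))"
      by (rule lorentzian_minor_squares)
    then show ?thesis using sq_abs_poly_root_vector[OF f, of k] c by simp
  qed
qed

section \<open>Quotient maps and orbits\<close>

text \<open>On each piece the preimage of \<open>U\<close> under \<open>q\<close> is the preimage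
  under \<open>s i\<close> of its preimage under \<open>g\<close>, hence closed; finitely many
  closed pieces glue. The sections need not agree on overlaps, so sign choices may jump from piece
  to piece.\<close>

lemma quotient_map_by_closed_sections:
  assumes q: "quotient_map Z Y q" and g: "continuous_map P Y g" and fin: "finite I"
    and K: "\<And>i. i \<in> I \<Longrightarrow> closedin Z (K i)" and cover: "topspace Z \<subseteq> (\<Union>i\<in>I. K i)"
    and s: "\<And>i. i \<in> I \<Longrightarrow> continuous_map (subtopology Z (K i)) P (s i)"
    and gs: "\<And>i z. i \<in> I \<Longrightarrow> z \<in> K i \<Longrightarrow> g (s i z) = q z"
  shows "quotient_map P Y g"
  unfolding quotient_map_closedin
proof (intro conjI allI impI iffI)
  have Ksub: "K i \<subseteq> topspace Z" if "i \<in> I" for i using closedin_subset[OF K[OF that]] .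
  have top: "topspace (subtopology Z (K i)) = K i" if "i \<in> I" for i using Ksub[OF that] by auto
  have sP: "s i z \<in> topspace P" if "i \<in> I" "z \<in> K i" for i z
    using s[OF that(1)] that top[OF that(1)] unfolding continuous_map_def by auto
  have qY: "q ` topspace Z = topspace Y" using q by (rule quotient_imp_surjective_map)
  show "g ` topspace P = topspace Y"
  proof
    show "g ` topspace P \<subseteq> topspace Y" using g by (rule continuous_map_image_subset_topspace)
    show "topspace Y \<subseteq> g ` topspace P"
    proof
      fix y assume "y \<in> topspace Y"
      then have "y \<in> q ` topspace Z" by (simp only: qY)
      then obtain z where z: "z \<in> topspace Z" "q z = y" by blast
      from subsetD[OF cover z(1)] obtain i where i: "i \<in> I" "z \<in> K i" by (rule UN_E)
      show "y \<in> g ` topspace P" using imageI[OF sP[OF i], of g] gs[OF i] z(2) by simp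
    qed
  qed
  fix U assume U: "U \<subseteq> topspace Y"
  show "closedin P {x \<in> topspace P. g x \<in> U}" if "closedin Y U"
    using closedin_continuous_map_preimage[OF g that] .
  show "closedin Y U" if closed: "closedin P {x \<in> topspace P. g x \<in> U}"
  proof -
    have part: "closedin Z {z \<in> K i. q z \<in> U}" if i: "i \<in> I" for i
    proof -
      have "closedin (subtopology Z (K i)) {z \<in> K i. s i z \<in> {x \<in> topspace P. g x \<in> U}}"
        using closedin_continuous_map_preimage[OF s[OF i] closed] unfolding top[OF i] .
      moreover have "{z \<in> K i. s i z \<in> {x \<in> topspace P. g x \<in> U}} = {z \<in> K i. q z \<in> U}"
        using sP[OF i] gs[OF i] by auto
      ultimately show ?thesis using closedin_trans_full[OF _ K[OF i]] by simp
    qed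
    have "{z \<in> topspace Z. q z \<in> U} = (\<Union>i\<in>I. {z \<in> K i. q z \<in> U})"
      using cover Ksub by blast
    then have "closedin Z {z \<in> topspace Z. q z \<in> U}"
      using fin part by (simp only:) (intro closedin_Union, auto)
    then show ?thesis using q U unfolding quotient_map_closedin by blast
  qed
qed

text \<open>The group laws are asked for only in their effect on \<open>S\<close>: scalings are
  functions on all of \<open>nat\<close> constrained below \<open>n\<close>, and beyond
  \<open>n\<close> they may be zero, so pointwise multiplication does not make them a group.\<close>

lemma orbit_of_eq_iff:
  assumes closed: "\<And>g z. g \<in> G \<Longrightarrow> z \<in> S \<Longrightarrow> act g z \<in> S"
    and unit: "\<And>z. z \<in> S \<Longrightarrow> \<exists>e\<in>G. act e z = z"
    and comp: "\<And>g h z. g \<in> G \<Longrightarrow> h \<in> G \<Longrightarrow> z \<in> S \<Longrightarrow> \<exists>k\<in>G. act g (act h z) = act k z"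
    and inv: "\<And>g z. g \<in> G \<Longrightarrow> z \<in> S \<Longrightarrow> \<exists>h\<in>G. act h (act g z) = z"
    and x: "x \<in> S" and y: "y \<in> S"
  shows "orbit_of G act x = orbit_of G act y \<longleftrightarrow> (\<exists>g\<in>G. y = act g x)"
proof
  assume eq: "orbit_of G act x = orbit_of G act y"
  obtain e where "e \<in> G" "act e y = y" using unit[OF y] by blast
  then have "y \<in> orbit_of G act y" unfolding orbit_of_def by force
  then have "y \<in> orbit_of G act x" by (simp only: eq)
  then show "\<exists>g\<in>G. y = act g x" unfolding orbit_of_def by blast
next
  assume "\<exists>g\<in>G. y = act g x"
  then obtain g where g: "g \<in> G" "y = act g x" by blast
  obtain h where h: "h \<in> G" "act h y = x" using inv[OF g(1) x] g(2) by blast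
  have sub: "orbit_of G act a \<subseteq> orbit_of G act b" if ab: "k \<in> G" "a = act k b" "b \<in> S" for a b k
  proof
    fix w assume "w \<in> orbit_of G act a"
    then obtain l where l: "l \<in> G" "w = act l a" unfolding orbit_of_def by blast
    obtain m where "m \<in> G" "act l (act k b) = act m b" using comp[OF l(1) ab(1) ab(3)] by blast
    then show "w \<in> orbit_of G act b" unfolding orbit_of_def using l(2) ab(2) by blast
  qed
  show "orbit_of G act x = orbit_of G act y"
    using sub[OF h(1) h(2)[symmetric] y] sub[OF g(1) g(2) x] by blast
qed

lemma vector_class_eq_iff:
  fixes p q :: "nat set \<Rightarrow> real"
  shows "vector_class p = vector_class q \<longleftrightarrow> (\<exists>c. c \<noteq> 0 \<and> q = scale_vector c p)"
proof -
  have "vector_class p = vector_class q \<longleftrightarrow> (\<exists>c\<in>{c. c \<noteq> 0}. q = scale_vector c p)"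
    unfolding vector_class_def
  proof (rule orbit_of_eq_iff[where S = UNIV])
    fix z :: "nat set \<Rightarrow> real"
    show "\<exists>e\<in>{c. c \<noteq> 0}. scale_vector e z = z"
      by (intro bexI[of _ 1]) (simp_all add: scale_vector_def)
    fix g :: real assume g: "g \<in> {c. c \<noteq> 0}"
    show "\<exists>h\<in>{c. c \<noteq> 0}. scale_vector h (scale_vector g z) = z"
      using g by (intro bexI[of _ "1 / g"]) (simp_all add: scale_vector_def)
    fix h :: real assume "h \<in> {c. c \<noteq> 0}"
    then show "\<exists>k\<in>{c. c \<noteq> 0}. scale_vector g (scale_vector h z) = scale_vector k z"
      using g by (intro bexI[of _ "g * h"]) (simp_all add: scale_vector_def mult.assoc)
  qed simp_all
  then show ?thesis by simp
qed

lemma poly_class_eq_iff: "poly_class f = poly_class g \<longleftrightarrow> (\<exists>c. c \<noteq> 0 \<and> g = c *\<^sub>R f)"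
proof -
  have "poly_class f = poly_class g \<longleftrightarrow> (\<exists>c\<in>{c. c \<noteq> 0}. g = c *\<^sub>R f)"
    unfolding poly_class_def
  proof (rule orbit_of_eq_iff[where S = UNIV])
    fix z :: real_mpoly
    show "\<exists>e\<in>{c. c \<noteq> 0}. e *\<^sub>R z = z" by (intro bexI[of _ 1]) simp_all
    fix g :: real assume g: "g \<in> {c. c \<noteq> 0}"
    show "\<exists>h\<in>{c. c \<noteq> 0}. h *\<^sub>R (g *\<^sub>R z) = z"
      using g by (intro bexI[of _ "1 / g"]) simp_all
    fix h :: real assume "h \<in> {c. c \<noteq> 0}"
    then show "\<exists>k\<in>{c. c \<noteq> 0}. g *\<^sub>R (h *\<^sub>R z) = k *\<^sub>R z"
      using g by (intro bexI[of _ "g * h"]) simp_all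
  qed simp_all
  then show ?thesis by simp
qed

lemma realization_class_eq_iff:
  fixes p q :: "nat set \<Rightarrow> real"
  assumes p: "\<And>S. S \<notin> ksubsets n d \<Longrightarrow> p S = 0" and q: "\<And>S. S \<notin> ksubsets n d \<Longrightarrow> q S = 0"
  shows "realization_class n p = realization_class n q \<longleftrightarrow>
    (\<exists>c t. c \<noteq> 0 \<and> (\<forall>i<n. t i \<noteq> 0) \<and> q = scale_vector c (scale_columns t p))"
proof -
  let ?S = "{p. \<forall>S. S \<notin> ksubsets n d \<longrightarrow> p S = (0::real)}" and ?G = "realization_group n :: (real \<times> (nat \<Rightarrow> real)) set"
  have act: "realization_action (c, t) p = (\<lambda>S. c * ((\<Prod>i\<in>S. t i) * p S))" for c t and p :: "nat set \<Rightarrow> real"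
    by (simp add: realization_action_def scale_vector_def scale_columns_def)
  have "realization_class n p = realization_class n q \<longleftrightarrow> (\<exists>g\<in>?G. q = realization_action g p)"
    unfolding realization_class_def
  proof (rule orbit_of_eq_iff[where S = ?S])
    fix z assume z: "z \<in> ?S"
    show "\<exists>e\<in>?G. realization_action e z = z"
      by (intro bexI[of _ "(1, \<lambda>_. 1)"]) (simp_all add: act realization_group_def)
    fix g assume g: "g \<in> ?G"
    obtain c t where gc: "g = (c, t)" by (cases g)
    show "realization_action g z \<in> ?S" using z by (simp add: gc act)
    show "\<exists>h\<in>?G. realization_action h (realization_action g z) = z"
    proof (intro bexI[of _ "(1 / c, \<lambda>i. 1 / t i)"] ext)
      fix S
      show "realization_action (1 / c, \<lambda>i. 1 / t i) (realization_action g z) S = z S"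
      proof (cases "S \<in> ksubsets n d")
        case True
        then have "\<forall>i\<in>S. t i \<noteq> 0" using g by (auto simp: gc realization_group_def ksubsets_def)
        then have "(\<Prod>i\<in>S. 1 / t i) * (\<Prod>i\<in>S. t i) = 1"
          unfolding prod.distrib[symmetric] by (intro prod.neutral) simp
        moreover have "c \<noteq> 0" using g by (simp add: gc realization_group_def)
        moreover have "realization_action (1 / c, \<lambda>i. 1 / t i) (realization_action g z) S =
            (1 / c * c) * ((\<Prod>i\<in>S. 1 / t i) * (\<Prod>i\<in>S. t i)) * z S"
          unfolding gc act by (simp only: ac_simps)
        ultimately show ?thesis by simp
      qed (use z in \<open>simp add: gc act\<close>)
    qed (use g in \<open>simp add: gc realization_group_def\<close>)
    fix h assume h: "h \<in> ?G"
    obtain c' t' where hc: "h = (c', t')" by (cases h)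
    show "\<exists>k\<in>?G. realization_action g (realization_action h z) = realization_action k z"
      using g h by (intro bexI[of _ "(c * c', \<lambda>i. t i * t' i)"])
        (simp_all add: gc hc act realization_group_def prod.distrib ac_simps)
  qed (use p q in auto)
  then show ?thesis by (auto simp: realization_group_def realization_action_def)
qed

lemma rescale_vars_multiaffine_poly:
  assumes f: "f \<in> multiaffine_forms d n"
  shows "rescale_vars c f = multiaffine_poly (ksubsets n d) (\<lambda>S. coeff_at f S * (\<Prod>i\<in>S. c i))"
proof -
  let ?t = "\<lambda>m. Poly_Mapping.single m (Poly_Mapping.lookup f m * (\<Prod>i\<in>Poly_Mapping.keys m. c i ^ Poly_Mapping.lookup m i))"
  have keys: "Poly_Mapping.keys f \<subseteq> exponent_of ` ksubsets n d" using f by (simp add: multiaffine_forms_def)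
  have "rescale_vars c f = (\<Sum>m\<in>exponent_of ` ksubsets n d. ?t m)"
    unfolding rescale_vars_def
  proof (rule sum.mono_neutral_left)
    show "\<forall>m\<in>exponent_of ` ksubsets n d - Poly_Mapping.keys f. ?t m = 0" by (simp add: in_keys_iff)
  qed (use keys finite_ksubsets in simp_all)
  also have "\<dots> = (\<Sum>S\<in>ksubsets n d. ?t (exponent_of S))"
    by (simp add: sum.reindex[OF inj_on_exponent_of])
  also have "\<dots> = multiaffine_poly (ksubsets n d) (\<lambda>S. coeff_at f S * (\<Prod>i\<in>S. c i))"
    unfolding multiaffine_poly_def
  proof (rule sum.cong[OF refl])
    fix S assume "S \<in> ksubsets n d"
    then have fin: "finite S" by (rule ksubsets_finite)
    have "(\<Prod>i\<in>S. c i ^ Poly_Mapping.lookup (exponent_of S) i) = (\<Prod>i\<in>S. c i)"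
      by (rule prod.cong) (simp_all add: lookup_exponent_of fin)
    then show "?t (exponent_of S) = Poly_Mapping.single (exponent_of S) (coeff_at f S * (\<Prod>i\<in>S. c i))"
      by (simp add: keys_exponent_of fin coeff_at_def)
  qed
  finally show ?thesis .
qed

lemma multiaffine_forms_multiaffine_poly: "multiaffine_poly (ksubsets n d) c \<in> multiaffine_forms d n"
  using keys_multiaffine_poly[OF order_refl, of n d c] by (auto simp: multiaffine_forms_def)

lemma multiaffine_forms_eqI:
  assumes "f \<in> multiaffine_forms d n" "g \<in> multiaffine_forms d n"
    and "\<And>S. S \<in> ksubsets n d \<Longrightarrow> coeff_at f S = coeff_at g S"
  shows "f = g"
proof -
  have "f = multiaffine_poly (ksubsets n d) (coeff_at f)"
    using multiaffine_poly_coeff_at[OF order_refl, of f n d] assms(1) by (simp add: multiaffine_forms_def)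
  also have "\<dots> = multiaffine_poly (ksubsets n d) (coeff_at g)"
    unfolding multiaffine_poly_def using assms(3) by (intro sum.cong refl) simp
  also have "\<dots> = g"
    using multiaffine_poly_coeff_at[OF order_refl, of g n d] assms(2) by (simp add: multiaffine_forms_def)
  finally show ?thesis .
qed

lemma coeff_at_multiaffine_poly_ksubsets:
  "S \<in> ksubsets n d \<Longrightarrow> coeff_at (multiaffine_poly (ksubsets n d) c) S = c S"
  using coeff_at_multiaffine_poly[OF order_refl, of S n d c] ksubsets_finite by simp

lemma L_class_eq_iff:
  assumes f: "f \<in> multiaffine_forms d n" and g: "g \<in> multiaffine_forms d n"
  shows "L_class n f = L_class n g \<longleftrightarrow>
    (\<exists>c. (\<forall>i<n. c i > 0) \<and> (\<forall>S\<in>ksubsets n d. coeff_at g S = coeff_at f S * (\<Prod>i\<in>S. c i)))"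
proof -
  note resc = rescale_vars_multiaffine_poly
  have in_forms: "rescale_vars c z \<in> multiaffine_forms d n" if "z \<in> multiaffine_forms d n" for c z
    unfolding resc[OF that] by (rule multiaffine_forms_multiaffine_poly)
  have coeff: "coeff_at (rescale_vars c z) S = coeff_at z S * (\<Prod>i\<in>S. c i)"
    if "z \<in> multiaffine_forms d n" "S \<in> ksubsets n d" for c z S
    unfolding resc[OF that(1)] coeff_at_multiaffine_poly_ksubsets[OF that(2)] ..
  have "L_class n f = L_class n g \<longleftrightarrow> (\<exists>c\<in>pos_torus n. g = rescale_vars c f)"
    unfolding L_class_def
  proof (rule orbit_of_eq_iff[where S = "multiaffine_forms d n"])
    fix z assume z: "z \<in> multiaffine_forms d n"
    show "\<exists>e\<in>pos_torus n. rescale_vars e z = z"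
      by (intro bexI[of _ "\<lambda>_. 1"] multiaffine_forms_eqI[OF in_forms[OF z] z])
        (simp_all add: coeff z pos_torus_def)
    fix c assume c: "c \<in> pos_torus n"
    show "rescale_vars c z \<in> multiaffine_forms d n" by (rule in_forms[OF z])
    show "\<exists>h\<in>pos_torus n. rescale_vars h (rescale_vars c z) = z"
    proof (intro bexI[of _ "\<lambda>i. 1 / c i"] multiaffine_forms_eqI[OF in_forms[OF in_forms[OF z]] z])
      fix S assume S: "S \<in> ksubsets n d"
      then have "\<forall>i\<in>S. c i > 0" using c by (auto simp: pos_torus_def ksubsets_def)
      then have "(\<Prod>i\<in>S. c i) * (\<Prod>i\<in>S. 1 / c i) = 1"
        unfolding prod.distrib[symmetric] by (intro prod.neutral) auto
      then show "coeff_at (rescale_vars (\<lambda>i. 1 / c i) (rescale_vars c z)) S = coeff_at z S"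
        unfolding coeff[OF in_forms[OF z] S] coeff[OF z S] by (simp only: mult.assoc mult_1_right)
    qed (use c in \<open>simp add: pos_torus_def\<close>)
    fix h assume h: "h \<in> pos_torus n"
    show "\<exists>k\<in>pos_torus n. rescale_vars c (rescale_vars h z) = rescale_vars k z"
    proof (intro bexI[of _ "\<lambda>i. c i * h i"] multiaffine_forms_eqI[OF in_forms[OF in_forms[OF z]] in_forms[OF z]])
      fix S assume S: "S \<in> ksubsets n d"
      show "coeff_at (rescale_vars c (rescale_vars h z)) S = coeff_at (rescale_vars (\<lambda>i. c i * h i) z) S"
        unfolding coeff[OF in_forms[OF z] S] coeff[OF z S] prod.distrib by (simp only: ac_simps)
    qed (use c h in \<open>simp add: pos_torus_def\<close>)
  qed (fact f g)+
  also have "\<dots> \<longleftrightarrow> (\<exists>c. (\<forall>i<n. c i > 0) \<and> (\<forall>S\<in>ksubsets n d. coeff_at g S = coeff_at f S * (\<Prod>i\<in>S. c i)))"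
  proof -
    have "g = rescale_vars c f \<longleftrightarrow> (\<forall>S\<in>ksubsets n d. coeff_at g S = coeff_at f S * (\<Prod>i\<in>S. c i))" for c
      using multiaffine_forms_eqI[OF g in_forms[OF f], of c] coeff[OF f, of _ c] by auto
    then show ?thesis by (simp add: pos_torus_def)
  qed
  finally show ?thesis .
qed

section \<open>The rank two Grassmannian\<close>

text \<open>Signs on the six edges of the complete graph on \<open>0..3\<close>, with constant
  product along perfect matchings, come from signs at the vertices and one global sign, normalized
  by sign 1 at vertex 0. Solving the equations for the edges \<open>a\<close>, \<open>b\<close>,
  \<open>d\<close> of one triangle gives \<open>s = a * b * d\<close>.\<close>

lemma signs_factor:
  fixes a b c d e f :: real
  assumes s: "a \<in> {-1,1}" "b \<in> {-1,1}" "c \<in> {-1,1}" "d \<in> {-1,1}" "e \<in> {-1,1}" "f \<in> {-1,1}"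
    and eq: "a * f = \<eta>" "b * e = \<eta>" "c * d = \<eta>"
  shows "\<exists>s t1 t2 t3. s \<in> {-1,1} \<and> t1 \<in> {-1,1} \<and> t2 \<in> {-1,1} \<and> t3 \<in> {-1,1} \<and>
    a = s * t1 \<and> b = s * t2 \<and> c = s * t3 \<and> d = s * t1 * t2 \<and> e = s * t1 * t3 \<and> f = s * t2 * t3"
proof -
  have sq: "a * a = 1" "b * b = 1" "c * c = 1" "d * d = 1" using s by auto
  define s where "s = a * b * d"
  have "x * y \<in> {-1,1}" if "x \<in> {-1,1}" "y \<in> {-1,1}" for x y :: real using that by auto
  note mult = this
  have s: "s \<in> {-1,1}" unfolding s_def by (intro mult assms(1,2,4))
  note signs = mult[OF assms(1) s] mult[OF assms(2) s] mult[OF assms(3) s]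
  have ss: "s * s = 1" using s by auto
  have **: "s * (x * s) = x" for x
  proof -
    have "s * (x * s) = (s * s) * x" by (simp only: ac_simps)
    then show ?thesis by (simp add: ss)
  qed
  have *: "s * (x * s) * (y * s) = s * x * y" for x y
  proof -
    have "s * (x * s) * (y * s) = (s * s) * (s * x * y)" by (simp only: ac_simps)
    then show ?thesis by (simp add: ss)
  qed
  have "s * a * b = d"
  proof -
    have "s * a * b = (a * a) * ((b * b) * d)" unfolding s_def by (simp only: ac_simps)
    then show ?thesis by (simp add: sq)
  qed
  moreover have "s * a * c = e"
  proof -
    have "s * a * c = (a * a) * (b * (c * d))" unfolding s_def by (simp only: ac_simps)
    also have "c * d = b * e" using eq by simp
    also have "(a * a) * (b * (b * e)) = (a * a) * ((b * b) * e)" by (simp only: ac_simps)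
    finally show ?thesis by (simp add: sq)
  qed
  moreover have "s * b * c = f"
  proof -
    have "s * b * c = (b * b) * (a * (c * d))" unfolding s_def by (simp only: ac_simps)
    also have "c * d = a * f" using eq by simp
    also have "(b * b) * (a * (a * f)) = (b * b) * ((a * a) * f)" by (simp only: ac_simps)
    finally show ?thesis by (simp add: sq)
  qed
  ultimately have "a = s * (a * s) \<and> b = s * (b * s) \<and> c = s * (c * s) \<and> d = s * (a * s) * (b * s) \<and>
      e = s * (a * s) * (c * s) \<and> f = s * (b * s) * (c * s)"
    by (intro conjI **[symmetric] trans[OF _ *[symmetric]]) (simp_all only:)
  then show ?thesis using s signs by blast
qed

text \<open>If an entry is zero its sign is free, and it is chosen so that the two signs have
  product \<open>\<eta>\<close>.\<close>

lemma sign_pair: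
  fixes a b a' b' \<eta> :: real
  assumes "b\<^sup>2 = a\<^sup>2" "b'\<^sup>2 = a'\<^sup>2" "\<eta> \<in> {-1,1}" "b * b' = \<eta> * (a * a')"
  shows "\<exists>\<epsilon> \<epsilon>'. \<epsilon> \<in> {-1,1} \<and> \<epsilon>' \<in> {-1,1} \<and> \<epsilon> * \<epsilon>' = \<eta> \<and> b = \<epsilon> * a \<and> b' = \<epsilon>' * a'"
proof -
  have "b = a \<or> b = - a" "b' = a' \<or> b' = - a'" using assms(1,2) by (simp_all only: power2_eq_iff)
  then obtain s s' where s: "s \<in> {-1,1}" "b = s * a" "s' \<in> {-1,1}" "b' = s' * a'"
    by (metis insertCI mult_1 mult_minus1)
  have ss: "s * s = 1" "s' * s' = 1" "\<eta> * \<eta> = 1" using s assms(3) by auto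
  show ?thesis
  proof (cases "a = 0")
    case True
    show ?thesis
      using True s assms(3) ss by (intro exI[of _ "\<eta> * s'"] exI[of _ s']) (auto simp: mult.assoc)
  next
    case False
    show ?thesis
    proof (cases "a' = 0")
      case True
      show ?thesis using True s assms(3) ss by (intro exI[of _ s] exI[of _ "s * \<eta>"]) (auto simp: mult.assoc[symmetric])
    next
      case a': False
      have "s * s' = \<eta>" using assms(4) False a' unfolding s(2,4) by simp
      then show ?thesis using s by blast
    qed
  qed
qed

text \<open>Comparing the two relations under a mixed sign pattern shows that the term out of step
  is zero, so its sign can be switched.\<close>

lemma common_sign:
  fixes x y z x' y' z' :: real
  assumes "x' = x \<or> x' = - x" "y' = y \<or> y' = - y" "z' = z \<or> z' = - z" "x - y + z = 0" "x' - y' + z' = 0"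
  shows "\<exists>\<eta>\<in>{-1,1}. x' = \<eta> * x \<and> y' = \<eta> * y \<and> z' = \<eta> * z"
proof -
  have "x' = x \<and> y' = y \<and> z' = z \<or> x' = - x \<and> y' = - y \<and> z' = - z"
    using assms by (elim disjE) auto
  then show ?thesis by auto
qed

text \<open>Equal squares leave six undetermined signs. The linear relation among the three products
  ties their signs to one \<open>\<eta>\<close>, which is the condition under which the six signs
  come from column scalings and a scalar.\<close>

lemma plucker_vectors_equal_squares:
  fixes p q :: "nat set \<Rightarrow> real"
  assumes p: "p \<in> minor_vectors 2 4" and q: "q \<in> minor_vectors 2 4"
    and sq: "\<And>S. S \<in> ksubsets 4 2 \<Longrightarrow> (q S)\<^sup>2 = (p S)\<^sup>2"
  shows "\<exists>s t. s \<in> {-1,1} \<and> (\<forall>i<4. t i \<in> {-1,1}) \<and> q = scale_vector s (scale_columns t p)"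
proof -
  have pq: "plucker_form p = 0" "plucker_form q = 0" and p0: "\<And>S. S \<notin> ksubsets 4 2 \<Longrightarrow> p S = 0"
    and q0: "\<And>S. S \<notin> ksubsets 4 2 \<Longrightarrow> q S = 0"
    using p q unfolding minor_vectors_2_4_iff by auto
  have sq': "(q {0,1})\<^sup>2 = (p {0,1})\<^sup>2" "(q {0,2})\<^sup>2 = (p {0,2})\<^sup>2" "(q {0,3})\<^sup>2 = (p {0,3})\<^sup>2"
    "(q {1,2})\<^sup>2 = (p {1,2})\<^sup>2" "(q {1,3})\<^sup>2 = (p {1,3})\<^sup>2" "(q {2,3})\<^sup>2 = (p {2,3})\<^sup>2"
    by (intro sq, simp add: ksubsets_4_2)+
  have pm: "b * b' = a * a' \<or> b * b' = - (a * a')" if "b\<^sup>2 = a\<^sup>2" "b'\<^sup>2 = a'\<^sup>2" for a a' b b' :: real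
  proof -
    have "(b * b')\<^sup>2 = (a * a')\<^sup>2" using that by (simp add: power_mult_distrib)
    then show ?thesis by (simp only: power2_eq_iff)
  qed
  obtain \<eta> where \<eta>: "\<eta> \<in> {-1,1}" "q {0,1} * q {2,3} = \<eta> * (p {0,1} * p {2,3})"
    "q {0,2} * q {1,3} = \<eta> * (p {0,2} * p {1,3})" "q {0,3} * q {1,2} = \<eta> * (p {0,3} * p {1,2})"
    using common_sign[OF pm[OF sq'(1,6)] pm[OF sq'(2,5)] pm[OF sq'(3,4)]] pq unfolding plucker_form_def by blast
  obtain a f where af: "a \<in> {-1,1}" "f \<in> {-1,1}" "a * f = \<eta>" "q {0,1} = a * p {0,1}" "q {2,3} = f * p {2,3}"
    using sign_pair[OF sq'(1,6) \<eta>(1,2)] by blast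
  obtain b e where be: "b \<in> {-1,1}" "e \<in> {-1,1}" "b * e = \<eta>" "q {0,2} = b * p {0,2}" "q {1,3} = e * p {1,3}"
    using sign_pair[OF sq'(2,5) \<eta>(1,3)] by blast
  obtain c d where cd: "c \<in> {-1,1}" "d \<in> {-1,1}" "c * d = \<eta>" "q {0,3} = c * p {0,3}" "q {1,2} = d * p {1,2}"
    using sign_pair[OF sq'(3,4) \<eta>(1,4)] by blast
  obtain s t1 t2 t3 where st: "s \<in> {-1,1}" "t1 \<in> {-1,1}" "t2 \<in> {-1,1}" "t3 \<in> {-1,1}"
    "a = s * t1" "b = s * t2" "c = s * t3" "d = s * t1 * t2" "e = s * t1 * t3" "f = s * t2 * t3"
    using signs_factor[OF af(1) be(1) cd(1,2) be(2) af(2,3) be(3) cd(3)] by blast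
  define t where "t i = (if i = 0 then 1 else if i = 1 then t1 else if i = 2 then t2 else t3)" for i :: nat
  have "q S = s * ((\<Prod>i\<in>S. t i) * p S)" for S
  proof (cases "S \<in> ksubsets 4 2")
    case True
    then have "S \<in> {{0,1},{0,2},{0,3},{1,2},{1,3},{2,3}}" unfolding ksubsets_4_2 .
    then show ?thesis
      by (elim insertE emptyE) (simp_all only: af(4,5) be(4,5) cd(4,5) st(5-10), simp_all add: t_def)
  qed (simp add: p0 q0)
  then have "q = scale_vector s (scale_columns t p)"
    unfolding scale_vector_def scale_columns_def by (rule ext)
  moreover have "\<forall>i<4. t i \<in> {-1,1}" using st by (simp add: t_def)
  ultimately show ?thesis using st(1) by blast
qed

section \<open>Square forms and the boundary for the uniform matroid\<close>

abbreviation (input) pairs4 :: "nat set set" where "pairs4 \<equiv> ksubsets 4 2"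

definition nonneg_form :: "real_mpoly \<Rightarrow> bool" where
  "nonneg_form f \<longleftrightarrow> (\<forall>S\<in>pairs4. coeff_at f S \<ge> 0)"

definition square_form :: "(nat set \<Rightarrow> real) \<Rightarrow> real_mpoly" where
  "square_form p = multiaffine_poly pairs4 (\<lambda>S. (p S)\<^sup>2)"

lemma square_form_coeff: "S \<in> pairs4 \<Longrightarrow> coeff_at (square_form p) S = (p S)\<^sup>2"
  unfolding square_form_def by (rule coeff_at_multiaffine_poly_ksubsets)

lemma square_form_in_forms: "square_form p \<in> multiaffine_forms 2 4"
  unfolding square_form_def by (rule multiaffine_forms_multiaffine_poly)

lemma square_form_discr: "plucker_form p = 0 \<Longrightarrow> plucker_discr (coeff_at (square_form p)) = 0"
  using plucker_discr_square[of p] plucker_discr_cong[of "coeff_at (square_form p)" "\<lambda>S. (p S)\<^sup>2"]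
  by (simp add: square_form_coeff)

lemma square_form_root_vector:
  assumes "f \<in> multiaffine_forms 2 4" "nonneg_form f"
  shows "square_form (root_vector k (coeff_at f)) = f"
  unfolding square_form_def
  by (rule sq_abs_poly_root_vector[OF assms(1)]) (use assms(2) in \<open>simp add: nonneg_form_def\<close>)

lemma root_vector_zero_outside: "S \<notin> pairs4 \<Longrightarrow> root_vector k c S = 0"
  by (simp add: root_vector_def)

lemma continuous_on_square_form: "continuous_on X (square_form :: (nat set \<Rightarrow> real) \<Rightarrow> _)"
proof -
  have "continuous_on X (\<lambda>p. multiaffine_poly pairs4 (\<lambda>S. (p S)\<^sup>2))"
    by (rule continuous_on_multiaffine_poly)
      (intro continuous_on_power continuous_on_product_then_coordinatewise[OF continuous_on_id])
  then show ?thesis by (simp add: square_form_def[abs_def])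
qed

lemma continuous_on_root_vector: "continuous_on X (\<lambda>f. root_vector k (coeff_at f))"
proof (rule continuous_on_coordinatewise_then_product)
  fix S
  show "continuous_on X (\<lambda>f. root_vector k (coeff_at f) S)"
  proof (cases "S \<in> pairs4")
    case True
    then show ?thesis unfolding root_vector_def
      by simp (intro continuous_intros continuous_on_coeff_at)
  qed (simp add: root_vector_def)
qed

lemma continuous_on_plucker_discr: "continuous_on X (\<lambda>f. plucker_discr (coeff_at f))"
  unfolding plucker_discr_def Let_def by (intro continuous_intros continuous_on_coeff_at)

lemma continuous_on_plucker_form_root_vector:
  "continuous_on X (\<lambda>f. plucker_form (root_vector k (coeff_at f)))"
  unfolding plucker_form_def
  by (intro continuous_intros continuous_on_product_then_coordinatewise[OF continuous_on_root_vector])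

lemma continuous_on_plucker_form: "continuous_on X plucker_form"
  unfolding plucker_form_def[abs_def]
  by (intro continuous_intros continuous_on_product_then_coordinatewise[OF continuous_on_id])

lemma L_mat_uniform_iff:
  "f \<in> L_mat 4 2 pairs4 \<longleftrightarrow>
     f \<in> multiaffine_forms 2 4 \<and> (\<forall>S\<in>pairs4. coeff_at f S > 0) \<and> plucker_discr (coeff_at f) \<le> 0"
proof -
  have keys: "Poly_Mapping.keys f = exponent_of ` pairs4 \<longleftrightarrow>
      f \<in> multiaffine_forms 2 4 \<and> (\<forall>S\<in>pairs4. coeff_at f S \<noteq> 0)"
    unfolding multiaffine_forms_def coeff_at_def by (auto simp: in_keys_iff[symmetric])
  have "{0,1} \<in> pairs4" by (simp add: ksubsets_4_2)
  then have "f \<noteq> 0" if "\<forall>S\<in>pairs4. coeff_at f S \<noteq> 0"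
    using that by (auto simp: coeff_at_def)
  then show ?thesis
    unfolding L_mat_def mem_Collect_eq keys using lorentzian_2_4_iff[of f] by (auto simp: less_le)
qed

lemma uniform_minor_self: "has_uniform_minor 4 pairs4 2 4"
proof -
  have inter: "X = Y" if "X \<in> pairs4" "Y \<in> pairs4" "X \<subseteq> Y" for X Y
    using that ksubsets_finite[OF that(2)] card_subset_eq[of Y X] by (simp add: ksubsets_def)
  have d0: "delete_bases \<B> {} = \<B>" if "\<And>X Y. X \<in> \<B> \<Longrightarrow> Y \<in> \<B> \<Longrightarrow> X \<subseteq> Y \<Longrightarrow> X = Y" for \<B>
    using that unfolding delete_bases_def by auto
  have sub: "B \<subseteq> {..<4}" if "B \<in> pairs4" for B using that by (simp add: ksubsets_def)
  have "delete_bases (dual_bases {..<4} pairs4) {} = dual_bases {..<4} pairs4"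
  proof (rule d0)
    fix X Y assume "X \<in> dual_bases {..<4} pairs4" "Y \<in> dual_bases {..<4} pairs4" "X \<subseteq> Y"
    then obtain A B where AB: "A \<in> pairs4" "B \<in> pairs4" "X = {..<4} - A" "Y = {..<4} - B" "{..<4} - A \<subseteq> {..<4} - B"
      unfolding dual_bases_def by auto
    then have "B \<subseteq> A" using sub[OF AB(2)] by blast
    then show "X = Y" using inter[OF AB(2,1)] AB by simp
  qed
  moreover have "dual_bases {..<4} (dual_bases {..<4} pairs4) = pairs4"
  proof -
    have "{..<4} - ({..<4} - B) = B" if "B \<in> pairs4" for B using sub[OF that] by blast
    then show ?thesis unfolding dual_bases_def image_image by simp
  qed
  ultimately have "contract_bases {..<4} pairs4 {} = pairs4" unfolding contract_bases_def by simp
  moreover have "delete_bases pairs4 {} = pairs4" by (rule d0[OF inter])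
  ultimately have "delete_bases (contract_bases {..<4} pairs4 {}) {} = {S. S \<subseteq> {..<4} \<and> card S = 2}"
    by (simp add: ksubsets_def)
  then show ?thesis unfolding has_uniform_minor_def by (intro exI[of _ "{}"]) simp
qed

lemma realizations_uniform_iff:
  fixes p :: "nat set \<Rightarrow> real"
  shows "p \<in> realizations 2 4 pairs4 \<longleftrightarrow> p \<in> minor_vectors 2 4 \<and> (\<forall>S\<in>pairs4. p S \<noteq> 0)"
  by (auto simp: realizations_def)

lemma sq_abs_poly_uniform: "sq_abs_poly pairs4 (p :: nat set \<Rightarrow> real) = square_form p"
  by (simp add: sq_abs_poly_def square_form_def)

text \<open>The inclusion into the zero set is topological: among the representations
  \<open>discr \<le> 0\<close> is closed and \<open>discr < 0\<close> is open. Conversely, a form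
  with discriminant 0 comes from a real realization, to which
  \<open>sq_abs_poly_boundary_real\<close> applies.\<close>

lemma boundary_L_mat_uniform:
  "boundary_L_mat 4 2 pairs4 = {f \<in> L_mat 4 2 pairs4. plucker_discr (coeff_at f) = 0}"
proof (intro equalityI subsetI)
  let ?T = "tinf_polys 4 2 pairs4"
  have T: "f \<in> multiaffine_forms 2 4" "\<forall>S\<in>pairs4. coeff_at f S > 0" if "f \<in> ?T" for f
    using that unfolding tinf_polys_def strong_tinf_representation_def multiaffine_forms_def
    by (auto simp: less_le)
  fix f assume f: "f \<in> boundary_L_mat 4 2 pairs4"
  then have fT: "f \<in> ?T" and cl: "f \<in> top_of_set ?T closure_of L_mat 4 2 pairs4"
    and int: "f \<notin> top_of_set ?T interior_of L_mat 4 2 pairs4"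
    unfolding boundary_L_mat_def frontier_of_def
    using closure_of_subset_topspace[of "top_of_set ?T" "L_mat 4 2 pairs4"] by auto
  have "closedin (top_of_set ?T) (?T \<inter> (\<lambda>f. plucker_discr (coeff_at f)) -` {..0})"
    by (intro continuous_closedin_preimage continuous_on_plucker_discr closed_atMost)
  \<comment> \<open>The relative closure only sees \<open>L_mat\<close> inside the space of
    representations, hence the intersection.\<close>
  then have "top_of_set ?T closure_of (?T \<inter> L_mat 4 2 pairs4) \<subseteq> ?T \<inter> (\<lambda>f. plucker_discr (coeff_at f)) -` {..0}"
    by (intro closure_of_minimal) (auto simp: L_mat_uniform_iff)
  then have D: "plucker_discr (coeff_at f) \<le> 0"
    using cl closure_of_restrict[of "top_of_set ?T" "L_mat 4 2 pairs4"] by auto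
  have "openin (top_of_set ?T) (?T \<inter> (\<lambda>f. plucker_discr (coeff_at f)) -` {..<0})"
    by (intro continuous_openin_preimage_gen continuous_on_plucker_discr open_lessThan)
  then have "?T \<inter> (\<lambda>f. plucker_discr (coeff_at f)) -` {..<0} \<subseteq> top_of_set ?T interior_of L_mat 4 2 pairs4"
    by (rule interior_of_maximal[rotated]) (use T in \<open>auto simp: L_mat_uniform_iff\<close>)
  then have "plucker_discr (coeff_at f) = 0" using int fT D by force
  then show "f \<in> {f \<in> L_mat 4 2 pairs4. plucker_discr (coeff_at f) = 0}"
    using T[OF fT] by (simp add: L_mat_uniform_iff)
next
  fix f assume "f \<in> {f \<in> L_mat 4 2 pairs4. plucker_discr (coeff_at f) = 0}"
  then have f: "f \<in> multiaffine_forms 2 4" "\<And>S. S \<in> pairs4 \<Longrightarrow> coeff_at f S > 0" "plucker_discr (coeff_at f) = 0"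
    by (auto simp: L_mat_uniform_iff)
  have nn: "nonneg_form f" using f(2) by (simp add: nonneg_form_def less_imp_le)
  obtain k where k: "plucker_form (root_vector k (coeff_at f)) = 0"
    using root_vector_plucker[of "coeff_at f"] f(2,3) less_imp_le by blast
  let ?p = "root_vector k (coeff_at f)"
  have "?p S \<noteq> 0" if "S \<in> pairs4" for S
    using f(2)[OF that] that by (simp add: root_vector_def root_sign_def)
  then have "?p \<in> realizations 2 4 pairs4"
    unfolding realizations_uniform_iff minor_vectors_2_4_iff using k by (simp add: root_vector_zero_outside)
  then have "sq_abs_poly pairs4 ?p \<in> boundary_L_mat 4 2 pairs4"
    by (intro sq_abs_poly_boundary_real matroid_bases_uniform uniform_minor_self) simp_all
  then show "f \<in> boundary_L_mat 4 2 pairs4"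
    by (simp add: sq_abs_poly_uniform square_form_root_vector[OF f(1) nn])
qed

lemma quotient_map_orbit_space:
  "quotient_map (top_of_set S) (orbit_space S G act) (orbit_of G act)"
  unfolding orbit_space_def by (rule quotient_map_quotient_topology)

section \<open>The reduced boundary and the realization space\<close>

text \<open>Rescaling multiplies each product of complementary coefficients by
  \<open>c 0 * c 1 * c 2 * c 3\<close>, so the discriminant only changes by a positive factor. The
  boundary is therefore saturated, as restricting the quotient map requires.\<close>

lemma L_class_uniform_discr:
  assumes f: "f \<in> L_mat 4 2 pairs4" and g: "g \<in> boundary_L_mat 4 2 pairs4" and eq: "L_class 4 f = L_class 4 g"
  shows "f \<in> boundary_L_mat 4 2 pairs4"
proof -
  have ff: "f \<in> multiaffine_forms 2 4" using f by (simp add: L_mat_uniform_iff)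
  have gg: "g \<in> multiaffine_forms 2 4" "plucker_discr (coeff_at g) = 0"
    using g unfolding boundary_L_mat_uniform by (auto simp: L_mat_uniform_iff)
  obtain c where c: "\<forall>i<4. c i > 0" "\<forall>S\<in>pairs4. coeff_at g S = coeff_at f S * (\<Prod>i\<in>S. c i)"
    using eq unfolding L_class_eq_iff[OF ff gg(1)] by blast
  define u where "u = c 0 * c 1 * c 2 * c 3"
  have "plucker_discr (coeff_at g) = u\<^sup>2 * plucker_discr (coeff_at f)"
    using c(2) by (simp add: u_def plucker_discr_def Let_def ksubsets_4_2 power2_eq_square algebra_simps)
  moreover have "u > 0" using c(1) by (simp add: u_def)
  ultimately have "plucker_discr (coeff_at f) = 0" using gg(2) by simp
  then show ?thesis unfolding boundary_L_mat_uniform using f by simp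
qed

lemma quotient_map_onto_boundary_reduced:
  "quotient_map (top_of_set (boundary_L_mat 4 2 pairs4))
     (subtopology (reduced_L_mat 4 2 pairs4) (boundary_reduced_L_mat 4 2 pairs4)) (L_class 4)"
proof -
  let ?L = "L_mat 4 2 pairs4" and ?B = "boundary_L_mat 4 2 pairs4"
  have quo: "quotient_map (top_of_set ?L) (reduced_L_mat 4 2 pairs4) (L_class 4)"
    unfolding reduced_L_mat_def L_class_def by (rule quotient_map_orbit_space)
  have BL: "?B \<subseteq> ?L" unfolding boundary_L_mat_uniform by blast
  have sat: "{f \<in> topspace (top_of_set ?L). L_class 4 f \<in> boundary_reduced_L_mat 4 2 pairs4} = ?B"
    unfolding boundary_reduced_L_mat_def using BL L_class_uniform_discr by auto
  have "closedin (top_of_set ?L) ?B"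
    unfolding boundary_L_mat_uniform
    by (intro continuous_closedin_preimage_constant continuous_on_plucker_discr)
  moreover have sub: "boundary_reduced_L_mat 4 2 pairs4 \<subseteq> topspace (reduced_L_mat 4 2 pairs4)"
    unfolding boundary_reduced_L_mat_def using quotient_imp_surjective_map[OF quo] BL by auto
  ultimately have "closedin (reduced_L_mat 4 2 pairs4) (boundary_reduced_L_mat 4 2 pairs4)"
    using quo[unfolded quotient_map_closedin, THEN conjunct2, rule_format, OF sub] unfolding sat by blast
  then have "quotient_map (subtopology (top_of_set ?L) ?B)
      (subtopology (reduced_L_mat 4 2 pairs4) (boundary_reduced_L_mat 4 2 pairs4)) (L_class 4)"
    using quotient_map_restriction[OF quo sat] by blast
  moreover have "subtopology (top_of_set ?L) ?B = top_of_set ?B"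
    using BL by (simp add: subtopology_subtopology Int_absorb1)
  ultimately show ?thesis by simp
qed

lemma root_vector_closed_cover:
  assumes "\<And>f. f \<in> X \<Longrightarrow> plucker_discr (coeff_at f) = 0"
    and "\<And>f. f \<in> X \<Longrightarrow> (\<forall>S\<in>pairs4. coeff_at f S \<ge> 0) \<or> (\<forall>S\<in>pairs4. coeff_at f S \<le> 0)"
  shows "X \<subseteq> (\<Union>k\<in>{..<3}. {f \<in> X. plucker_form (root_vector k (coeff_at f)) = 0})"
proof
  fix f assume f: "f \<in> X"
  let ?c = "\<lambda>S. \<bar>coeff_at f S\<bar>"
  have "plucker_discr ?c = plucker_discr (coeff_at f)"
    using assms(2)[OF f] by (auto simp: plucker_discr_def Let_def ksubsets_4_2)
  then obtain k where k: "k < 3" "plucker_form (root_vector k ?c) = 0"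
    using root_vector_plucker[of ?c] assms(1)[OF f] by auto
  have "root_vector k ?c = root_vector k (coeff_at f)" by (rule ext) (simp add: root_vector_def)
  then show "f \<in> (\<Union>k\<in>{..<3}. {f \<in> X. plucker_form (root_vector k (coeff_at f)) = 0})"
    using k f by auto
qed

lemma quotient_map_square_form_reduced:
  "quotient_map (top_of_set (realizations 2 4 pairs4))
     (subtopology (reduced_L_mat 4 2 pairs4) (boundary_reduced_L_mat 4 2 pairs4))
     (\<lambda>p. L_class 4 (square_form p))"
proof (rule quotient_map_by_closed_sections[OF quotient_map_onto_boundary_reduced])
  let ?B = "boundary_L_mat 4 2 pairs4" and ?R = "realizations 2 4 pairs4 :: (nat set \<Rightarrow> real) set"
  let ?K = "\<lambda>k. {f \<in> ?B. plucker_form (root_vector k (coeff_at f)) = 0}"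
  let ?s = "\<lambda>k f. root_vector k (coeff_at f)"
  have B: "f \<in> multiaffine_forms 2 4 \<and> (\<forall>S\<in>pairs4. coeff_at f S > 0) \<and> plucker_discr (coeff_at f) = 0 \<and> nonneg_form f"
    if "f \<in> ?B" for f
    using that unfolding boundary_L_mat_uniform by (auto simp: L_mat_uniform_iff nonneg_form_def less_imp_le)
  have sR: "square_form p \<in> ?B" if "p \<in> ?R" for p
    using sq_abs_poly_boundary_real[OF matroid_bases_uniform that uniform_minor_self]
    by (simp add: sq_abs_poly_uniform)
  show "continuous_map (top_of_set ?R)
     (subtopology (reduced_L_mat 4 2 pairs4) (boundary_reduced_L_mat 4 2 pairs4)) (\<lambda>p. L_class 4 (square_form p))"
  proof -
    have "continuous_map (top_of_set ?R) (top_of_set ?B) square_form"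
      using sR by (simp add: continuous_on_square_form Pi_iff)
    from continuous_map_compose[OF this quotient_imp_continuous_map[OF quotient_map_onto_boundary_reduced]]
    show ?thesis by (simp add: o_def)
  qed
  show "finite {..<3::nat}" by simp
  show "closedin (top_of_set ?B) (?K k)" for k
    by (intro continuous_closedin_preimage_constant continuous_on_plucker_form_root_vector)
  show "topspace (top_of_set ?B) \<subseteq> (\<Union>k\<in>{..<3}. ?K k)"
    unfolding topspace_euclidean_subtopology
    by (rule root_vector_closed_cover) (use B in \<open>auto simp: less_imp_le\<close>)
  show "continuous_map (subtopology (top_of_set ?B) (?K k)) (top_of_set ?R) (?s k)" for k
  proof -
    have "?s k f \<in> ?R" if "f \<in> ?K k" for f
    proof -
      have "?s k f S \<noteq> 0" if "S \<in> pairs4" for S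
        using B[of f] \<open>f \<in> ?K k\<close> that by (simp add: root_vector_def root_sign_def) force
      then show ?thesis
        using that unfolding realizations_uniform_iff minor_vectors_2_4_iff by (simp add: root_vector_zero_outside)
    qed
    moreover have "subtopology (top_of_set ?B) (?K k) = top_of_set (?K k)"
      by (simp add: subtopology_subtopology) (metis (no_types, lifting) Int_absorb1 mem_Collect_eq subsetI)
    ultimately show ?thesis by (simp add: continuous_on_root_vector Pi_iff)
  qed
  show "L_class 4 (square_form (?s k f)) = L_class 4 f" if "f \<in> ?K k" for k f
    using B[of f] that by (simp add: square_form_root_vector)
qed

text \<open>A positive rescaling \<open>c\<close> is absorbed into the columns of \<open>p\<close>
  by \<open>sqrt (c i)\<close>, which leaves two Pluecker vectors with equal squares.\<close>

lemma reduced_class_eq_iff: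
  fixes p q :: "nat set \<Rightarrow> real"
  assumes p: "p \<in> minor_vectors 2 4" and q: "q \<in> minor_vectors 2 4"
  shows "L_class 4 (square_form p) = L_class 4 (square_form q) \<longleftrightarrow> realization_class 4 p = realization_class 4 q"
proof -
  have p0: "\<And>S. S \<notin> pairs4 \<Longrightarrow> p S = 0" and q0: "\<And>S. S \<notin> pairs4 \<Longrightarrow> q S = 0"
    using p q unfolding minor_vectors_2_4_iff by auto
  have L: "L_class 4 (square_form p) = L_class 4 (square_form q) \<longleftrightarrow>
      (\<exists>c. (\<forall>i<4. c i > 0) \<and> (\<forall>S\<in>pairs4. (q S)\<^sup>2 = (p S)\<^sup>2 * (\<Prod>i\<in>S. c i)))"
    unfolding L_class_eq_iff[OF square_form_in_forms square_form_in_forms] by (simp add: square_form_coeff)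
  have R: "realization_class 4 p = realization_class 4 q \<longleftrightarrow>
      (\<exists>c t. c \<noteq> 0 \<and> (\<forall>i<4. t i \<noteq> 0) \<and> q = scale_vector c (scale_columns t p))"
    by (rule realization_class_eq_iff[OF p0 q0])
  show ?thesis unfolding L R
  proof
    assume "\<exists>c. (\<forall>i<4. c i > 0) \<and> (\<forall>S\<in>pairs4. (q S)\<^sup>2 = (p S)\<^sup>2 * (\<Prod>i\<in>S. c i))"
    then obtain c where c: "\<forall>i<4. c i > 0" "\<And>S. S \<in> pairs4 \<Longrightarrow> (q S)\<^sup>2 = (p S)\<^sup>2 * (\<Prod>i\<in>S. c i)" by blast
    define p' where "p' = scale_columns (\<lambda>i. sqrt (c i)) p"
    have "plucker_form p' = sqrt (c 0) * sqrt (c 1) * sqrt (c 2) * sqrt (c 3) * plucker_form p"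
      by (simp add: plucker_form_def p'_def scale_columns_def algebra_simps)
    then have p': "p' \<in> minor_vectors 2 4"
      using p p0 unfolding minor_vectors_2_4_iff by (simp add: p'_def scale_columns_def)
    have sqeq: "(q S)\<^sup>2 = (p' S)\<^sup>2" if S: "S \<in> pairs4" for S
    proof -
      have "(\<Prod>i\<in>S. sqrt (c i))\<^sup>2 = (\<Prod>i\<in>S. c i)"
        unfolding prod_power_distrib
        by (rule prod.cong) (use c(1) S in \<open>auto simp: ksubsets_def less_imp_le\<close>)
      then show ?thesis using c(2)[OF S] by (simp add: p'_def scale_columns_def power_mult_distrib mult.commute)
    qed
    have "\<exists>s t. s \<in> {-1,1} \<and> (\<forall>i<4. t i \<in> {-1,1}) \<and> q = scale_vector s (scale_columns t p')"
      by (rule plucker_vectors_equal_squares[OF p' q]) (rule sqeq)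
    then obtain s t where st: "s \<in> {-1,1}" "\<forall>i<4. t i \<in> {-1,1}" "q = scale_vector s (scale_columns t p')"
      by (elim exE conjE)
    have "scale_columns t p' = scale_columns (\<lambda>i. t i * sqrt (c i)) p"
      by (simp add: p'_def scale_columns_def prod.distrib mult.assoc)
    then have "q = scale_vector s (scale_columns (\<lambda>i. t i * sqrt (c i)) p)" using st(3) by simp
    moreover have "s \<noteq> 0" using st(1) by auto
    moreover have "\<forall>i<4. t i * sqrt (c i) \<noteq> 0"
    proof (intro allI impI)
      fix i :: nat assume i: "i < 4"
      then have "t i = -1 \<or> t i = 1" using st(2) by simp
      moreover have "c i > 0" using c(1) i by simp
      ultimately show "t i * sqrt (c i) \<noteq> 0" by auto
    qed
    ultimately have "s \<noteq> 0 \<and> (\<forall>i<4. t i * sqrt (c i) \<noteq> 0) \<and>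
        q = scale_vector s (scale_columns (\<lambda>i. t i * sqrt (c i)) p)" by simp
    then show "\<exists>c t. c \<noteq> 0 \<and> (\<forall>i<4. t i \<noteq> 0) \<and> q = scale_vector c (scale_columns t p)"
      by (rule exI[THEN exI[where P = "\<lambda>c. \<exists>t. c \<noteq> 0 \<and> (\<forall>i<4. t i \<noteq> 0) \<and> q = scale_vector c (scale_columns t p)"]])
  next
    assume "\<exists>c t. c \<noteq> 0 \<and> (\<forall>i<4. t i \<noteq> 0) \<and> q = scale_vector c (scale_columns t p)"
    then obtain c t where ct: "c \<noteq> 0" "\<forall>i<4. t i \<noteq> 0" "q = scale_vector c (scale_columns t p)"
      by (elim exE conjE)
    \<comment> \<open>Distributing the scalar over the columns: \<open>S\<close> has two elements,
      so a factor \<open>\<bar>c\<bar>\<close> per column produces the required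
      \<open>c\<^sup>2\<close>.\<close>
    have "(q S)\<^sup>2 = (p S)\<^sup>2 * (\<Prod>i\<in>S. \<bar>c\<bar> * (t i)\<^sup>2)" if S: "S \<in> pairs4" for S
    proof -
      have "card S = 2" using S by (simp add: ksubsets_def)
      then have "(\<Prod>i\<in>S. \<bar>c\<bar> * (t i)\<^sup>2) = c\<^sup>2 * (\<Prod>i\<in>S. t i)\<^sup>2"
        by (simp add: prod.distrib prod_power_distrib)
      then show ?thesis by (simp add: ct(3) scale_vector_def scale_columns_def power_mult_distrib)
    qed
    moreover have "\<forall>i<4. \<bar>c\<bar> * (t i)\<^sup>2 > 0" using ct(1,2) by simp
    ultimately show "\<exists>c. (\<forall>i<4. c i > 0) \<and> (\<forall>S\<in>pairs4. (q S)\<^sup>2 = (p S)\<^sup>2 * (\<Prod>i\<in>S. c i))"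
      by (intro exI[of _ "\<lambda>i. \<bar>c\<bar> * (t i)\<^sup>2"] conjI ballI)
  qed
qed

text \<open>Both spaces are quotients of the set of realizations with the same fibres, so the
  induced bijection is a quotient map and hence a homeomorphism.\<close>

lemma realization_space_homeomorphism:
  "\<exists>\<phi>. (\<forall>p \<in> realizations 2 4 pairs4 :: (nat set \<Rightarrow> real) set.
          \<phi> (realization_class 4 p) = L_class 4 (sq_abs_poly pairs4 p)) \<and>
       homeomorphic_map (realization_space 2 4 pairs4 :: (nat set \<Rightarrow> real) set topology)
         (subtopology (reduced_L_mat 4 2 pairs4) (boundary_reduced_L_mat 4 2 pairs4)) \<phi>"
proof -
  let ?R = "realizations 2 4 pairs4 :: (nat set \<Rightarrow> real) set"
  let ?X = "realization_space 2 4 pairs4 :: (nat set \<Rightarrow> real) set topology"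
  let ?Y = "subtopology (reduced_L_mat 4 2 pairs4) (boundary_reduced_L_mat 4 2 pairs4)"
  let ?g = "\<lambda>p. L_class 4 (square_form p)"
  have R: "p \<in> minor_vectors 2 4" if "p \<in> ?R" for p using that by (simp add: realizations_uniform_iff)
  have quo: "quotient_map (top_of_set ?R) ?X (realization_class 4)"
    unfolding realization_space_def realization_class_def by (rule quotient_map_orbit_space)
  have eq: "?g p = ?g q \<longleftrightarrow> realization_class 4 p = realization_class 4 q" if "p \<in> ?R" "q \<in> ?R" for p q
    by (rule reduced_class_eq_iff[OF R[OF that(1)] R[OF that(2)]])
  obtain \<phi> where \<phi>: "continuous_map ?X ?Y \<phi>" "\<And>p. p \<in> ?R \<Longrightarrow> \<phi> (realization_class 4 p) = ?g p"
    using quotient_map_lift_exists[OF quo quotient_imp_continuous_map[OF quotient_map_square_form_reduced]] eq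
    by (metis (no_types, lifting) topspace_euclidean_subtopology)
  have "quotient_map (top_of_set ?R) ?Y (\<phi> \<circ> realization_class 4)"
    by (rule quotient_map_eq[OF quotient_map_square_form_reduced]) (simp add: \<phi>(2))
  then have "quotient_map ?X ?Y \<phi>"
    by (rule quotient_map_from_composition[OF quotient_imp_continuous_map[OF quo] \<phi>(1)])
  moreover have "inj_on \<phi> (topspace ?X)"
  proof (rule inj_onI)
    fix x y assume xy: "x \<in> topspace ?X" "y \<in> topspace ?X" "\<phi> x = \<phi> y"
    have "topspace ?X = realization_class 4 ` ?R" using quotient_imp_surjective_map[OF quo] by simp
    then obtain p q where "p \<in> ?R" "x = realization_class 4 p" "q \<in> ?R" "y = realization_class 4 q"
      using xy by auto
    then show "x = y" using xy(3) \<phi>(2) eq by simp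
  qed
  ultimately have "homeomorphic_map ?X ?Y \<phi>" unfolding homeomorphic_map_def by blast
  then show ?thesis using \<phi>(2) by (intro exI[of _ \<phi>]) (simp add: sq_abs_poly_uniform)
qed

section \<open>The projective space of multiaffine quadrics\<close>

lemma scaleR_coeff_at: "coeff_at (c *\<^sub>R f) S = c * coeff_at f S"
  by (simp add: coeff_at_def lookup_scaleR)

lemma scaleR_in_forms: "f \<in> multiaffine_forms d n \<Longrightarrow> c *\<^sub>R f \<in> multiaffine_forms d n"
  by (auto simp: multiaffine_forms_def in_keys_iff lookup_scaleR)

lemma plucker_discr_scaleR: "plucker_discr (coeff_at (c *\<^sub>R f)) = c^4 * plucker_discr (coeff_at f)"
  by (simp add: plucker_discr_def Let_def scaleR_coeff_at power2_eq_square power4_eq_xxxx algebra_simps)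

text \<open>Nonnegativity up to a global sign, the version that descends to projective
  classes.\<close>

definition signed_form :: "real_mpoly \<Rightarrow> bool" where
  "signed_form f \<longleftrightarrow> nonneg_form f \<or> nonneg_form (- f)"

lemma coeff_at_uminus: "coeff_at (- f) S = - coeff_at f S"
  by (simp add: coeff_at_def)

lemma nonzero_form_coeff:
  assumes "f \<in> multiaffine_forms 2 4" "f \<noteq> 0"
  shows "\<exists>S\<in>pairs4. coeff_at f S \<noteq> 0"
proof (rule ccontr)
  assume "\<not> ?thesis"
  then have "f = 0"
    by (intro multiaffine_forms_eqI[OF assms(1)]) (auto simp: multiaffine_forms_def coeff_at_def)
  then show False using assms(2) by simp
qed

lemma poly_class_in_PL_box_iff:
  assumes f: "f \<in> multiaffine_forms 2 4" "f \<noteq> 0"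
  shows "poly_class f \<in> PL_box 2 4 \<longleftrightarrow> signed_form f \<and> plucker_discr (coeff_at f) \<le> 0"
proof
  assume "poly_class f \<in> PL_box 2 4"
  then obtain g where g: "g \<in> multiaffine_forms 2 4" "lorentzian 4 2 g" "poly_class g = poly_class f"
    unfolding PL_box_def by auto
  then obtain c where c: "c \<noteq> 0" "f = c *\<^sub>R g" using poly_class_eq_iff[of g f] by auto
  have g': "nonneg_form g" "plucker_discr (coeff_at g) \<le> 0"
    using g(2) unfolding lorentzian_2_4_iff[OF g(1)] nonneg_form_def by auto
  have "signed_form f"
    using g'(1) c by (cases "c > 0")
      (auto simp: signed_form_def nonneg_form_def scaleR_coeff_at coeff_at_uminus mult_nonpos_nonneg)
  moreover have "plucker_discr (coeff_at f) \<le> 0"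
    unfolding c(2) plucker_discr_scaleR using g'(2) by (simp add: mult_nonneg_nonpos)
  ultimately show "signed_form f \<and> plucker_discr (coeff_at f) \<le> 0" by simp
next
  assume *: "signed_form f \<and> plucker_discr (coeff_at f) \<le> 0"
  have pos: "poly_class g \<in> PL_box 2 4"
    if "g \<in> multiaffine_forms 2 4" "g \<noteq> 0" "nonneg_form g" "plucker_discr (coeff_at g) \<le> 0" for g
    using that lorentzian_2_4_iff[OF that(1)] unfolding PL_box_def nonneg_form_def by blast
  have minus: "- f = (- 1) *\<^sub>R f" by simp
  have "poly_class f = poly_class (- f)" unfolding poly_class_eq_iff minus by (intro exI[of _ "- 1"]) simp
  moreover have "- f \<in> multiaffine_forms 2 4" unfolding minus by (rule scaleR_in_forms[OF f(1)])
  moreover have "plucker_discr (coeff_at (- f)) = plucker_discr (coeff_at f)"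
    unfolding minus plucker_discr_scaleR by simp
  ultimately show "poly_class f \<in> PL_box 2 4"
    using * pos[of f] pos[of "- f"] f unfolding signed_form_def by auto
qed

lemma quotient_map_poly_class:
  "quotient_map (top_of_set (multiaffine_forms 2 4 - {0})) (multiaffine_projective_space 2 4) poly_class"
  unfolding multiaffine_projective_space_def poly_class_def by (rule quotient_map_orbit_space)

lemma closed_signed_forms: "closedin (top_of_set X) {f \<in> X. signed_form f}"
proof -
  have nn: "closedin (top_of_set X) {f \<in> X. \<forall>S\<in>pairs4. s * coeff_at f S \<ge> 0}" for s
  proof -
    have "closedin (top_of_set X) (X \<inter> (\<lambda>f. s * coeff_at f S) -` {0..})" for S
      by (intro continuous_closedin_preimage continuous_intros continuous_on_coeff_at closed_atLeast)
    moreover have "{f \<in> X. \<forall>S\<in>pairs4. s * coeff_at f S \<ge> 0} = (\<Inter>S\<in>pairs4. X \<inter> (\<lambda>f. s * coeff_at f S) -` {0..})"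
      by (auto simp: ksubsets_4_2)
    moreover have "pairs4 \<noteq> {}" by (simp add: ksubsets_4_2)
    ultimately show ?thesis by (simp only:) (intro closedin_INT, auto)
  qed
  have "{f \<in> X. signed_form f} = {f \<in> X. \<forall>S\<in>pairs4. 1 * coeff_at f S \<ge> 0} \<union> {f \<in> X. \<forall>S\<in>pairs4. (- 1) * coeff_at f S \<ge> 0}"
    by (auto simp: signed_form_def nonneg_form_def coeff_at_uminus)
  then show ?thesis using closedin_Un[OF nn[of 1] nn[of "- 1"]] by simp
qed

text \<open>Perturbing one coefficient: a zero coefficient is made negative; otherwise one pair product is at least
  the sum of the other two, and increasing it makes the discriminant positive.\<close>

lemma exit_direction:
  assumes f: "f \<in> multiaffine_forms 2 4" "f \<noteq> 0" and nn: "nonneg_form f" and D: "plucker_discr (coeff_at f) = 0"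
  shows "\<exists>h :: real \<Rightarrow> real_mpoly. continuous_on UNIV h \<and> h 0 = f \<and>
    (\<forall>\<epsilon>>0. h \<epsilon> \<in> multiaffine_forms 2 4 - {0} \<and> \<not> (signed_form (h \<epsilon>) \<and> plucker_discr (coeff_at (h \<epsilon>)) \<le> 0))"
proof -
  let ?c = "coeff_at f"
  have c0: "?c S \<ge> 0" if "S \<in> pairs4" for S using nn that by (simp add: nonneg_form_def)
  obtain R where R: "R \<in> pairs4" "?c R > 0" using nonzero_form_coeff[OF f] c0 by (auto simp: less_le)
  define h where "h S u = multiaffine_poly pairs4 (\<lambda>S'. if S' = S then u else ?c S')" for S u
  have hc: "coeff_at (h S u) S' = (if S' = S then u else ?c S')" if "S' \<in> pairs4" for S S' u
    unfolding h_def by (rule coeff_at_multiaffine_poly_ksubsets[OF that])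
  have hf: "h S u \<in> multiaffine_forms 2 4" for S u unfolding h_def by (rule multiaffine_forms_multiaffine_poly)
  have h0: "h S (?c S) = f" for S by (rule multiaffine_forms_eqI[OF hf f(1)]) (simp add: hc)
  have hcont: "continuous_on UNIV (\<lambda>\<epsilon>. h S (g \<epsilon>))" if "continuous_on UNIV g" for S and g :: "real \<Rightarrow> real"
    unfolding h_def
  proof (rule continuous_on_multiaffine_poly)
    fix S' show "continuous_on UNIV (\<lambda>\<epsilon>. if S' = S then g \<epsilon> else ?c S')" using that by (cases "S' = S") auto
  qed
  have hne: "h S u \<noteq> 0" if "S \<in> pairs4" "u \<noteq> 0" for S u
    using hc[OF that(1), of S u] that(2) by (auto simp: coeff_at_def)
  show ?thesis
  proof (cases "\<exists>S\<in>pairs4. ?c S = 0")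
    case True
    then obtain S where S: "S \<in> pairs4" "?c S = 0" by blast
    have RS: "R \<noteq> S" using R S by auto
    show ?thesis
    proof (intro exI[of _ "\<lambda>\<epsilon>. h S (- \<epsilon>)"] conjI allI impI)
      show "continuous_on UNIV (\<lambda>\<epsilon>. h S (- \<epsilon>))" by (intro hcont continuous_intros)
      show "h S (- 0) = f" using h0[of S] S by simp
      fix \<epsilon> :: real assume \<epsilon>: "\<epsilon> > 0"
      show "h S (- \<epsilon>) \<in> multiaffine_forms 2 4 - {0}" using hf hne[OF S(1)] \<epsilon> by simp
      have "coeff_at (h S (- \<epsilon>)) S < 0" "coeff_at (h S (- \<epsilon>)) R > 0"
        using hc[OF S(1), of S] hc[OF R(1), of S] RS R \<epsilon> by simp_all
      then have "\<not> signed_form (h S (- \<epsilon>))"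
        using S(1) R(1) unfolding signed_form_def nonneg_form_def coeff_at_uminus by force
      then show "\<not> (signed_form (h S (- \<epsilon>)) \<and> plucker_discr (coeff_at (h S (- \<epsilon>))) \<le> 0)" by simp
    qed
  next
    case False
    then have cpos: "?c S > 0" if "S \<in> pairs4" for S using c0[OF that] that by (auto simp: less_le)
    have cp: "?c {0,1} > 0" "?c {0,2} > 0" "?c {0,3} > 0" "?c {1,2} > 0" "?c {1,3} > 0" "?c {2,3} > 0"
      by (intro cpos, simp add: ksubsets_4_2)+
    define A B C where "A = ?c {0,1} * ?c {2,3}" and "B = ?c {0,2} * ?c {1,3}" and "C = ?c {0,3} * ?c {1,2}"
    have ABC: "A > 0" "B > 0" "C > 0" using cp by (simp_all add: A_def B_def C_def)
    have Dabc: "A\<^sup>2 + B\<^sup>2 + C\<^sup>2 - 2*A*B - 2*A*C - 2*B*C = 0"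
      using D unfolding plucker_discr_def Let_def A_def B_def C_def .
    have grow: "(x * (1 + \<epsilon>))\<^sup>2 + y\<^sup>2 + z\<^sup>2 - 2*(x * (1 + \<epsilon>))*y - 2*(x * (1 + \<epsilon>))*z - 2*y*z > 0"
      if "x > 0" "x \<ge> y + z" "x\<^sup>2 + y\<^sup>2 + z\<^sup>2 - 2*x*y - 2*x*z - 2*y*z = 0" "\<epsilon> > 0" for x y z \<epsilon> :: real
    proof -
      have "(x * (1 + \<epsilon>))\<^sup>2 + y\<^sup>2 + z\<^sup>2 - 2*(x * (1 + \<epsilon>))*y - 2*(x * (1 + \<epsilon>))*z - 2*y*z =
          (x\<^sup>2 + y\<^sup>2 + z\<^sup>2 - 2*x*y - 2*x*z - 2*y*z) + 2 * \<epsilon> * x * (x - (y + z)) + (\<epsilon> * x)\<^sup>2"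
        by (simp add: power2_eq_square algebra_simps)
      moreover have "2 * \<epsilon> * x * (x - (y + z)) \<ge> 0" using that by simp
      moreover have "(\<epsilon> * x)\<^sup>2 > 0" using that by simp
      ultimately show ?thesis using that(3) by linarith
    qed
    \<comment> \<open>The discriminant equals
      \<open>A * (A - B - C) + B * (B - A - C) + C * (C - A - B)\<close>; if all three brackets were
      negative it could not vanish.\<close>
    have "A \<ge> B + C \<or> B \<ge> A + C \<or> C \<ge> A + B"
    proof (rule ccontr)
      assume "\<not> ?thesis"
      then have "A * (A - B - C) < 0" "B * (B - A - C) < 0" "C * (C - A - B) < 0"
        using ABC by (simp_all add: mult_pos_neg)
      moreover have "A\<^sup>2 + B\<^sup>2 + C\<^sup>2 - 2*A*B - 2*A*C - 2*B*C = A * (A - B - C) + B * (B - A - C) + C * (C - A - B)"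
        by (simp add: power2_eq_square algebra_simps)
      ultimately show False using Dabc by linarith
    qed
    then have "\<exists>S\<in>pairs4. \<forall>\<epsilon>>0. plucker_discr (coeff_at (h S (?c S * (1 + \<epsilon>)))) > 0"
    proof (elim disjE)
      assume le: "A \<ge> B + C"
      have S: "{0,1} \<in> pairs4" by (simp add: ksubsets_4_2)
      have "plucker_discr (coeff_at (h {0,1} (?c {0,1} * (1 + \<epsilon>)))) =
        (A * (1 + \<epsilon>))\<^sup>2 + B\<^sup>2 + C\<^sup>2 - 2*(A * (1 + \<epsilon>))*B - 2*(A * (1 + \<epsilon>))*C - 2*B*C" for \<epsilon>
        unfolding plucker_discr_def Let_def A_def B_def C_def
        by (simp add: hc ksubsets_4_2 doubleton_eq_iff ac_simps)
      then show ?thesis using grow[OF ABC(1) le Dabc] S by (intro bexI[of _ "{0,1}"]) simp_all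
    next
      assume le: "B \<ge> A + C"
      have S: "{0,2} \<in> pairs4" by (simp add: ksubsets_4_2)
      have "plucker_discr (coeff_at (h {0,2} (?c {0,2} * (1 + \<epsilon>)))) =
        (B * (1 + \<epsilon>))\<^sup>2 + A\<^sup>2 + C\<^sup>2 - 2*(B * (1 + \<epsilon>))*A - 2*(B * (1 + \<epsilon>))*C - 2*A*C" for \<epsilon>
        unfolding plucker_discr_def Let_def A_def B_def C_def
        by (simp add: hc ksubsets_4_2 doubleton_eq_iff ac_simps)
      moreover have "B\<^sup>2 + A\<^sup>2 + C\<^sup>2 - 2*B*A - 2*B*C - 2*A*C = 0" using Dabc by (simp add: ac_simps)
      ultimately show ?thesis using grow[OF ABC(2) le] S by (intro bexI[of _ "{0,2}"]) simp_all
    next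
      assume le: "C \<ge> A + B"
      have S: "{0,3} \<in> pairs4" by (simp add: ksubsets_4_2)
      have "plucker_discr (coeff_at (h {0,3} (?c {0,3} * (1 + \<epsilon>)))) =
        (C * (1 + \<epsilon>))\<^sup>2 + A\<^sup>2 + B\<^sup>2 - 2*(C * (1 + \<epsilon>))*A - 2*(C * (1 + \<epsilon>))*B - 2*A*B" for \<epsilon>
        unfolding plucker_discr_def Let_def A_def B_def C_def
        by (simp add: hc ksubsets_4_2 doubleton_eq_iff ac_simps)
      moreover have "C\<^sup>2 + A\<^sup>2 + B\<^sup>2 - 2*C*A - 2*C*B - 2*A*B = 0" using Dabc by (simp add: ac_simps)
      ultimately show ?thesis using grow[OF ABC(3) le] S by (intro bexI[of _ "{0,3}"]) simp_all
    qed
    then obtain S where S: "S \<in> pairs4" "\<And>\<epsilon>. \<epsilon> > 0 \<Longrightarrow> plucker_discr (coeff_at (h S (?c S * (1 + \<epsilon>)))) > 0"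
      by blast
    show ?thesis
    proof (intro exI[of _ "\<lambda>\<epsilon>. h S (?c S * (1 + \<epsilon>))"] conjI allI impI)
      show "continuous_on UNIV (\<lambda>\<epsilon>. h S (?c S * (1 + \<epsilon>)))" by (intro hcont continuous_intros)
      show "h S (?c S * (1 + 0)) = f" using h0[of S] by simp
      fix \<epsilon> :: real assume \<epsilon>: "\<epsilon> > 0"
      have "?c S * (1 + \<epsilon>) \<noteq> 0" using cpos[OF S(1)] \<epsilon> by simp
      then show "h S (?c S * (1 + \<epsilon>)) \<in> multiaffine_forms 2 4 - {0}" using hf hne[OF S(1)] by simp
      show "\<not> (signed_form (h S (?c S * (1 + \<epsilon>))) \<and> plucker_discr (coeff_at (h S (?c S * (1 + \<epsilon>)))) \<le> 0)"
        using S(2)[OF \<epsilon>] by simp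
    qed
  qed
qed

text \<open>\<open>PL_box\<close> is closed, so its boundary is what remains after removing the
  interior. Classes with negative discriminant form an open set inside \<open>PL_box\<close>, and
  from every class with discriminant 0 the curve of \<open>exit_direction\<close> leaves
  \<open>PL_box\<close> immediately.\<close>

lemma poly_class_in_boundary_iff:
  assumes f: "f \<in> multiaffine_forms 2 4" "f \<noteq> 0"
  shows "poly_class f \<in> boundary_PL_box 2 4 \<longleftrightarrow> signed_form f \<and> plucker_discr (coeff_at f) = 0"
proof -
  let ?F = "multiaffine_forms 2 4 - {0}" and ?P = "multiaffine_projective_space 2 4"
  note quo = quotient_map_poly_class
  have top: "poly_class ` ?F = topspace ?P" using quotient_imp_surjective_map[OF quo] by simp
  have PLsub: "PL_box 2 4 \<subseteq> topspace ?P"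
    unfolding PL_box_def top[symmetric] by (intro image_mono) (auto simp: lorentzian_def)
  have preim: "{g \<in> ?F. poly_class g \<in> PL_box 2 4} = {g \<in> ?F. signed_form g} \<inter> (?F \<inter> (\<lambda>g. plucker_discr (coeff_at g)) -` {..0})"
    using poly_class_in_PL_box_iff by auto
  have "closedin (top_of_set ?F) {g \<in> ?F. poly_class g \<in> PL_box 2 4}"
    unfolding preim
    by (intro closedin_Int closed_signed_forms continuous_closedin_preimage continuous_on_plucker_discr closed_atMost)
  then have closed: "closedin ?P (PL_box 2 4)"
    using quo[unfolded quotient_map_closedin, THEN conjunct2, rule_format, OF PLsub]
    unfolding topspace_euclidean_subtopology by blast
  have fP: "poly_class f \<in> topspace ?P" using f top by blast
  have bd: "boundary_PL_box 2 4 = PL_box 2 4 - ?P interior_of PL_box 2 4"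
    unfolding boundary_PL_box_def frontier_of_def closure_of_closedin[OF closed] ..
  define Op where "Op = {g \<in> ?F. signed_form g \<and> plucker_discr (coeff_at g) < 0}"
  define pos where "pos s = {g \<in> ?F. \<forall>S\<in>pairs4. s * coeff_at g S > 0}" for s
  \<comment> \<open>A negative discriminant excludes zero coefficients, so the closed sign condition
    may be replaced by a strict, hence open, one.\<close>
  have Op_eq: "Op = (?F \<inter> (\<lambda>g. plucker_discr (coeff_at g)) -` {..<0}) \<inter> (pos 1 \<union> pos (- 1))"
  proof (intro equalityI subsetI)
    fix g assume g: "g \<in> Op"
    have ne: "coeff_at g S \<noteq> 0" if "S \<in> pairs4" for S
      using g plucker_discr_nonneg_if_zero[OF that] unfolding Op_def by force
    have "(\<forall>S\<in>pairs4. coeff_at g S > 0) \<or> (\<forall>S\<in>pairs4. coeff_at g S < 0)"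
      using g ne unfolding Op_def signed_form_def nonneg_form_def coeff_at_uminus by (auto simp: less_le)
    then show "g \<in> (?F \<inter> (\<lambda>g. plucker_discr (coeff_at g)) -` {..<0}) \<inter> (pos 1 \<union> pos (- 1))"
      using g unfolding Op_def pos_def by auto
  next
    fix g assume "g \<in> (?F \<inter> (\<lambda>g. plucker_discr (coeff_at g)) -` {..<0}) \<inter> (pos 1 \<union> pos (- 1))"
    then have g: "g \<in> ?F" "plucker_discr (coeff_at g) < 0"
      "(\<forall>S\<in>pairs4. coeff_at g S > 0) \<or> (\<forall>S\<in>pairs4. coeff_at g S < 0)" unfolding pos_def by auto
    have "signed_form g"
      using g(3) unfolding signed_form_def nonneg_form_def coeff_at_uminus by (auto simp: less_imp_le)
    then show "g \<in> Op" using g by (simp add: Op_def)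
  qed
  have openOp: "openin (top_of_set ?F) Op"
  proof -
    have pos_open: "openin (top_of_set ?F) (pos s)" for s
    proof -
      have "openin (top_of_set ?F) (?F \<inter> (\<lambda>g. s * coeff_at g S) -` {0<..})" for S
        by (intro continuous_openin_preimage_gen continuous_intros continuous_on_coeff_at open_greaterThan)
      moreover have "pos s = (\<Inter>S\<in>pairs4. ?F \<inter> (\<lambda>g. s * coeff_at g S) -` {0<..})"
        by (auto simp: pos_def ksubsets_4_2)
      moreover have "pairs4 \<noteq> {}" by (simp add: ksubsets_4_2)
      ultimately show ?thesis by (simp only:) (intro openin_Inter, auto simp: finite_ksubsets)
    qed
    show ?thesis unfolding Op_eq
      by (intro openin_Int openin_Un pos_open continuous_openin_preimage_gen continuous_on_plucker_discr open_lessThan)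
  qed
  \<comment> \<open>Saturation is what carries openness through the quotient to the projective
    space.\<close>
  have Op_sat: "{g \<in> topspace (top_of_set ?F). poly_class g \<in> poly_class ` Op} = Op"
  proof (intro equalityI subsetI)
    fix g assume g: "g \<in> {g \<in> topspace (top_of_set ?F). poly_class g \<in> poly_class ` Op}"
    then obtain h where h: "h \<in> Op" "poly_class h = poly_class g" by auto
    then obtain c where c: "c \<noteq> 0" "g = c *\<^sub>R h" using poly_class_eq_iff[of h g] by auto
    have "h \<in> ?F" "signed_form h" "plucker_discr (coeff_at h) < 0" using h by (auto simp: Op_def)
    moreover have "signed_form g"
      using \<open>signed_form h\<close> c by (cases "c > 0")
        (auto simp: signed_form_def nonneg_form_def scaleR_coeff_at coeff_at_uminus mult_nonpos_nonneg mult_nonneg_nonpos mult_nonpos_nonpos)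
    moreover have "plucker_discr (coeff_at g) < 0"
      unfolding c(2) plucker_discr_scaleR using h c(1) by (simp add: Op_def mult_pos_neg)
    ultimately show "g \<in> Op" using g by (simp add: Op_def)
  qed (auto simp: Op_def)
  have "poly_class ` Op \<subseteq> topspace ?P" unfolding top[symmetric] by (auto simp: Op_def)
  then have "openin ?P (poly_class ` Op)"
    using quo[unfolded quotient_map_def, THEN conjunct2, rule_format, of "poly_class ` Op"] openOp
    unfolding Op_sat by blast
  moreover have "poly_class ` Op \<subseteq> PL_box 2 4"
    using poly_class_in_PL_box_iff by (auto simp: Op_def)
  ultimately have int: "poly_class ` Op \<subseteq> ?P interior_of PL_box 2 4" by (rule interior_of_maximal[rotated])
  show ?thesis
  proof
    assume "poly_class f \<in> boundary_PL_box 2 4"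
    then have b: "poly_class f \<in> PL_box 2 4" "poly_class f \<notin> ?P interior_of PL_box 2 4" unfolding bd by auto
    then have s: "signed_form f" "plucker_discr (coeff_at f) \<le> 0" using poly_class_in_PL_box_iff[OF f] by auto
    moreover have "f \<notin> Op" using b(2) int by blast
    ultimately show "signed_form f \<and> plucker_discr (coeff_at f) = 0" using f unfolding Op_def by auto
  next
    assume s: "signed_form f \<and> plucker_discr (coeff_at f) = 0"
    then have PL: "poly_class f \<in> PL_box 2 4" using poly_class_in_PL_box_iff[OF f] by simp
    have not_int: "poly_class g \<notin> ?P interior_of PL_box 2 4"
      if g: "g \<in> multiaffine_forms 2 4" "g \<noteq> 0" "nonneg_form g" "plucker_discr (coeff_at g) = 0" for g
    proof
      assume "poly_class g \<in> ?P interior_of PL_box 2 4"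
      then obtain U where U: "openin ?P U" "poly_class g \<in> U" "U \<subseteq> PL_box 2 4" unfolding interior_of_def by blast
      have "openin (top_of_set ?F) {x \<in> topspace (top_of_set ?F). poly_class x \<in> U}"
        using openin_continuous_map_preimage[OF quotient_imp_continuous_map[OF quo] U(1)] .
      then obtain V where V: "open V" "{x \<in> ?F. poly_class x \<in> U} = ?F \<inter> V" unfolding openin_open by auto
      obtain h where h: "continuous_on UNIV h" "h 0 = g"
        "\<And>\<epsilon>::real. \<epsilon> > 0 \<Longrightarrow> h \<epsilon> \<in> ?F \<and> \<not> (signed_form (h \<epsilon>) \<and> plucker_discr (coeff_at (h \<epsilon>)) \<le> 0)"
        using exit_direction[OF g] by blast
      have "open (h -` V)" using V(1) h(1) continuous_on_open_vimage[OF open_UNIV, of h] by simp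
      moreover have "0 \<in> h -` V" using h(2) U(2) V(2) g by auto
      ultimately obtain e where e: "e > 0" "ball 0 e \<subseteq> h -` V" unfolding open_contains_ball by blast
      have "e / 2 \<in> ball 0 e" using e(1) by (simp add: dist_real_def)
      then have "h (e / 2) \<in> V" using e(2) by blast
      moreover have hF: "h (e / 2) \<in> ?F" "\<not> (signed_form (h (e / 2)) \<and> plucker_discr (coeff_at (h (e / 2))) \<le> 0)"
        using h(3)[of "e / 2"] e(1) by auto
      ultimately have "poly_class (h (e / 2)) \<in> PL_box 2 4" using V(2) U(3) by blast
      then show False using poly_class_in_PL_box_iff[of "h (e / 2)"] hF by auto
    qed
    have minus: "- f = (- 1) *\<^sub>R f" by simp
    have "poly_class f = poly_class (- f)" unfolding poly_class_eq_iff minus by (intro exI[of _ "- 1"]) simp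
    moreover have "- f \<in> multiaffine_forms 2 4" unfolding minus by (rule scaleR_in_forms[OF f(1)])
    moreover have "plucker_discr (coeff_at (- f)) = plucker_discr (coeff_at f)"
      unfolding minus plucker_discr_scaleR by simp
    ultimately have "poly_class f \<notin> ?P interior_of PL_box 2 4"
      using s not_int[of f] not_int[of "- f"] f unfolding signed_form_def by auto
    then show "poly_class f \<in> boundary_PL_box 2 4" unfolding bd using PL by blast
  qed
qed

lemma quotient_map_onto_boundary_PL_box:
  "quotient_map (top_of_set {f \<in> multiaffine_forms 2 4 - {0}. signed_form f \<and> plucker_discr (coeff_at f) = 0})
     (subtopology (multiaffine_projective_space 2 4) (boundary_PL_box 2 4)) poly_class"
proof -
  let ?F = "multiaffine_forms 2 4 - {0}"
  let ?Z = "{f \<in> ?F. signed_form f \<and> plucker_discr (coeff_at f) = 0}"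
  have "{f \<in> topspace (top_of_set ?F). poly_class f \<in> boundary_PL_box 2 4} = ?Z"
    using poly_class_in_boundary_iff by auto
  moreover have "closedin (multiaffine_projective_space 2 4) (boundary_PL_box 2 4)"
    unfolding boundary_PL_box_def by (rule closedin_frontier_of)
  ultimately have "quotient_map (subtopology (top_of_set ?F) ?Z)
      (subtopology (multiaffine_projective_space 2 4) (boundary_PL_box 2 4)) poly_class"
    using quotient_map_restriction[OF quotient_map_poly_class] by blast
  moreover have "subtopology (top_of_set ?F) ?Z = top_of_set ?Z"
    unfolding subtopology_subtopology by (intro arg_cong[of _ _ top_of_set]) blast
  ultimately show ?thesis by simp
qed

lemma square_form_eq_0_iff: "square_form p = 0 \<longleftrightarrow> (\<forall>S\<in>pairs4. p S = 0)"
proof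
  assume z: "square_form p = 0"
  show "\<forall>S\<in>pairs4. p S = 0"
  proof
    fix S assume S: "S \<in> pairs4"
    have "(p S)\<^sup>2 = coeff_at (square_form p) S" by (rule square_form_coeff[OF S, symmetric])
    then show "p S = 0" by (simp add: z coeff_at_def)
  qed
qed (simp add: square_form_def multiaffine_poly_def)

section \<open>The real Grassmannian as a quotient\<close>

text \<open>The Grassmannian carries the subspace topology of projective space. As its cone is
  closed and saturated, this is also the quotient topology from the cone, where continuity is easier
  to handle.\<close>

lemma quotient_map_grassmannian:
  "quotient_map (top_of_set (minor_vectors 2 4 - {\<lambda>_. 0})) (grassmannian 2 4 :: (nat set \<Rightarrow> real) set topology) vector_class"
proof -
  let ?V = "{p. (\<forall>S. S \<notin> pairs4 \<longrightarrow> p S = 0) \<and> p \<noteq> (\<lambda>_. 0::real)}"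
  let ?W = "minor_vectors 2 4 - {\<lambda>_. 0::real}"
  let ?P = "plucker_projective_space 2 4 :: (nat set \<Rightarrow> real) set topology"
  have quo: "quotient_map (top_of_set ?V) ?P vector_class"
    unfolding plucker_projective_space_def vector_class_def by (rule quotient_map_orbit_space)
  have W: "p \<in> ?W \<longleftrightarrow> p \<in> ?V \<and> plucker_form p = 0" for p
    by (auto simp: minor_vectors_2_4_iff)
  have WV: "?W \<subseteq> ?V" using W by blast
  have sat: "{p \<in> topspace (top_of_set ?V). vector_class p \<in> vector_class ` ?W} = ?W"
  proof (intro equalityI subsetI)
    fix p assume p: "p \<in> {p \<in> topspace (top_of_set ?V). vector_class p \<in> vector_class ` ?W}"
    then have pV: "p \<in> ?V" by simp
    from p obtain q where q: "q \<in> ?W" "vector_class q = vector_class p" by auto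
    obtain c where c: "p = scale_vector c q" using q(2) unfolding vector_class_eq_iff by (elim exE conjE)
    have "plucker_form p = c\<^sup>2 * plucker_form q"
      by (simp add: c plucker_form_def scale_vector_def power2_eq_square algebra_simps)
    then have "plucker_form p = 0" using q(1) unfolding W by simp
    then show "p \<in> ?W" unfolding W using pV by blast
  next
    fix p assume "p \<in> ?W"
    then show "p \<in> {p \<in> topspace (top_of_set ?V). vector_class p \<in> vector_class ` ?W}"
      using subsetD[OF WV] by simp
  qed
  have "?W = {p \<in> ?V. plucker_form p = 0}" using W by blast
  moreover have "closedin (top_of_set ?V) {p \<in> ?V. plucker_form p = 0}"
    by (intro continuous_closedin_preimage_constant continuous_on_plucker_form)
  ultimately have "closedin (top_of_set ?V) ?W" by simp
  moreover have sub: "vector_class ` ?W \<subseteq> topspace ?P"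
    using image_mono[OF WV, of vector_class] quotient_imp_surjective_map[OF quo] by simp
  ultimately have "closedin ?P (vector_class ` ?W)"
    using quo[unfolded quotient_map_closedin, THEN conjunct2, rule_format, OF sub] unfolding sat by blast
  then have "quotient_map (subtopology (top_of_set ?V) ?W) (subtopology ?P (vector_class ` ?W)) vector_class"
    using quotient_map_restriction[OF quo sat] by blast
  moreover have "subtopology (top_of_set ?V) ?W = top_of_set ?W"
    using WV by (simp add: subtopology_subtopology Int_absorb1)
  ultimately show ?thesis unfolding grassmannian_def by simp
qed

lemma square_form_boundary:
  assumes "p \<in> minor_vectors 2 4 - {\<lambda>_. 0}"
  shows "square_form p \<in> multiaffine_forms 2 4 - {0}" "signed_form (square_form p)"
    "plucker_discr (coeff_at (square_form p)) = 0"
proof -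
  have p: "plucker_form p = 0" "\<And>S. S \<notin> pairs4 \<Longrightarrow> p S = 0" "p \<noteq> (\<lambda>_. 0)"
    using assms by (auto simp: minor_vectors_2_4_iff)
  have "square_form p \<noteq> 0"
  proof
    assume "square_form p = 0"
    then have "p = (\<lambda>_. 0)" using p(2) unfolding square_form_eq_0_iff by (intro ext) metis
    then show False using p(3) by simp
  qed
  then show "square_form p \<in> multiaffine_forms 2 4 - {0}" using square_form_in_forms by simp
  show "signed_form (square_form p)" by (simp add: signed_form_def nonneg_form_def square_form_coeff)
  show "plucker_discr (coeff_at (square_form p)) = 0" by (rule square_form_discr[OF p(1)])
qed

lemma quotient_map_square_form_projective:
  "quotient_map (top_of_set (minor_vectors 2 4 - {\<lambda>_. 0}))
     (subtopology (multiaffine_projective_space 2 4) (boundary_PL_box 2 4)) (\<lambda>p. poly_class (square_form p))"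
proof (rule quotient_map_by_closed_sections[OF quotient_map_onto_boundary_PL_box])
  let ?Z = "{f \<in> multiaffine_forms 2 4 - {0}. signed_form f \<and> plucker_discr (coeff_at f) = 0}"
  let ?W = "minor_vectors 2 4 - {\<lambda>_. 0::real}"
  let ?K = "\<lambda>k. {f \<in> ?Z. plucker_form (root_vector k (coeff_at f)) = 0}"
  let ?s = "\<lambda>k f. root_vector k (coeff_at f)"
  \<comment> \<open>For a nonpositive \<open>f\<close> the root vector reproduces
    \<open>- f\<close>, which represents the same class.\<close>
  have cls: "poly_class (square_form (?s k f)) = poly_class f" if "f \<in> ?Z" for k f
  proof (cases "nonneg_form f")
    case True
    then show ?thesis using that by (simp add: square_form_root_vector)
  next
    case False
    then have nn: "nonneg_form (- f)" using that by (simp add: signed_form_def)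
    have minus: "- f = (- 1) *\<^sub>R f" by simp
    have "- f \<in> multiaffine_forms 2 4" unfolding minus by (rule scaleR_in_forms) (use that in simp)
    then have "square_form (?s k (- f)) = - f" by (rule square_form_root_vector[OF _ nn])
    moreover have "?s k (- f) = ?s k f" by (rule ext) (simp add: root_vector_def coeff_at_uminus)
    ultimately have "square_form (?s k f) = - f" by simp
    moreover have "poly_class f = poly_class (- f)"
      unfolding poly_class_eq_iff minus by (intro exI[of _ "- 1"]) simp
    ultimately show ?thesis by simp
  qed
  show "continuous_map (top_of_set ?W)
     (subtopology (multiaffine_projective_space 2 4) (boundary_PL_box 2 4)) (\<lambda>p. poly_class (square_form p))"
  proof -
    have "continuous_map (top_of_set ?W) (top_of_set ?Z) square_form"
      using square_form_boundary by (simp add: continuous_on_square_form Pi_iff)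
    from continuous_map_compose[OF this quotient_imp_continuous_map[OF quotient_map_onto_boundary_PL_box]]
    show ?thesis by (simp add: o_def)
  qed
  show "finite {..<3::nat}" by simp
  show "closedin (top_of_set ?Z) (?K k)" for k
    by (intro continuous_closedin_preimage_constant continuous_on_plucker_form_root_vector)
  show "topspace (top_of_set ?Z) \<subseteq> (\<Union>k\<in>{..<3}. ?K k)"
    unfolding topspace_euclidean_subtopology
    by (rule root_vector_closed_cover) (auto simp: signed_form_def nonneg_form_def coeff_at_uminus)
  show "continuous_map (subtopology (top_of_set ?Z) (?K k)) (top_of_set ?W) (?s k)" for k
  proof -
    have "?s k f \<in> ?W" if f: "f \<in> ?K k" for f
    proof -
      obtain S where "S \<in> pairs4" "coeff_at f S \<noteq> 0" using nonzero_form_coeff[of f] f by auto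
      then have "?s k f S \<noteq> 0" by (simp add: root_vector_def root_sign_def)
      then have "?s k f \<noteq> (\<lambda>_. 0)" by metis
      then show ?thesis using f by (simp add: minor_vectors_2_4_iff root_vector_zero_outside)
    qed
    moreover have "subtopology (top_of_set ?Z) (?K k) = top_of_set (?K k)"
      unfolding subtopology_subtopology by (intro arg_cong[of _ _ top_of_set]) blast
    ultimately show ?thesis by (simp add: continuous_on_root_vector Pi_iff)
  qed
  show "poly_class (square_form (?s k f)) = poly_class f" if "f \<in> ?K k" for k f
    using cls that by simp
qed

lemma square_form_scale_vector: "square_form (scale_vector c p) = c\<^sup>2 *\<^sub>R square_form p"
proof (rule multiaffine_forms_eqI[OF square_form_in_forms scaleR_in_forms[OF square_form_in_forms]])
  fix S assume "S \<in> pairs4"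
  then show "coeff_at (square_form (scale_vector c p)) S = coeff_at (c\<^sup>2 *\<^sub>R square_form p) S"
    by (simp add: scaleR_coeff_at square_form_coeff scale_vector_def power_mult_distrib)
qed

lemma square_form_scale_signs:
  assumes "\<forall>i<4. t i \<in> {-1, 1}"
  shows "square_form (scale_columns t p) = square_form p"
proof (rule multiaffine_forms_eqI[OF square_form_in_forms square_form_in_forms])
  fix S assume S: "S \<in> pairs4"
  have "(\<Prod>i\<in>S. (t i)\<^sup>2) = 1"
  proof (rule prod.neutral, rule ballI)
    fix i assume "i \<in> S"
    then have "t i \<in> {-1, 1}" using S assms by (auto simp: ksubsets_def)
    then show "(t i)\<^sup>2 = 1" by auto
  qed
  then show "coeff_at (square_form (scale_columns t p)) S = coeff_at (square_form p) S"
    using S by (simp add: square_form_coeff scale_columns_def power_mult_distrib prod_power_distrib)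
qed

text \<open>The scalar relating the two forms is positive, because both have squares as coefficients
  and are nonzero. Its square root is absorbed into \<open>p\<close>, and the vectors then have
  equal squares; the leftover sign disappears in the projective class.\<close>

lemma projective_class_eq_iff:
  fixes p q :: "nat set \<Rightarrow> real"
  assumes p: "p \<in> minor_vectors 2 4 - {\<lambda>_. 0}" and q: "q \<in> minor_vectors 2 4 - {\<lambda>_. 0}"
  shows "poly_class (square_form p) = poly_class (square_form q) \<longleftrightarrow>
    (\<exists>t. (\<forall>i<4. t i \<in> {-1, 1}) \<and> vector_class q = vector_class (scale_columns t p))"
proof
  assume "poly_class (square_form p) = poly_class (square_form q)"
  then obtain c where c: "c \<noteq> 0" "square_form q = c *\<^sub>R square_form p"
    unfolding poly_class_eq_iff by (elim exE conjE)
  have qc: "(q S)\<^sup>2 = c * (p S)\<^sup>2" if "S \<in> pairs4" for S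
    using square_form_coeff[OF that, of q] square_form_coeff[OF that, of p] by (simp add: c(2) scaleR_coeff_at)
  have "square_form q \<noteq> 0" using square_form_boundary(1)[OF q] by simp
  then obtain S where S: "S \<in> pairs4" "q S \<noteq> 0" unfolding square_form_eq_0_iff by blast
  have "c * (p S)\<^sup>2 > 0" using qc[OF S(1)] S(2) by (metis zero_less_power2)
  then have cpos: "c > 0" by (simp add: zero_less_mult_iff)
  let ?p = "scale_vector (sqrt c) p"
  have "plucker_form ?p = (sqrt c)\<^sup>2 * plucker_form p"
    unfolding power2_eq_square by (simp only: plucker_form_def scale_vector_def algebra_simps)
  then have p': "?p \<in> minor_vectors 2 4"
    using p by (simp add: minor_vectors_2_4_iff) (simp add: scale_vector_def)
  have q': "q \<in> minor_vectors 2 4" using q by simp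
  have sqeq: "(q S)\<^sup>2 = (?p S)\<^sup>2" if "S \<in> pairs4" for S
    using qc[OF that] cpos by (simp add: scale_vector_def power_mult_distrib)
  have "\<exists>s t. s \<in> {-1,1} \<and> (\<forall>i<4. t i \<in> {-1,1}) \<and> q = scale_vector s (scale_columns t ?p)"
    by (rule plucker_vectors_equal_squares[OF p' q']) (rule sqeq)
  then obtain s t where st: "s \<in> {-1,1}" "\<forall>i<4. t i \<in> {-1,1}" "q = scale_vector s (scale_columns t ?p)"
    by (elim exE conjE)
  have "s * sqrt c \<noteq> 0" using st(1) cpos by auto
  moreover have "q = scale_vector (s * sqrt c) (scale_columns t p)"
    unfolding st(3) by (simp add: scale_vector_def scale_columns_def ac_simps)
  ultimately have "vector_class (scale_columns t p) = vector_class q"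
    unfolding vector_class_eq_iff by (intro exI[of _ "s * sqrt c"] conjI)
  then show "\<exists>t. (\<forall>i<4. t i \<in> {-1, 1}) \<and> vector_class q = vector_class (scale_columns t p)"
    using st(2) by (intro exI[of _ t]) simp
next
  assume "\<exists>t. (\<forall>i<4. t i \<in> {-1, 1}) \<and> vector_class q = vector_class (scale_columns t p)"
  then obtain t where t: "\<forall>i<4. t i \<in> {-1, 1}" "vector_class (scale_columns t p) = vector_class q"
    by (elim exE conjE) simp
  from t(2) obtain c where c: "c \<noteq> 0" "q = scale_vector c (scale_columns t p)"
    unfolding vector_class_eq_iff by (elim exE conjE)
  have "square_form q = c\<^sup>2 *\<^sub>R square_form p"
    unfolding c(2) square_form_scale_vector square_form_scale_signs[OF t(1)] ..
  then show "poly_class (square_form p) = poly_class (square_form q)"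
    unfolding poly_class_eq_iff using c(1) by (intro exI[of _ "c\<^sup>2"]) simp
qed

lemma grassmannian_quotient_map:
  "\<exists>\<psi>. (\<forall>p \<in> minor_vectors 2 4 - {\<lambda>_. 0} :: (nat set \<Rightarrow> real) set.
          \<psi> (vector_class p) = poly_class (square_form p)) \<and>
       quotient_map (grassmannian 2 4 :: (nat set \<Rightarrow> real) set topology)
         (subtopology (multiaffine_projective_space 2 4) (boundary_PL_box 2 4)) \<psi>"
proof -
  let ?W = "minor_vectors 2 4 - {\<lambda>_. 0} :: (nat set \<Rightarrow> real) set"
  let ?X = "grassmannian 2 4 :: (nat set \<Rightarrow> real) set topology"
  let ?Y = "subtopology (multiaffine_projective_space 2 4) (boundary_PL_box 2 4)"
  let ?g = "\<lambda>p. poly_class (square_form p)"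
  note quo = quotient_map_grassmannian and g = quotient_map_square_form_projective
  have eq: "?g p = ?g q" if pq: "vector_class p = vector_class q" for p q :: "nat set \<Rightarrow> real"
  proof -
    obtain c where c: "c \<noteq> 0" "q = scale_vector c p" using pq unfolding vector_class_eq_iff by (elim exE conjE)
    show ?thesis unfolding poly_class_eq_iff c(2) square_form_scale_vector
      using c(1) by (intro exI[of _ "c\<^sup>2"]) simp
  qed
  obtain \<psi> where \<psi>: "continuous_map ?X ?Y \<psi>" "\<And>p. p \<in> ?W \<Longrightarrow> \<psi> (vector_class p) = ?g p"
    using quotient_map_lift_exists[OF quo quotient_imp_continuous_map[OF g]] eq
    by (metis (no_types, lifting) topspace_euclidean_subtopology)
  have "quotient_map (top_of_set ?W) ?Y (\<psi> \<circ> vector_class)"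
    by (rule quotient_map_eq[OF g]) (simp add: \<psi>(2))
  then have "quotient_map ?X ?Y \<psi>"
    by (rule quotient_map_from_composition[OF quotient_imp_continuous_map[OF quo] \<psi>(1)])
  then show ?thesis using \<psi>(2) by (intro exI[of _ \<psi>]) simp
qed

theorem theorem5p1:
  fixes n d :: nat and \<B> :: "nat set set"
  assumes M: "matroid_bases n d \<B>"
  shows
    "sq_abs_poly \<B> ` (realizations d n \<B> :: (nat set \<Rightarrow> complex) set) \<subseteq> L_mat n d \<B>
     \<and> (\<forall>f \<in> sq_abs_poly \<B> ` (realizations d n \<B> :: (nat set \<Rightarrow> complex) set). stable_mpoly n f)
     \<and> (has_uniform_minor n \<B> 2 4 \<longrightarrow>
          sq_abs_poly \<B> ` (realizations d n \<B> :: (nat set \<Rightarrow> real) set) \<subseteq> boundary_L_mat n d \<B>)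
     \<and> (has_uniform_minor n \<B> 2 5 \<longrightarrow>
          sq_abs_poly \<B> ` (realizations d n \<B> :: (nat set \<Rightarrow> complex) set) \<subseteq> boundary_L_mat n d \<B>)
     \<and> (n = 4 \<and> d = 2 \<and> \<B> = ksubsets 4 2 \<longrightarrow>
          (\<exists>\<phi>. (\<forall>p \<in> realizations d n \<B> :: (nat set \<Rightarrow> real) set.
                  \<phi> (realization_class n p) = L_class n (sq_abs_poly \<B> p)) \<and>
               homeomorphic_map
                 (realization_space d n \<B> :: (nat set \<Rightarrow> real) set topology)
                 (subtopology (reduced_L_mat n d \<B>) (boundary_reduced_L_mat n d \<B>)) \<phi>))
     \<and> (\<exists>\<psi>. (\<forall>p \<in> minor_vectors 2 4 - {\<lambda>_. 0} :: (nat set \<Rightarrow> real) set.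
                \<psi> (vector_class p) = poly_class (multiaffine_poly (ksubsets 4 2) (\<lambda>S. (p S)\<^sup>2))) \<and>
             quotient_map
               (grassmannian 2 4 :: (nat set \<Rightarrow> real) set topology)
               (subtopology (multiaffine_projective_space 2 4) (boundary_PL_box 2 4)) \<psi> \<and>
             (\<forall>p \<in> minor_vectors 2 4 - {\<lambda>_. 0} :: (nat set \<Rightarrow> real) set.
              \<forall>q \<in> minor_vectors 2 4 - {\<lambda>_. 0}.
                \<psi> (vector_class p) = \<psi> (vector_class q) \<longleftrightarrow>
                (\<exists>t. (\<forall>i<4. t i \<in> {-1, 1}) \<and> vector_class q = vector_class (scale_columns t p))))"
proof (intro conjI impI ballI)
  show "sq_abs_poly \<B> ` (realizations d n \<B> :: (nat set \<Rightarrow> complex) set) \<subseteq> L_mat n d \<B>"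
    using sq_abs_poly_in_L_mat_complex[OF M] by blast
  show "stable_mpoly n f"
    if "f \<in> sq_abs_poly \<B> ` (realizations d n \<B> :: (nat set \<Rightarrow> complex) set)" for f
    using that stable_sq_abs_poly[OF M] by blast
  show "sq_abs_poly \<B> ` (realizations d n \<B> :: (nat set \<Rightarrow> real) set) \<subseteq> boundary_L_mat n d \<B>"
    if "has_uniform_minor n \<B> 2 4"
    using sq_abs_poly_boundary_real[OF M _ that] by blast
  show "sq_abs_poly \<B> ` (realizations d n \<B> :: (nat set \<Rightarrow> complex) set) \<subseteq> boundary_L_mat n d \<B>"
    if "has_uniform_minor n \<B> 2 5"
    using sq_abs_poly_boundary_complex[OF M _ that] by blast
  show "\<exists>\<phi>. (\<forall>p \<in> realizations d n \<B> :: (nat set \<Rightarrow> real) set.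
              \<phi> (realization_class n p) = L_class n (sq_abs_poly \<B> p)) \<and>
           homeomorphic_map
             (realization_space d n \<B> :: (nat set \<Rightarrow> real) set topology)
             (subtopology (reduced_L_mat n d \<B>) (boundary_reduced_L_mat n d \<B>)) \<phi>"
    if eq: "n = 4 \<and> d = 2 \<and> \<B> = ksubsets 4 2"
  proof -
    have "n = 4" "d = 2" "\<B> = ksubsets 4 2" using eq by auto
    then show ?thesis using realization_space_homeomorphism by (simp only:)
  qed
  obtain \<psi> where \<psi>: "\<And>p :: nat set \<Rightarrow> real. p \<in> minor_vectors 2 4 - {\<lambda>_. 0} \<Longrightarrow> \<psi> (vector_class p) = poly_class (square_form p)"
    "quotient_map (grassmannian 2 4 :: (nat set \<Rightarrow> real) set topology)
         (subtopology (multiaffine_projective_space 2 4) (boundary_PL_box 2 4)) \<psi>"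
    using grassmannian_quotient_map by (elim exE conjE) (simp only: Ball_def, metis)
  show "\<exists>\<psi>. (\<forall>p \<in> minor_vectors 2 4 - {\<lambda>_. 0} :: (nat set \<Rightarrow> real) set.
                \<psi> (vector_class p) = poly_class (multiaffine_poly (ksubsets 4 2) (\<lambda>S. (p S)\<^sup>2))) \<and>
             quotient_map
               (grassmannian 2 4 :: (nat set \<Rightarrow> real) set topology)
               (subtopology (multiaffine_projective_space 2 4) (boundary_PL_box 2 4)) \<psi> \<and>
             (\<forall>p \<in> minor_vectors 2 4 - {\<lambda>_. 0} :: (nat set \<Rightarrow> real) set.
              \<forall>q \<in> minor_vectors 2 4 - {\<lambda>_. 0}.
                \<psi> (vector_class p) = \<psi> (vector_class q) \<longleftrightarrow>
                (\<exists>t. (\<forall>i<4. t i \<in> {-1, 1}) \<and> vector_class q = vector_class (scale_columns t p)))"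
  proof (intro exI[of _ \<psi>] conjI ballI)
    show "\<psi> (vector_class p) = poly_class (multiaffine_poly (ksubsets 4 2) (\<lambda>S. (p S)\<^sup>2))"
      if "p \<in> minor_vectors 2 4 - {\<lambda>_. 0}" for p
      using \<psi>(1)[OF that] unfolding square_form_def .
    show "\<psi> (vector_class p) = \<psi> (vector_class q) \<longleftrightarrow>
        (\<exists>t. (\<forall>i<4. t i \<in> {-1, 1}) \<and> vector_class q = vector_class (scale_columns t p))"
      if "p \<in> minor_vectors 2 4 - {\<lambda>_. 0}" "q \<in> minor_vectors 2 4 - {\<lambda>_. 0}" for p q
      unfolding \<psi>(1)[OF that(1)] \<psi>(1)[OF that(2)] by (rule projective_class_eq_iff[OF that])
  qed (rule \<psi>(2))
qed

end
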